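(* Let $(M,\nabla)$ be a connected smooth $n$-dimensional manifold ($n\ge 2$) with a symmetric (torsion-free) linear connection $\nabla$. Let $a>0$ and $b\neq 0$ be real constants, let the total space $T^*M$ be endowed with the proper natural Riemann extension $\overline g$ with constants $a,b$, and let $P$ be the endomorphism field of $T(T^*M)$ determined by $$PX^C=X^C+2C(\nabla X)-\frac{b}{a}X^V W,\qquad P\alpha^V=-\alpha^V$$ for all vector fields $X$ and all differential 1-forms $\alpha$ on $M$. Then $(T^*M,P,\overline g)$ is an almost para-Hermitian manifold. Moreover: (i) if $M$ is not flat (resp. $M$ is flat), then $(T^*M,P,\overline g)$ is almost para-Kähler (resp. para-Kähler); (ii) $P$ is harmonic on $(T^*M,\overline g)$.
   Context: **Cotangent bundle and lifts.** Points of $T^*M$ are pairs $(x,\omega)$, $x\in M$, $\omega\in T^*_xM$; $p:T^*M\to M$ is the projection. A chart $(x^1,\dots,x^n)$ of $M$ induces coordinates $(x^1,\dots,x^n,\omega_1,\dots,\omega_n)$ on $T^*M$, with $\omega=\omega_i\,dx^i$; put $\partial_i=\partial/\partial x^i$, $\partial_{i*}=\partial/\partial\omega_i$. The Liouville type vector field is $W=\sum_i\omega_i\partial_{i*}$. For a vector field $X=X^i\partial_i$ on $M$: - the vertical lift $X^V$ is the function $X^V(x,\omega)=\omega(X_x)$ on $T^*M$; - the complete lift $X^C$ is the vector field on $T^*M$ with $X^C(Z^V)=[X,Z]^V$ for all vector fields $Z$ on $M$; locally $X^C=\sum_i X^i\partial_i-\sum_{h,i}\omega_h(\partial_iX^h)\partial_{i*}$.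 For a 1-form $\alpha=\sum_i\alpha_i dx^i$ on $M$, the vertical lift $\alpha^V$ is the vector field $\alpha^V=\sum_i\alpha_i\partial_{i*}$ on $T^*M$. For a $(1,1)$ tensor field $T$ on $M$, the contracted vector field $C(T)$ on $T^*M$ is determined by $C(T)(Z^V)_{(x,\omega)}=\omega((TZ)_x)$ for all vector fields $Z$ on $M$; it is vertical, with $C(T)_{(x,\omega)}$ being the vertical vector corresponding to the covector $\omega\circ T_x$. Here $\nabla X$ denotes the $(1,1)$ tensor field $Z\mapsto\nabla_ZX$. **Natural Riemann extension.** For constants $a>0$ and $b$, it is the semi-Riemannian metric $\overline g$ on $T^*M$ of signature $(n,n)$ given by $$\overline g_{(x,\omega)}(X^C,Y^C)=-a\,\omega(\nabla_{X_x}Y+\nabla_{Y_x}X)+b\,\omega(X_x)\omega(Y_x),$$ $$\overline g_{(x,\omega)}(X^C,\alpha^V)=a\,\alpha_x(X_x),\qquad \overline g_{(x,\omega)}(\alpha^V,\beta^V)=0$$ for all vector fields $X,Y$ and 1-forms $\alpha,\beta$ on $M$. It is called proper if $b\ne0$. **Para-Hermitian notions.** An almost para-complex structure on a $2n$-dimensional manifold $N$ is a $(1,1)$ tensor field $P$ with $P\neq\pm\mathrm{Id}$, $P^2=\mathrm{Id}$ whose $\pm1$-eigendistributions have the same rank. $(N,P,g)$ is almost para-Hermitian if $P$ is an almost para-complex structure and $g$ is a semi-Riemannian metric with $g(PX,PY)=-g(X,Y)$. Put $\Omega(X,Y)=g(X,PY)$. $(N,P,g)$ is para-Kähler if $\nabla^gP=0$,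 where $\nabla^g$ is the Levi-Civita connection of $g$, and almost para-Kähler if $d\Omega=0$. **Flatness.** $M$ is flat if the curvature tensor $R$ of $\nabla$ vanishes identically. **Harmonicity.** A $(1,1)$ tensor field $T$ on a semi-Riemannian manifold $(N,h)$ is harmonic if $T$, viewed as an endomorphism field $T:(TN,h^C)\to(TN,h^C)$, is a harmonic map, where $h^C$ is the complete lift of $h$ to $TN$ (in induced coordinates $(x^i,y^i)$: $h^C=y^k(\partial_kh_{ij})dx^idx^j+2h_{ij}dx^idy^j$). By a known result this is equivalent to $\delta T=0$, where $\delta T=\mathrm{trace}_h\{(X,Y)\mapsto(\nabla^h_XT)Y\}$ and $\nabla^h$ is the Levi-Civita connection of $h$. *)

theory Defs
  imports "HOL-Analysis.Analysis"
begin

section \<open>Smooth maps between Euclidean spaces\<close>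

text \<open>The set \<open>S\<close> is meant to be open, so that all derivatives are full Frechet derivatives.\<close>

primrec Ck_on :: "nat \<Rightarrow> ('a::euclidean_space \<Rightarrow> 'b::real_normed_vector) \<Rightarrow> 'a set \<Rightarrow> bool" where
  "Ck_on 0 f S \<longleftrightarrow> continuous_on S f"
| "Ck_on (Suc k) f S \<longleftrightarrow>
     (\<forall>x\<in>S. f differentiable (at x)) \<and> (\<forall>v. Ck_on k (\<lambda>x. frechet_derivative f (at x) v) S)"

definition smooth_on :: "('a::euclidean_space \<Rightarrow> 'b::real_normed_vector) \<Rightarrow> 'a set \<Rightarrow> bool" where
  "smooth_on f S \<longleftrightarrow> (\<forall>k. Ck_on k f S)"


section \<open>Smooth manifolds\<close>

text \<open>
  A manifold is given by an indexed smooth atlas \<open>(U\<^sub>i, \<phi>\<^sub>i)\<close>, \<open>i \<in> Idx N\<close>, with \<open>U\<^sub>i = Dom N i\<close>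
  and \<open>\<phi>\<^sub>i = Crd N i\<close>. The underlying set is the union of the chart domains, and the topology is
  the one determined by the atlas. The atlas need not be maximal. The tangent and cotangent
  bundles below carry atlases with the same index set.
\<close>

record ('i, 'p, 'e) atlas =
  Idx :: "'i set"
  Dom :: "'i \<Rightarrow> 'p set"
  Crd :: "'i \<Rightarrow> 'p \<Rightarrow> 'e"

definition carrier :: "('i,'p,'e) atlas \<Rightarrow> 'p set" where
  "carrier N = (\<Union>i\<in>Idx N. Dom N i)"

definition Img :: "('i,'p,'e) atlas \<Rightarrow> 'i \<Rightarrow> 'e set" where
  "Img N i = Crd N i ` Dom N i"

definition Prm :: "('i,'p,'e) atlas \<Rightarrow> 'i \<Rightarrow> 'e \<Rightarrow> 'p" where
  "Prm N i = inv_into (Dom N i) (Crd N i)"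

definition charts_at :: "('i,'p,'e) atlas \<Rightarrow> 'p \<Rightarrow> 'i set" where
  "charts_at N p = {i \<in> Idx N. p \<in> Dom N i}"

text \<open>Chart-independent quantities at \<open>p\<close> are evaluated in this arbitrarily chosen chart.\<close>

definition chart_at :: "('i,'p,'e) atlas \<Rightarrow> 'p \<Rightarrow> 'i" where
  "chart_at N p = (SOME i. i \<in> charts_at N p)"

definition smooth_atlas :: "('i,'p,'e::euclidean_space) atlas \<Rightarrow> bool" where
  "smooth_atlas N \<longleftrightarrow>
     (\<forall>i\<in>Idx N. inj_on (Crd N i) (Dom N i)) \<and>
     (\<forall>i\<in>Idx N. \<forall>j\<in>Idx N.
        open (Crd N i ` (Dom N i \<inter> Dom N j)) \<and>
        smooth_on (Crd N j \<circ> Prm N i) (Crd N i ` (Dom N i \<inter> Dom N j)))"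

definition atlas_topology :: "('i,'p,'e::euclidean_space) atlas \<Rightarrow> 'p topology" where
  "atlas_topology N =
     topology (\<lambda>U. U \<subseteq> carrier N \<and> (\<forall>i\<in>Idx N. open (Crd N i ` (U \<inter> Dom N i))))"

definition smooth_manifold :: "('i,'p,'e::euclidean_space) atlas \<Rightarrow> bool" where
  "smooth_manifold N \<longleftrightarrow>
     carrier N \<noteq> {} \<and> smooth_atlas N \<and>
     Hausdorff_space (atlas_topology N) \<and> second_countable (atlas_topology N)"

definition smooth_map ::
  "('i,'p,'e::euclidean_space) atlas \<Rightarrow> ('j,'q,'f::euclidean_space) atlas \<Rightarrow> ('p \<Rightarrow> 'q) \<Rightarrow> bool" where
  "smooth_map N N' F \<longleftrightarrow>
     F ` carrier N \<subseteq> carrier N' \<and>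
     (\<forall>i\<in>Idx N. \<forall>j\<in>Idx N'.
        open (Crd N i ` (Dom N i \<inter> F -` Dom N' j)) \<and>
        smooth_on (Crd N' j \<circ> F \<circ> Prm N i) (Crd N i ` (Dom N i \<inter> F -` Dom N' j)))"

definition smooth_function :: "('i,'p,'e::euclidean_space) atlas \<Rightarrow> ('p \<Rightarrow> real) \<Rightarrow> bool" where
  "smooth_function N f \<longleftrightarrow> (\<forall>i\<in>Idx N. smooth_on (f \<circ> Prm N i) (Img N i))"


section \<open>Tangent vectors, covectors, vector fields\<close>

text \<open>
  A tangent vector at \<open>p\<close> is the family of its components in the charts at \<open>p\<close>, related by the
  Jacobians of the transition maps, and set to \<open>0\<close> at all other indices.
\<close>

type_synonym ('i, 'e) tvec = "'i \<Rightarrow> 'e"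
type_synonym ('i, 'p, 'e) vfield = "'p \<Rightarrow> ('i, 'e) tvec"
type_synonym ('i, 'e) covec = "('i, 'e) tvec \<Rightarrow> real"

definition transition_deriv ::
  "('i,'p,'e::euclidean_space) atlas \<Rightarrow> 'p \<Rightarrow> 'i \<Rightarrow> 'i \<Rightarrow> 'e \<Rightarrow> 'e" where
  "transition_deriv N p i j = frechet_derivative (Crd N j \<circ> Prm N i) (at (Crd N i p))"

definition tangent_space :: "('i,'p,'e::euclidean_space) atlas \<Rightarrow> 'p \<Rightarrow> ('i,'e) tvec set" where
  "tangent_space N p =
     {v. (\<forall>i\<in>charts_at N p. \<forall>j\<in>charts_at N p. v j = transition_deriv N p i j (v i)) \<and>
         (\<forall>i. i \<notin> charts_at N p \<longrightarrow> v i = 0)}"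

text \<open>The tangent vector at \<open>p\<close> with components \<open>u\<close> in chart \<open>i\<close>; for \<open>u \<in> Basis\<close> this is a
  coordinate vector \<open>\<partial>\<^sub>k\<close>.\<close>

definition chart_vec :: "('i,'p,'e::euclidean_space) atlas \<Rightarrow> 'i \<Rightarrow> 'p \<Rightarrow> 'e \<Rightarrow> ('i,'e) tvec" where
  "chart_vec N i p u = (\<lambda>j. if j \<in> charts_at N p then transition_deriv N p i j u else 0)"

definition lincomb :: "real \<Rightarrow> ('i,'e::real_vector) tvec \<Rightarrow> real \<Rightarrow> ('i,'e) tvec \<Rightarrow> ('i,'e) tvec" where
  "lincomb r u s v = (\<lambda>i. r *\<^sub>R u i + s *\<^sub>R v i)"

definition cotangent_space :: "('i,'p,'e::euclidean_space) atlas \<Rightarrow> 'p \<Rightarrow> ('i,'e) covec set" where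
  "cotangent_space N p =
     {\<omega>. (\<forall>u\<in>tangent_space N p. \<forall>v\<in>tangent_space N p. \<forall>r s.
             \<omega> (lincomb r u s v) = r * \<omega> u + s * \<omega> v) \<and>
         (\<forall>v. v \<notin> tangent_space N p \<longrightarrow> \<omega> v = 0)}"

text \<open>The components \<open>\<omega>\<^sub>k = \<omega>(\<partial>\<^sub>k)\<close> of a covector in chart \<open>i\<close>.\<close>

definition covec_crd :: "('i,'p,'e::euclidean_space) atlas \<Rightarrow> 'i \<Rightarrow> 'p \<Rightarrow> ('i,'e) covec \<Rightarrow> 'e" where
  "covec_crd N i p \<omega> = (\<Sum>c\<in>Basis. \<omega> (chart_vec N i p c) *\<^sub>R c)"

definition vfield_crd ::
  "('i,'p,'e) atlas \<Rightarrow> 'i \<Rightarrow> ('i,'p,'e) vfield \<Rightarrow> 'e \<Rightarrow> 'e" where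
  "vfield_crd N i X y = X (Prm N i y) i"

definition vector_fields :: "('i,'p,'e::euclidean_space) atlas \<Rightarrow> ('i,'p,'e) vfield set" where
  "vector_fields N =
     {X. (\<forall>p\<in>carrier N. X p \<in> tangent_space N p) \<and>
         (\<forall>p. p \<notin> carrier N \<longrightarrow> X p = (\<lambda>_. 0)) \<and>
         (\<forall>i\<in>Idx N. smooth_on (vfield_crd N i X) (Img N i))}"

definition one_forms :: "('i,'p,'e::euclidean_space) atlas \<Rightarrow> ('p \<Rightarrow> ('i,'e) covec) set" where
  "one_forms N =
     {\<alpha>. (\<forall>p\<in>carrier N. \<alpha> p \<in> cotangent_space N p) \<and>
         (\<forall>i\<in>Idx N. smooth_on (\<lambda>y. covec_crd N i (Prm N i y) (\<alpha> (Prm N i y))) (Img N i))}"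

definition dir_deriv ::
  "('i,'p,'e::euclidean_space) atlas \<Rightarrow> 'p \<Rightarrow> ('i,'e) tvec \<Rightarrow> ('p \<Rightarrow> real) \<Rightarrow> real" where
  "dir_deriv N p v f =
     (let i = chart_at N p in frechet_derivative (f \<circ> Prm N i) (at (Crd N i p)) (v i))"

text \<open>\<open>[X,Y]\<^sup>k = X\<^sup>l \<partial>\<^sub>l Y\<^sup>k - Y\<^sup>l \<partial>\<^sub>l X\<^sup>k\<close> in every chart.\<close>

definition bracket ::
  "('i,'p,'e::euclidean_space) atlas \<Rightarrow> ('i,'p,'e) vfield \<Rightarrow> ('i,'p,'e) vfield \<Rightarrow> ('i,'p,'e) vfield" where
  "bracket N X Y p =
     (\<lambda>i. if i \<in> charts_at N p
          then frechet_derivative (vfield_crd N i Y) (at (Crd N i p)) (X p i)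
             - frechet_derivative (vfield_crd N i X) (at (Crd N i p)) (Y p i)
          else 0)"


section \<open>Tensor fields of type (1,1) and (0,2)\<close>

text \<open>Both are given pointwise as (multi)linear maps on tangent spaces; their values on
  arguments which are not tangent vectors are irrelevant.\<close>

type_synonym ('i, 'p, 'e) endo = "'p \<Rightarrow> ('i,'e) tvec \<Rightarrow> ('i,'e) tvec"
type_synonym ('i, 'p, 'e) bform = "'p \<Rightarrow> ('i,'e) tvec \<Rightarrow> ('i,'e) tvec \<Rightarrow> real"

definition endo_field :: "('i,'p,'e::euclidean_space) atlas \<Rightarrow> ('i,'p,'e) endo \<Rightarrow> bool" where
  "endo_field N T \<longleftrightarrow>
     (\<forall>p\<in>carrier N. \<forall>u\<in>tangent_space N p. \<forall>v\<in>tangent_space N p.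
        T p u \<in> tangent_space N p \<and>
        (\<forall>r s. T p (lincomb r u s v) = lincomb r (T p u) s (T p v))) \<and>
     (\<forall>i\<in>Idx N. \<forall>u. smooth_on (\<lambda>y. T (Prm N i y) (chart_vec N i (Prm N i y) u) i) (Img N i))"

definition endo_apply ::
  "('i,'p,'e::euclidean_space) atlas \<Rightarrow> ('i,'p,'e) endo \<Rightarrow> ('i,'p,'e) vfield \<Rightarrow> ('i,'p,'e) vfield" where
  "endo_apply N T X p = (if p \<in> carrier N then T p (X p) else (\<lambda>_. 0))"

definition bform_crd ::
  "('i,'p,'e::euclidean_space) atlas \<Rightarrow> 'i \<Rightarrow> ('i,'p,'e) bform \<Rightarrow> 'e \<Rightarrow> 'e \<Rightarrow> 'e \<Rightarrow> real" where
  "bform_crd N i g y u v =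
     g (Prm N i y) (chart_vec N i (Prm N i y) u) (chart_vec N i (Prm N i y) v)"

definition bform_field :: "('i,'p,'e::euclidean_space) atlas \<Rightarrow> ('i,'p,'e) bform \<Rightarrow> bool" where
  "bform_field N g \<longleftrightarrow>
     (\<forall>p\<in>carrier N. \<forall>u\<in>tangent_space N p. \<forall>v\<in>tangent_space N p. \<forall>w\<in>tangent_space N p. \<forall>r s.
        g p (lincomb r u s v) w = r * g p u w + s * g p v w \<and>
        g p w (lincomb r u s v) = r * g p w u + s * g p w v) \<and>
     (\<forall>i\<in>Idx N. \<forall>u v. smooth_on (\<lambda>y. bform_crd N i g y u v) (Img N i))"


section \<open>Semi-Riemannian metrics and linear connections\<close>

text \<open>Signature \<open>(r,s)\<close> means that every tangent space has a pseudo-orthonormal basis with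
  \<open>r\<close> vectors of square \<open>1\<close> and \<open>s\<close> vectors of square \<open>-1\<close>; nondegeneracy follows.\<close>

definition metric_of_signature ::
  "('i,'p,'e::euclidean_space) atlas \<Rightarrow> nat \<Rightarrow> nat \<Rightarrow> ('i,'p,'e) bform \<Rightarrow> bool" where
  "metric_of_signature N r s g \<longleftrightarrow>
     bform_field N g \<and>
     (\<forall>p\<in>carrier N. \<forall>u\<in>tangent_space N p. \<forall>v\<in>tangent_space N p. g p u v = g p v u) \<and>
     r + s = DIM('e) \<and>
     (\<forall>p\<in>carrier N. \<exists>A B. A \<subseteq> tangent_space N p \<and> B \<subseteq> tangent_space N p \<and> finite A \<and> finite B \<and>
        card A = r \<and> card B = s \<and>
        (\<forall>u\<in>A. g p u u = 1) \<and> (\<forall>u\<in>B. g p u u = -1) \<and>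
        (\<forall>u\<in>A \<union> B. \<forall>v\<in>A \<union> B. u \<noteq> v \<longrightarrow> g p u v = 0))"

definition semi_riemannian_metric ::
  "('i,'p,'e::euclidean_space) atlas \<Rightarrow> ('i,'p,'e) bform \<Rightarrow> bool" where
  "semi_riemannian_metric N g \<longleftrightarrow> (\<exists>r s. metric_of_signature N r s g)"

text \<open>A linear connection as a covariant derivative: \<open>D p v Y\<close> is \<open>(\<nabla>\<^sub>v Y)\<^sub>p\<close> for a tangent
  vector \<open>v\<close> at \<open>p\<close> and a vector field \<open>Y\<close>.\<close>

type_synonym ('i, 'p, 'e) conn = "'p \<Rightarrow> ('i,'e) tvec \<Rightarrow> ('i,'p,'e) vfield \<Rightarrow> ('i,'e) tvec"

definition cov_deriv ::
  "('i,'p,'e::euclidean_space) atlas \<Rightarrow> ('i,'p,'e) conn \<Rightarrow>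
     ('i,'p,'e) vfield \<Rightarrow> ('i,'p,'e) vfield \<Rightarrow> ('i,'p,'e) vfield" where
  "cov_deriv N D X Y p = (if p \<in> carrier N then D p (X p) Y else (\<lambda>_. 0))"

definition linear_connection :: "('i,'p,'e::euclidean_space) atlas \<Rightarrow> ('i,'p,'e) conn \<Rightarrow> bool" where
  "linear_connection N D \<longleftrightarrow>
     (\<forall>X\<in>vector_fields N. \<forall>Y\<in>vector_fields N. cov_deriv N D X Y \<in> vector_fields N) \<and>
     (\<forall>p\<in>carrier N. \<forall>u\<in>tangent_space N p. \<forall>v\<in>tangent_space N p. \<forall>Y\<in>vector_fields N. \<forall>r s.
        D p (lincomb r u s v) Y = lincomb r (D p u Y) s (D p v Y)) \<and>
     (\<forall>p\<in>carrier N. \<forall>v\<in>tangent_space N p. \<forall>Y\<in>vector_fields N. \<forall>Z\<in>vector_fields N. \<forall>r s.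
        D p v (\<lambda>q. lincomb r (Y q) s (Z q)) = lincomb r (D p v Y) s (D p v Z)) \<and>
     (\<forall>p\<in>carrier N. \<forall>v\<in>tangent_space N p. \<forall>Y\<in>vector_fields N. \<forall>f. smooth_function N f \<longrightarrow>
        D p v (\<lambda>q i. f q *\<^sub>R Y q i) = lincomb (dir_deriv N p v f) (Y p) (f p) (D p v Y))"

definition torsion_free :: "('i,'p,'e::euclidean_space) atlas \<Rightarrow> ('i,'p,'e) conn \<Rightarrow> bool" where
  "torsion_free N D \<longleftrightarrow>
     (\<forall>X\<in>vector_fields N. \<forall>Y\<in>vector_fields N. \<forall>p\<in>carrier N. \<forall>i.
        cov_deriv N D X Y p i - cov_deriv N D Y X p i = bracket N X Y p i)"

definition curvature ::
  "('i,'p,'e::euclidean_space) atlas \<Rightarrow> ('i,'p,'e) conn \<Rightarrow>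
     ('i,'p,'e) vfield \<Rightarrow> ('i,'p,'e) vfield \<Rightarrow> ('i,'p,'e) vfield \<Rightarrow> ('i,'p,'e) vfield" where
  "curvature N D X Y Z p =
     (\<lambda>i. cov_deriv N D X (cov_deriv N D Y Z) p i - cov_deriv N D Y (cov_deriv N D X Z) p i
          - cov_deriv N D (bracket N X Y) Z p i)"

definition flat :: "('i,'p,'e::euclidean_space) atlas \<Rightarrow> ('i,'p,'e) conn \<Rightarrow> bool" where
  "flat N D \<longleftrightarrow>
     (\<forall>X\<in>vector_fields N. \<forall>Y\<in>vector_fields N. \<forall>Z\<in>vector_fields N. \<forall>p\<in>carrier N.
        curvature N D X Y Z p = (\<lambda>_. 0))"

definition levi_civita_connection ::
  "('i,'p,'e::euclidean_space) atlas \<Rightarrow> ('i,'p,'e) bform \<Rightarrow> ('i,'p,'e) conn \<Rightarrow> bool" where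
  "levi_civita_connection N g D \<longleftrightarrow>
     linear_connection N D \<and> torsion_free N D \<and>
     (\<forall>p\<in>carrier N. \<forall>v\<in>tangent_space N p. \<forall>Y\<in>vector_fields N. \<forall>Z\<in>vector_fields N.
        dir_deriv N p v (\<lambda>q. g q (Y q) (Z q)) = g p (D p v Y) (Z p) + g p (Y p) (D p v Z))"

definition parallel_endo ::
  "('i,'p,'e::euclidean_space) atlas \<Rightarrow> ('i,'p,'e) conn \<Rightarrow> ('i,'p,'e) endo \<Rightarrow> bool" where
  "parallel_endo N D T \<longleftrightarrow>
     (\<forall>p\<in>carrier N. \<forall>v\<in>tangent_space N p. \<forall>Y\<in>vector_fields N.
        D p v (endo_apply N T Y) = T p (D p v Y))"


section \<open>Para-Hermitian structures\<close>

text \<open>Evaluation at an index \<open>i \<in> charts_at N p\<close> identifies the tangent space at \<open>p\<close> linearly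
  with the model space; it is used to speak of the dimension of an eigenspace.\<close>

definition almost_para_complex ::
  "('i,'p,'e::euclidean_space) atlas \<Rightarrow> ('i,'p,'e) endo \<Rightarrow> bool" where
  "almost_para_complex N P \<longleftrightarrow>
     endo_field N P \<and>
     (\<exists>p\<in>carrier N. \<exists>v\<in>tangent_space N p. P p v \<noteq> v) \<and>
     (\<exists>p\<in>carrier N. \<exists>v\<in>tangent_space N p. P p v \<noteq> (\<lambda>i. - v i)) \<and>
     (\<forall>p\<in>carrier N. \<forall>v\<in>tangent_space N p. P p (P p v) = v) \<and>
     (\<forall>p\<in>carrier N. \<forall>i\<in>charts_at N p.
        dim ((\<lambda>v. v i) ` {v \<in> tangent_space N p. P p v = v}) =
        dim ((\<lambda>v. v i) ` {v \<in> tangent_space N p. P p v = (\<lambda>j. - v j)}))"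

definition almost_para_hermitian ::
  "('i,'p,'e::euclidean_space) atlas \<Rightarrow> ('i,'p,'e) endo \<Rightarrow> ('i,'p,'e) bform \<Rightarrow> bool" where
  "almost_para_hermitian N P g \<longleftrightarrow>
     smooth_manifold N \<and> almost_para_complex N P \<and> semi_riemannian_metric N g \<and>
     (\<forall>p\<in>carrier N. \<forall>u\<in>tangent_space N p. \<forall>v\<in>tangent_space N p.
        g p (P p u) (P p v) = - g p u v)"

definition fundamental_form ::
  "('i,'p,'e) endo \<Rightarrow> ('i,'p,'e) bform \<Rightarrow> ('i,'p,'e) bform" where
  "fundamental_form P g p u v = g p u (P p v)"

definition ext_deriv2 ::
  "('i,'p,'e::euclidean_space) atlas \<Rightarrow> ('i,'p,'e) bform \<Rightarrow>
     ('i,'p,'e) vfield \<Rightarrow> ('i,'p,'e) vfield \<Rightarrow> ('i,'p,'e) vfield \<Rightarrow> 'p \<Rightarrow> real" where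
  "ext_deriv2 N \<Omega> X Y Z p =
     dir_deriv N p (X p) (\<lambda>q. \<Omega> q (Y q) (Z q))
     - dir_deriv N p (Y p) (\<lambda>q. \<Omega> q (X q) (Z q))
     + dir_deriv N p (Z p) (\<lambda>q. \<Omega> q (X q) (Y q))
     - \<Omega> p (bracket N X Y p) (Z p)
     + \<Omega> p (bracket N X Z p) (Y p)
     - \<Omega> p (bracket N Y Z p) (X p)"

definition almost_para_kaehler ::
  "('i,'p,'e::euclidean_space) atlas \<Rightarrow> ('i,'p,'e) endo \<Rightarrow> ('i,'p,'e) bform \<Rightarrow> bool" where
  "almost_para_kaehler N P g \<longleftrightarrow>
     almost_para_hermitian N P g \<and>
     (\<forall>X\<in>vector_fields N. \<forall>Y\<in>vector_fields N. \<forall>Z\<in>vector_fields N. \<forall>p\<in>carrier N.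
        ext_deriv2 N (fundamental_form P g) X Y Z p = 0)"

text \<open>The quantifier over \<open>D\<close> ranges over exactly one connection (on vector fields), by the
  fundamental theorem of semi-Riemannian geometry.\<close>

definition para_kaehler ::
  "('i,'p,'e::euclidean_space) atlas \<Rightarrow> ('i,'p,'e) endo \<Rightarrow> ('i,'p,'e) bform \<Rightarrow> bool" where
  "para_kaehler N P g \<longleftrightarrow>
     almost_para_hermitian N P g \<and>
     (\<forall>D. levi_civita_connection N g D \<longrightarrow> parallel_endo N D P)"


section \<open>Tangent bundle, harmonic maps, harmonic endomorphism fields\<close>

definition tangent_bundle ::
  "('i,'p,'e::euclidean_space) atlas \<Rightarrow> ('i, 'p \<times> ('i,'e) tvec, 'e \<times> 'e) atlas" where
  "tangent_bundle N =
     \<lparr> Idx = Idx N,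
       Dom = (\<lambda>i. {(p, v). p \<in> Dom N i \<and> v \<in> tangent_space N p}),
       Crd = (\<lambda>i (p, v). (Crd N i p, v i)) \<rparr>"

text \<open>\<open>h\<^sup>C = y\<^sup>k (\<partial>\<^sub>k h\<^sub>i\<^sub>j) dx\<^sup>i dx\<^sup>j + 2 h\<^sub>i\<^sub>j dx\<^sup>i dy\<^sup>j\<close>, polarised.\<close>

definition complete_lift_metric ::
  "('i,'p,'e::euclidean_space) atlas \<Rightarrow> ('i,'p,'e) bform \<Rightarrow>
     ('i, 'p \<times> ('i,'e) tvec, 'e \<times> 'e) bform" where
  "complete_lift_metric N h = (\<lambda>(p, v) \<xi> \<eta>.
     let i = chart_at N p; H = bform_crd N i h; x = Crd N i p;
         (u, u') = \<xi> i; (w, w') = \<eta> i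
     in frechet_derivative (\<lambda>y. H y u w) (at x) (v i) + H x u w' + H x u' w)"

text \<open>Local expressions of a metric in a chart are functions \<open>G y u v\<close>. Below, \<open>sharp B c\<close> is the
  vector \<open>z\<close> with \<open>B(z, v) = c \<bullet> v\<close> for all \<open>v\<close>, i.e. \<open>z\<^sup>i = g\<^sup>i\<^sup>j c\<^sub>j\<close>, and \<open>christoffel G y u v\<close> is
  the vector with components \<open>\<Gamma>\<^sup>k\<^sub>i\<^sub>j u\<^sup>i v\<^sup>j\<close>.\<close>

definition sharp :: "('e::euclidean_space \<Rightarrow> 'e \<Rightarrow> real) \<Rightarrow> 'e \<Rightarrow> 'e" where
  "sharp B c = (THE z. \<forall>v. B z v = c \<bullet> v)"

definition christoffel :: "('e::euclidean_space \<Rightarrow> 'e \<Rightarrow> 'e \<Rightarrow> real) \<Rightarrow> 'e \<Rightarrow> 'e \<Rightarrow> 'e \<Rightarrow> 'e" where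
  "christoffel G y u v = sharp (G y)
     (\<Sum>c\<in>Basis. ((frechet_derivative (\<lambda>z. G z v c) (at y) u
                 + frechet_derivative (\<lambda>z. G z u c) (at y) v
                 - frechet_derivative (\<lambda>z. G z u v) (at y) c) / 2) *\<^sub>R c)"

text \<open>
  The tension field \<open>\<tau>(F) = trace\<^sub>g \<nabla>dF\<close> at \<open>p\<close> of a smooth map, a tangent vector at \<open>F p\<close>. In
  charts its components are
  \<open>g\<^sup>k\<^sup>l (\<partial>\<^sub>k \<partial>\<^sub>l f - \<Gamma>\<^sup>m\<^sub>k\<^sub>l \<partial>\<^sub>m f + \<Gamma>'(f)(\<partial>\<^sub>k f, \<partial>\<^sub>l f))\<close> with \<open>f\<close> the local expression of \<open>F\<close>.
\<close>

definition tension_field ::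
  "('i,'p,'e::euclidean_space) atlas \<Rightarrow> ('i,'p,'e) bform \<Rightarrow>
   ('j,'q,'f::euclidean_space) atlas \<Rightarrow> ('j,'q,'f) bform \<Rightarrow> ('p \<Rightarrow> 'q) \<Rightarrow> 'p \<Rightarrow> ('j,'f) tvec" where
  "tension_field N g N' g' F p =
     (let i = chart_at N p; j = chart_at N' (F p);
          f = Crd N' j \<circ> F \<circ> Prm N i;
          y = Crd N i p;
          df = (\<lambda>z. frechet_derivative f (at z));
          G = bform_crd N i g; G' = bform_crd N' j g'
      in chart_vec N' j (F p)
           (\<Sum>c\<in>Basis. let c' = sharp (G y) c in
              frechet_derivative (\<lambda>z. df z c') (at y) c
              - df y (christoffel G y c c')
              + christoffel G' (f y) (df y c) (df y c')))"

definition harmonic_map ::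
  "('i,'p,'e::euclidean_space) atlas \<Rightarrow> ('i,'p,'e) bform \<Rightarrow>
   ('j,'q,'f::euclidean_space) atlas \<Rightarrow> ('j,'q,'f) bform \<Rightarrow> ('p \<Rightarrow> 'q) \<Rightarrow> bool" where
  "harmonic_map N g N' g' F \<longleftrightarrow>
     smooth_map N N' F \<and> (\<forall>p\<in>carrier N. tension_field N g N' g' F p = (\<lambda>_. 0))"

definition harmonic_endo ::
  "('i,'p,'e::euclidean_space) atlas \<Rightarrow> ('i,'p,'e) bform \<Rightarrow> ('i,'p,'e) endo \<Rightarrow> bool" where
  "harmonic_endo N h T \<longleftrightarrow>
     harmonic_map (tangent_bundle N) (complete_lift_metric N h)
                  (tangent_bundle N) (complete_lift_metric N h) (\<lambda>(p, v). (p, T p v))"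


section \<open>Cotangent bundle and lifts\<close>

definition cotangent_bundle ::
  "('i,'p,'e::euclidean_space) atlas \<Rightarrow> ('i, 'p \<times> ('i,'e) covec, 'e \<times> 'e) atlas" where
  "cotangent_bundle M =
     \<lparr> Idx = Idx M,
       Dom = (\<lambda>i. {(x, \<omega>). x \<in> Dom M i \<and> \<omega> \<in> cotangent_space M x}),
       Crd = (\<lambda>i (x, \<omega>). (Crd M i x, covec_crd M i x \<omega>)) \<rparr>"

definition vlift :: "('i,'p,'e) vfield \<Rightarrow> 'p \<times> ('i,'e) covec \<Rightarrow> real" where
  "vlift X = (\<lambda>(x, \<omega>). \<omega> (X x))"

text \<open>The vertical tangent vector \<open>\<Sum>\<^sub>k \<theta>\<^sub>k \<partial>\<^sub>k\<^sub>*\<close> of the cotangent bundle at \<open>q = (x, \<omega>)\<close>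
  corresponding to a covector \<open>\<theta>\<close> at \<open>x\<close>.\<close>

definition vertical ::
  "('i,'p,'e::euclidean_space) atlas \<Rightarrow> 'p \<times> ('i,'e) covec \<Rightarrow> ('i,'e) covec \<Rightarrow> ('i,'e \<times> 'e) tvec" where
  "vertical M q \<theta> =
     (\<lambda>i. if i \<in> charts_at (cotangent_bundle M) q then (0, covec_crd M i (fst q) \<theta>) else 0)"

definition liouville ::
  "('i,'p,'e::euclidean_space) atlas \<Rightarrow> ('i, 'p \<times> ('i,'e) covec, 'e \<times> 'e) vfield" where
  "liouville M = (\<lambda>(x, \<omega>). vertical M (x, \<omega>) \<omega>)"

definition vlift_form ::
  "('i,'p,'e::euclidean_space) atlas \<Rightarrow> ('p \<Rightarrow> ('i,'e) covec) \<Rightarrow>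
     ('i, 'p \<times> ('i,'e) covec, 'e \<times> 'e) vfield" where
  "vlift_form M \<alpha> = (\<lambda>(x, \<omega>). vertical M (x, \<omega>) (\<alpha> x))"

definition contracted ::
  "('i,'p,'e::euclidean_space) atlas \<Rightarrow> ('i,'p,'e) endo \<Rightarrow>
     ('i, 'p \<times> ('i,'e) covec, 'e \<times> 'e) vfield" where
  "contracted M T = (\<lambda>(x, \<omega>). vertical M (x, \<omega>) (\<lambda>v. \<omega> (T x v)))"

text \<open>\<open>X\<^sup>C = X\<^sup>i \<partial>\<^sub>i - \<omega>\<^sub>h (\<partial>\<^sub>i X\<^sup>h) \<partial>\<^sub>i\<^sub>*\<close> in every induced chart.\<close>

definition complete_lift ::
  "('i,'p,'e::euclidean_space) atlas \<Rightarrow> ('i,'p,'e) vfield \<Rightarrow>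
     ('i, 'p \<times> ('i,'e) covec, 'e \<times> 'e) vfield" where
  "complete_lift M X = (\<lambda>(x, \<omega>) i.
     if i \<in> charts_at (cotangent_bundle M) (x, \<omega>)
     then (X x i,
           - (\<Sum>c\<in>Basis. (covec_crd M i x \<omega> \<bullet>
                frechet_derivative (vfield_crd M i X) (at (Crd M i x)) c) *\<^sub>R c))
     else 0)"

text \<open>The \<open>(1,1)\<close> tensor field \<open>\<nabla>X : Z \<mapsto> \<nabla>\<^sub>Z X\<close>.\<close>

definition nabla_endo :: "('i,'p,'e) conn \<Rightarrow> ('i,'p,'e) vfield \<Rightarrow> ('i,'p,'e) endo" where
  "nabla_endo D X x v = D x v X"

definition natural_riemann_extension ::
  "('i,'p,'e::euclidean_space) atlas \<Rightarrow> ('i,'p,'e) conn \<Rightarrow> real \<Rightarrow> real \<Rightarrow>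
     ('i, 'p \<times> ('i,'e) covec, 'e \<times> 'e) bform \<Rightarrow> bool" where
  "natural_riemann_extension M D a b g \<longleftrightarrow>
     metric_of_signature (cotangent_bundle M) DIM('e) DIM('e) g \<and>
     (\<forall>(x, \<omega>)\<in>carrier (cotangent_bundle M).
        (\<forall>X\<in>vector_fields M. \<forall>Y\<in>vector_fields M.
           g (x, \<omega>) (complete_lift M X (x, \<omega>)) (complete_lift M Y (x, \<omega>)) =
             - a * \<omega> (lincomb 1 (D x (X x) Y) 1 (D x (Y x) X)) + b * \<omega> (X x) * \<omega> (Y x)) \<and>
        (\<forall>X\<in>vector_fields M. \<forall>\<alpha>\<in>one_forms M.
           g (x, \<omega>) (complete_lift M X (x, \<omega>)) (vlift_form M \<alpha> (x, \<omega>)) = a * \<alpha> x (X x)) \<and>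
        (\<forall>\<alpha>\<in>one_forms M. \<forall>\<beta>\<in>one_forms M.
           g (x, \<omega>) (vlift_form M \<alpha> (x, \<omega>)) (vlift_form M \<beta> (x, \<omega>)) = 0))"

end

theory Submission
  imports Defs
begin

text \<open>
  In the chart of \<open>T\<^sup>*M\<close> induced by a chart of \<open>M\<close>, write \<open>S(u, v) = -2a \<omega>(\<Gamma>(u, v)) + b \<omega>(u) \<omega>(v)\<close>. Then
  \<open>g((u, \<theta>), (v, \<tau>)) = a (\<theta>(v) + \<tau>(u)) + S(u, v)\<close> and \<open>P(u, \<theta>) = (u, -S(u, \<cdot>)/a - \<theta>)\<close>. Hence \<open>P\<close> is an
  anti-isometric involution, and \<open>g(\<cdot>, P \<cdot>)\<close> is \<open>a\<close> times the canonical symplectic form, which is closed.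
  With \<open>h\<^sub>v = -S(v, \<cdot>)/(2a)\<close>, Koszul's formula shows that \<open>(\<nabla>\<^bsub>(u, \<theta>)\<^esub> P)(v, \<tau>)\<close> is vertical, with value
  \<open>(dS\<^bsub>(v, h\<^sub>v)\<^esub>(u, w) - dS\<^bsub>(w, h\<^sub>w)\<^esub>(u, v))/a = -2 \<omega>(R(v, w) u)\<close> on \<open>w\<close>. It vanishes if \<open>M\<close> is flat, and it always
  vanishes if \<open>u = 0\<close> or \<open>v = 0\<close>. Since the musical dual of a horizontal coordinate covector is vertical,
  every term of the trace defining the tension field of \<open>P\<close> is therefore zero.

  The hypotheses speak about global fields only; bump functions provide enough of them to read off
  the local expressions at every point.
\<close>

subsection \<open>Calculus of smooth maps\<close>

text \<open>The factor \<open>1/(2a)\<close> in \<open>h\<^sub>v\<close> has a geometric origin: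
  \<open>(v, h\<^sub>v)\<close> is the vector over \<open>v\<close> fixed by \<open>P\<close>. The
  eigenspace for 1 is the graph of \<open>h\<close>, and the one for -1 is the fibre direction.

  The Christoffel symbols of \<open>g\<close> are never solved for. Testing Koszul's formula on
  vertical vectors gives the horizontal part of \<open>\<Gamma>(\<xi>, \<eta>)\<close>. It depends
  on \<open>\<eta>\<close> only through its base part, which \<open>P\<close> preserves, so
  \<open>\<Gamma>(\<xi>, P \<eta>)\<close> and \<open>P \<Gamma>(\<xi>, \<eta>)\<close> have the
  same horizontal part. Testing on horizontal vectors gives the sum of the vertical parts of
  \<open>\<Gamma>(\<xi>, \<eta>)\<close> and \<open>\<Gamma>(\<xi>, P \<eta>)\<close>, and only this
  sum enters \<open>\<nabla>P\<close>.

  Harmonicity is defined by second derivatives on the tangent bundle of the cotangent bundle. A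
  reduction valid for any metric first brings the tension field back to \<open>\<nabla>T\<close>;
  the special metric is inserted only afterwards.

  A further obstacle is that the connection coefficients of the base arise from a pointwise choice
  and carry no smoothness of their own. It is recovered from the coefficients of
  \<open>g\<close>.\<close>

abbreviation fd :: "('a::euclidean_space \<Rightarrow> 'b::real_normed_vector) \<Rightarrow> 'a \<Rightarrow> 'a \<Rightarrow> 'b" where
  "fd f x \<equiv> frechet_derivative f (at x)"

lemma fd_eqI: "(f has_derivative f') (at x) \<Longrightarrow> fd f x = f'"
  using frechet_derivative_at by metis

lemma fd_cong_open:
  assumes "open S" "x \<in> S" "\<And>y. y \<in> S \<Longrightarrow> f y = g y"
  shows "fd f x = fd g x"
proof -
  have "\<And>D. (f has_derivative D) (at x) \<longleftrightarrow> (g has_derivative D) (at x)"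
    using assms has_derivative_transform_within_open[of _ _ x UNIV S] by (metis (no_types, lifting))
  then show ?thesis unfolding frechet_derivative_def by simp
qed

lemma differentiable_cong_open:
  assumes "open S" "x \<in> S" "\<And>y. y \<in> S \<Longrightarrow> f y = g y"
  shows "f differentiable at x \<longleftrightarrow> g differentiable at x"
  unfolding differentiable_def
  using assms has_derivative_transform_within_open[of _ _ x UNIV S] by (metis (no_types, lifting))

lemma Ck_on_cong:
  assumes "open S" "\<And>x. x \<in> S \<Longrightarrow> f x = g x"
  shows "Ck_on k f S \<longleftrightarrow> Ck_on k g S"
  using assms(2)
proof (induction k arbitrary: f g)
  case 0
  then show ?case using continuous_on_cong[of S S f g] by simp
next
  case (Suc k)
  have "fd f x = fd g x" "f differentiable at x \<longleftrightarrow> g differentiable at x" if "x \<in> S" for x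
    using fd_cong_open[OF assms(1) that, of f g] differentiable_cong_open[OF assms(1) that, of f g] Suc.prems
    by blast+
  then have "Ck_on k (\<lambda>x. fd f x v) S \<longleftrightarrow> Ck_on k (\<lambda>x. fd g x v) S"
    and "(\<forall>x\<in>S. f differentiable at x) \<longleftrightarrow> (\<forall>x\<in>S. g differentiable at x)" for v
    using Suc.IH[of "\<lambda>x. fd f x v" "\<lambda>x. fd g x v"] by simp_all
  then show ?case by simp
qed

lemma Ck_on_subset: "Ck_on k f S \<Longrightarrow> T \<subseteq> S \<Longrightarrow> Ck_on k f T"
  by (induction k arbitrary: f) (auto intro: continuous_on_subset)

lemma Ck_on_SucD: "Ck_on (Suc k) f S \<Longrightarrow> Ck_on k f S"
proof (induction k arbitrary: f)
  case 0
  then show ?case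
    by (auto intro!: continuous_at_imp_continuous_on differentiable_imp_continuous_within)
next
  case (Suc k)
  then show ?case by (metis Ck_on.simps(2))
qed

text \<open>Full derivatives at a point see only a neighbourhood, so smoothness is a local property.
  This is what later glues a cut-off object to zero.\<close>

lemma Ck_on_Union:
  assumes "\<And>T. T \<in> \<T> \<Longrightarrow> open T \<and> Ck_on k f T"
  shows "Ck_on k f (\<Union>\<T>)"
  using assms
proof (induction k arbitrary: f)
  case 0
  then show ?case by (auto intro: continuous_on_open_Union)
next
  case (Suc k)
  then show ?case by fastforce
qed

lemma Ck_on_const: "Ck_on k (\<lambda>x. c) S"
  by (induction k arbitrary: c) (auto simp: frechet_derivative_const)

lemma Ck_on_bounded_linear: "bounded_linear f \<Longrightarrow> Ck_on k f S"
proof (cases k)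
  case 0
  assume "bounded_linear f" then show ?thesis using 0
    by (simp add: linear_continuous_on)
next
  case (Suc m)
  assume f: "bounded_linear f"
  then have "fd f x = f" for x
    using bounded_linear_imp_has_derivative fd_eqI by blast
  then show ?thesis using f Suc by (simp add: Ck_on_const bounded_linear_imp_differentiable)
qed

lemma Ck_on_SucI:
  assumes "open S" "\<And>x. x \<in> S \<Longrightarrow> (f has_derivative f' x) (at x)" "\<And>v. Ck_on k (\<lambda>x. f' x v) S"
  shows "Ck_on (Suc k) f S"
proof -
  have "Ck_on k (\<lambda>x. fd f x v) S \<longleftrightarrow> Ck_on k (\<lambda>x. f' x v) S" for v
    by (rule Ck_on_cong[OF assms(1)]) (simp add: fd_eqI[OF assms(2)])
  then show ?thesis using assms by (auto simp: differentiable_def)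
qed

lemma Ck_on_add:
  assumes "open S" shows "Ck_on k f S \<Longrightarrow> Ck_on k g S \<Longrightarrow> Ck_on k (\<lambda>x. f x + g x) S"
proof (induction k arbitrary: f g)
  case 0
  then show ?case by (simp add: continuous_on_add)
next
  case (Suc k)
  show ?case
  proof (rule Ck_on_SucI[OF assms])
    show "((\<lambda>x. f x + g x) has_derivative (\<lambda>v. fd f x v + fd g x v)) (at x)" if "x \<in> S" for x
      using Suc.prems that by (intro has_derivative_add) (simp_all add: frechet_derivative_works[symmetric])
    show "Ck_on k (\<lambda>x. fd f x v + fd g x v) S" for v
      using Suc by simp
  qed
qed

text \<open>The product rule pairs a differentiated factor with an undifferentiated one, so the
  induction also needs each factor one order lower, which \<open>Ck_on_SucD\<close>
  supplies.\<close>

lemma (in bounded_bilinear) Ck_on_bilinear: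
  fixes f :: "'x::euclidean_space \<Rightarrow> 'a"
  assumes "open S" shows "Ck_on k f S \<Longrightarrow> Ck_on k g S \<Longrightarrow> Ck_on k (\<lambda>x. f x ** g x) S"
proof (induction k arbitrary: f g)
  case 0
  then show ?case by (simp add: continuous_on)
next
  case (Suc k)
  show ?case
  proof (rule Ck_on_SucI[OF assms])
    show "((\<lambda>x. f x ** g x) has_derivative (\<lambda>v. f x ** fd g x v + fd f x v ** g x)) (at x)"
      if "x \<in> S" for x
      using FDERIV[of f _ x UNIV g] Suc.prems that by (simp add: frechet_derivative_works)
    show "Ck_on k (\<lambda>x. f x ** fd g x v + fd f x v ** g x) S" for v
      using Suc.prems Ck_on_SucD[OF Suc.prems(1)] Ck_on_SucD[OF Suc.prems(2)] by (simp add: Suc.IH Ck_on_add[OF assms])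
  qed
qed

lemma Ck_on_sum:
  assumes "open S" "finite I" "\<And>i. i \<in> I \<Longrightarrow> Ck_on k (f i) S"
  shows "Ck_on k (\<lambda>x. \<Sum>i\<in>I. f i x) S"
  using assms(2,3) by (induction I) (auto intro: Ck_on_add[OF assms(1)] Ck_on_const)

lemma linear_sum_Basis:
  "linear f \<Longrightarrow> f v = (\<Sum>c\<in>Basis. (v \<bullet> c) *\<^sub>R f c)" for f :: "'a::euclidean_space \<Rightarrow> 'b::real_vector"
  by (subst euclidean_representation[of v, symmetric]) (simp add: linear_sum linear_scale)

lemma lincomb_apply: "lincomb r u s v i = r *\<^sub>R u i + s *\<^sub>R v i"
  by (simp add: lincomb_def)

lemma linear_fd: "f differentiable at x \<Longrightarrow> linear (fd f x)"
  using linear_frechet_derivative by blast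

lemma Ck_on_compose:
  fixes f :: "'a::euclidean_space \<Rightarrow> 'b::euclidean_space"
  assumes "open S" "open T" "f ` S \<subseteq> T"
  shows "Ck_on k f S \<Longrightarrow> Ck_on k g T \<Longrightarrow> Ck_on k (\<lambda>x. g (f x)) S"
proof (induction k arbitrary: g)
  case 0
  then show ?case using assms(3) by (auto intro: continuous_on_compose2)
next
  case (Suc k)
  have D: "((\<lambda>x. g (f x)) has_derivative (\<lambda>v. fd g (f x) (fd f x v))) (at x)" if "x \<in> S" for x
  proof (rule has_derivative_compose[of f _ x UNIV g])
    show "(f has_derivative fd f x) (at x)" "(g has_derivative fd g (f x)) (at (f x))"
      using Suc.prems that assms(3) by (auto simp: frechet_derivative_works[symmetric] image_subset_iff)
  qed
  \<comment> \<open>In the chain rule \<open>x\<close> enters both through the base point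
    \<open>f x\<close> and through the direction \<open>fd f x v\<close>. Expanding the direction in
    the basis separates the two and leaves a sum of products.\<close>
  have fd_eq: "fd (\<lambda>x. g (f x)) x v = (\<Sum>c\<in>Basis. (fd f x v \<bullet> c) *\<^sub>R fd g (f x) c)" if "x \<in> S" for x v
    using fd_eqI[OF D[OF that]] Suc.prems that assms(3) linear_sum_Basis[OF linear_fd, of g "f x" "fd f x v"]
    by (auto simp: image_subset_iff)
  have "Ck_on k (\<lambda>x. \<Sum>c\<in>Basis. (fd f x v \<bullet> c) *\<^sub>R fd g (f x) c) S" for v
  proof -
    have *: "Ck_on k (\<lambda>x. fd g (f x) c) S" "Ck_on k (\<lambda>x. fd f x v) S" for c
      using Suc.prems Suc.IH[of "\<lambda>y. fd g y c"] Ck_on_SucD[OF Suc.prems(1)] by simp_all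
    show ?thesis
      by (intro * Ck_on_sum assms bounded_bilinear.Ck_on_bilinear[OF bounded_bilinear_scaleR]
          bounded_bilinear.Ck_on_bilinear[OF bounded_bilinear_inner] Ck_on_const finite_Basis)
  qed
  then have "Ck_on k (\<lambda>x. fd (\<lambda>x. g (f x)) x v) S" for v
    using Ck_on_cong[OF assms(1) fd_eq] by simp
  then show ?case using D by (auto simp: differentiable_def)
qed

section \<open>Closure properties of smooth maps\<close>

named_theorems smooth_intros

lemma smooth_on_cong:
  "open S \<Longrightarrow> (\<And>x. x \<in> S \<Longrightarrow> f x = g x) \<Longrightarrow> smooth_on f S \<longleftrightarrow> smooth_on g S"
  unfolding smooth_on_def using Ck_on_cong by blast

lemma smooth_on_eqI:
  "open S \<Longrightarrow> smooth_on g S \<Longrightarrow> (\<And>x. x \<in> S \<Longrightarrow> f x = g x) \<Longrightarrow> smooth_on f S"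
  using smooth_on_cong[of S f g] by simp

lemma smooth_on_subset: "smooth_on f S \<Longrightarrow> T \<subseteq> S \<Longrightarrow> smooth_on f T"
  unfolding smooth_on_def using Ck_on_subset by blast

lemma smooth_on_Union:
  "(\<And>T. T \<in> \<T> \<Longrightarrow> open T \<and> smooth_on f T) \<Longrightarrow> smooth_on f (\<Union>\<T>)"
  unfolding smooth_on_def by (auto intro!: Ck_on_Union)

lemma smooth_on_Un:
  "open S \<Longrightarrow> open T \<Longrightarrow> smooth_on f S \<Longrightarrow> smooth_on f T \<Longrightarrow> smooth_on f (S \<union> T)"
  using smooth_on_Union[of "{S, T}" f] by auto

lemma smooth_on_const [smooth_intros]: "smooth_on (\<lambda>x. c) S"
  unfolding smooth_on_def by (simp add: Ck_on_const)

lemma smooth_on_bounded_linear: "bounded_linear f \<Longrightarrow> smooth_on f S"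
  unfolding smooth_on_def by (simp add: Ck_on_bounded_linear)

lemma smooth_on_id [smooth_intros]: "smooth_on (\<lambda>x. x) S"
  by (simp add: smooth_on_bounded_linear bounded_linear_ident)

lemma smooth_on_add [smooth_intros]:
  "open S \<Longrightarrow> smooth_on f S \<Longrightarrow> smooth_on g S \<Longrightarrow> smooth_on (\<lambda>x. f x + g x) S"
  unfolding smooth_on_def by (simp add: Ck_on_add)

lemma smooth_on_sum [smooth_intros]:
  "open S \<Longrightarrow> finite I \<Longrightarrow> (\<And>i. i \<in> I \<Longrightarrow> smooth_on (f i) S) \<Longrightarrow> smooth_on (\<lambda>x. \<Sum>i\<in>I. f i x) S"
  unfolding smooth_on_def by (simp add: Ck_on_sum)

lemma smooth_on_bilinear:
  fixes f :: "'x::euclidean_space \<Rightarrow> 'a::real_normed_vector"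
  shows "bounded_bilinear h \<Longrightarrow> open S \<Longrightarrow> smooth_on f S \<Longrightarrow> smooth_on g S \<Longrightarrow> smooth_on (\<lambda>x. h (f x) (g x)) S"
  unfolding smooth_on_def by (simp add: bounded_bilinear.Ck_on_bilinear)

lemmas smooth_on_scaleR [smooth_intros] = smooth_on_bilinear[OF bounded_bilinear_scaleR]
lemmas smooth_on_inner [smooth_intros] = smooth_on_bilinear[OF bounded_bilinear_inner]
lemmas smooth_on_mult [smooth_intros] = smooth_on_bilinear[OF bounded_bilinear_mult]

lemma smooth_on_compose:
  fixes f :: "'a::euclidean_space \<Rightarrow> 'b::euclidean_space"
  shows "open S \<Longrightarrow> open T \<Longrightarrow> f ` S \<subseteq> T \<Longrightarrow> smooth_on f S \<Longrightarrow> smooth_on g T \<Longrightarrow> smooth_on (\<lambda>x. g (f x)) S"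
  unfolding smooth_on_def using Ck_on_compose by blast

lemma smooth_on_linear:
  fixes L :: "'b::euclidean_space \<Rightarrow> 'c::real_normed_vector"
  shows "linear L \<Longrightarrow> open S \<Longrightarrow> smooth_on f S \<Longrightarrow> smooth_on (\<lambda>x. L (f x)) S"
  by (rule smooth_on_compose[of S UNIV])
     (auto intro: smooth_on_bounded_linear simp: linear_conv_bounded_linear)

lemma smooth_on_fst [smooth_intros]:
  fixes f :: "'a::euclidean_space \<Rightarrow> 'b::euclidean_space \<times> 'c::euclidean_space"
  shows "open S \<Longrightarrow> smooth_on f S \<Longrightarrow> smooth_on (\<lambda>x. fst (f x)) S"
  by (rule smooth_on_linear[OF linear_fst])

lemma smooth_on_snd [smooth_intros]:
  fixes f :: "'a::euclidean_space \<Rightarrow> 'b::euclidean_space \<times> 'c::euclidean_space"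
  shows "open S \<Longrightarrow> smooth_on f S \<Longrightarrow> smooth_on (\<lambda>x. snd (f x)) S"
  by (rule smooth_on_linear[OF linear_snd])

lemma smooth_on_minus [smooth_intros]:
  fixes f :: "'a::euclidean_space \<Rightarrow> 'b::real_normed_vector"
  shows "open S \<Longrightarrow> smooth_on f S \<Longrightarrow> smooth_on (\<lambda>x. - f x) S"
  using smooth_on_scaleR[of S "\<lambda>_. -1" f] by (simp add: smooth_on_const)

lemma smooth_on_diff [smooth_intros]:
  fixes f :: "'a::euclidean_space \<Rightarrow> 'b::real_normed_vector"
  shows "open S \<Longrightarrow> smooth_on f S \<Longrightarrow> smooth_on g S \<Longrightarrow> smooth_on (\<lambda>x. f x - g x) S"
  using smooth_on_add[of S f "\<lambda>x. - g x"] by (simp add: smooth_on_minus)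

lemma smooth_on_Pair [smooth_intros]:
  fixes f :: "'a::euclidean_space \<Rightarrow> 'b::euclidean_space" and g :: "'a \<Rightarrow> 'c::euclidean_space"
  assumes "open S" "smooth_on f S" "smooth_on g S"
  shows "smooth_on (\<lambda>x. (f x, g x)) S"
proof -
  have "linear (\<lambda>y::'b. (y, 0::'c))" "linear (\<lambda>z::'c. (0::'b, z))"
    by (auto intro!: linearI)
  then have "smooth_on (\<lambda>x. (f x, 0) + (0, g x)) S"
    by (intro smooth_on_add[OF assms(1)] smooth_on_linear[of "\<lambda>y. (y, 0)" S f, OF _ assms(1,2)]
        smooth_on_linear[of "\<lambda>z. (0, z)" S g, OF _ assms(1,3)])
  then show ?thesis by simp
qed

lemma smooth_on_fd: "smooth_on f S \<Longrightarrow> smooth_on (\<lambda>x. fd f x v) S"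
  unfolding smooth_on_def using Ck_on.simps(2) by blast

lemma smooth_on_differentiable: "smooth_on f S \<Longrightarrow> x \<in> S \<Longrightarrow> f differentiable at x"
  unfolding smooth_on_def using Ck_on.simps(2) by blast

lemma smooth_on_has_derivative: "smooth_on f S \<Longrightarrow> x \<in> S \<Longrightarrow> (f has_derivative fd f x) (at x)"
  using smooth_on_differentiable frechet_derivative_works by blast

lemma smooth_on_continuous: "smooth_on f S \<Longrightarrow> continuous_on S f"
  unfolding smooth_on_def using Ck_on.simps(1) by blast

lemma smooth_on_linear_fd: "smooth_on f S \<Longrightarrow> x \<in> S \<Longrightarrow> linear (fd f x)"
  using smooth_on_differentiable linear_fd by blast

text \<open>The basis expansion of \<open>a x\<close> reduces the claim to products, so smoothness
  of \<open>L\<close> has to be known only for fixed basis vectors. Jacobians acting on fibre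
  coordinates have this form.\<close>

lemma smooth_on_linear_family:
  fixes L :: "'a::euclidean_space \<Rightarrow> 'b::euclidean_space \<Rightarrow> 'c::real_normed_vector"
    and f :: "'d::euclidean_space \<Rightarrow> 'a"
  assumes "open S" "open T" "f ` S \<subseteq> T" "smooth_on f S" "smooth_on a S"
    and "\<And>c. c \<in> Basis \<Longrightarrow> smooth_on (\<lambda>x. L x c) T" "\<And>x. x \<in> T \<Longrightarrow> linear (L x)"
  shows "smooth_on (\<lambda>x. L (f x) (a x)) S"
proof -
  have "smooth_on (\<lambda>x. \<Sum>c\<in>Basis. (a x \<bullet> c) *\<^sub>R L (f x) c) S"
    by (intro smooth_intros assms finite_Basis)
       (rule smooth_on_compose[OF assms(1-4)], rule assms(6))
  moreover have "L (f x) (a x) = (\<Sum>c\<in>Basis. (a x \<bullet> c) *\<^sub>R L (f x) c)" if "x \<in> S" for x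
    using assms(3,7) that linear_sum_Basis by blast
  ultimately show ?thesis using smooth_on_cong[OF assms(1)] by (metis (no_types, lifting))
qed

text \<open>A product rule that does not treat \<open>L\<close> as a map into a space of operators:
  only the evaluations \<open>L y c\<close> are differentiated, and linearity in \<open>c\<close>
  assembles them.\<close>

lemma has_derivative_linear_family:
  fixes L :: "'a::euclidean_space \<Rightarrow> 'b::euclidean_space \<Rightarrow> 'c::real_normed_vector"
    and f :: "'d::euclidean_space \<Rightarrow> 'a"
  assumes "open T" "f x \<in> T" "(f has_derivative f') (at x)" "(a has_derivative a') (at x)"
    and diff: "\<And>c. (\<lambda>y. L y c) differentiable at (f x)" and lin: "\<And>y. y \<in> T \<Longrightarrow> linear (L y)"
  shows "((\<lambda>z. L (f z) (a z)) has_derivative (\<lambda>v. fd (\<lambda>y. L y (a x)) (f x) (f' v) + L (f x) (a' v))) (at x)"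
proof -
  have Lf: "((\<lambda>z. L (f z) c) has_derivative (\<lambda>v. fd (\<lambda>y. L y c) (f x) (f' v))) (at x)" for c
    using has_derivative_compose[OF assms(3)] diff frechet_derivative_works by blast
  have D: "((\<lambda>z. \<Sum>c\<in>Basis. (a z \<bullet> c) *\<^sub>R L (f z) c) has_derivative
        (\<lambda>v. \<Sum>c\<in>Basis. (a x \<bullet> c) *\<^sub>R fd (\<lambda>y. L y c) (f x) (f' v) + (a' v \<bullet> c) *\<^sub>R L (f x) c)) (at x)"
    by (intro has_derivative_sum has_derivative_scaleR has_derivative_inner_left Lf assms(4))
  \<comment> \<open>The basis expansion equals \<open>L (f z) (a z)\<close> only where
    \<open>L (f z)\<close> is linear, hence the neighbourhood that \<open>f\<close> maps into
    \<open>T\<close>.\<close>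
  have "continuous (at x) f" using assms(3) has_derivative_continuous by blast
  then obtain U where U: "open U" "x \<in> U" "f ` U \<subseteq> T"
    by (metis (no_types, lifting) assms(1,2) continuous_at_open image_subset_iff)
  have fdL: "fd (\<lambda>y. L y b) (f x) u = (\<Sum>c\<in>Basis. (b \<bullet> c) *\<^sub>R fd (\<lambda>y. L y c) (f x) u)" for b u
  proof -
    have "fd (\<lambda>y. L y b) (f x) = fd (\<lambda>y. \<Sum>c\<in>Basis. (b \<bullet> c) *\<^sub>R L y c) (f x)"
      by (rule fd_cong_open[OF assms(1,2) linear_sum_Basis[OF lin]])
    also have "\<dots> = (\<lambda>u. \<Sum>c\<in>Basis. (b \<bullet> c) *\<^sub>R fd (\<lambda>y. L y c) (f x) u)"
      by (intro fd_eqI has_derivative_sum has_derivative_scaleR_right)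
         (simp add: diff frechet_derivative_works[symmetric])
    finally show ?thesis by simp
  qed
  have eq: "(\<lambda>v. \<Sum>c\<in>Basis. (a x \<bullet> c) *\<^sub>R fd (\<lambda>y. L y c) (f x) (f' v) + (a' v \<bullet> c) *\<^sub>R L (f x) c)
      = (\<lambda>v. fd (\<lambda>y. L y (a x)) (f x) (f' v) + L (f x) (a' v))"
  proof
    fix v
    have "L (f x) (a' v) = (\<Sum>c\<in>Basis. (a' v \<bullet> c) *\<^sub>R L (f x) c)"
      by (rule linear_sum_Basis[OF lin[OF assms(2)]])
    then show "(\<Sum>c\<in>Basis. (a x \<bullet> c) *\<^sub>R fd (\<lambda>y. L y c) (f x) (f' v) + (a' v \<bullet> c) *\<^sub>R L (f x) c)
      = fd (\<lambda>y. L y (a x)) (f x) (f' v) + L (f x) (a' v)"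
      by (simp only: sum.distrib fdL[of "a x"])
  qed
  have "(\<Sum>c\<in>Basis. (a z \<bullet> c) *\<^sub>R L (f z) c) = L (f z) (a z)" if "z \<in> U" for z
    using lin linear_sum_Basis that U(3) by (metis image_subset_iff)
  then show ?thesis
    using has_derivative_transform_within_open[OF D U(1,2)] eq by auto
qed

subsection \<open>Symmetry of second derivatives\<close>

text \<open>Two applications of the mean value theorem, first along \<open>u\<close> to the
  increment in direction \<open>v\<close>, then along \<open>v\<close> to the derivative in
  direction \<open>u\<close>.\<close>

lemma second_difference_mvt:
  fixes f :: "'a::euclidean_space \<Rightarrow> real"
  assumes f: "smooth_on f S" and h: "0 < h"
    and S: "\<forall>s\<in>{0..h}. \<forall>t\<in>{0..h}. x + s *\<^sub>R u + t *\<^sub>R v \<in> S"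
  shows "\<exists>s\<in>{0..h}. \<exists>t\<in>{0..h}.
    f (x + h *\<^sub>R u + h *\<^sub>R v) - f (x + h *\<^sub>R u) - (f (x + h *\<^sub>R v) - f x)
       = h * h * fd (\<lambda>z. fd f z u) (x + s *\<^sub>R u + t *\<^sub>R v) v"
proof -
  \<comment> \<open>The increment of \<open>f\<close> along \<open>h *\<^sub>R v\<close>, as a
    function of the position on the side \<open>u\<close>; the second difference is
    \<open>F h - F 0\<close>.\<close>
  define F where "F = (\<lambda>s. f (x + s *\<^sub>R u + h *\<^sub>R v) - f (x + s *\<^sub>R u + 0 *\<^sub>R v))"
  have der: "((\<lambda>s. f (x + s *\<^sub>R u + t *\<^sub>R v)) has_derivative (\<lambda>r. r * fd f (x + s *\<^sub>R u + t *\<^sub>R v) u)) (at s)"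
    if "0 \<le> s" "s \<le> h" "0 \<le> t" "t \<le> h" for s t
  proof -
    have fS: "x + s *\<^sub>R u + t *\<^sub>R v \<in> S" using S that by simp
    have 1: "((\<lambda>s. x + s *\<^sub>R u + t *\<^sub>R v) has_derivative (\<lambda>r. r *\<^sub>R u)) (at s)"
      by (auto intro!: derivative_eq_intros)
    have "((\<lambda>s. f (x + s *\<^sub>R u + t *\<^sub>R v)) has_derivative (\<lambda>r. fd f (x + s *\<^sub>R u + t *\<^sub>R v) (r *\<^sub>R u))) (at s)"
      using has_derivative_compose[OF 1 smooth_on_has_derivative[OF f fS]] .
    then show ?thesis using linear_scale[OF smooth_on_linear_fd[OF f fS]] by simp
  qed
  have der2: "((\<lambda>t. fd f (x + s *\<^sub>R u + t *\<^sub>R v) u) has_derivative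
       (\<lambda>r. r * fd (\<lambda>z. fd f z u) (x + s *\<^sub>R u + t *\<^sub>R v) v)) (at t)"
    if "0 \<le> s" "s \<le> h" "0 \<le> t" "t \<le> h" for s t
  proof -
    have fS: "x + s *\<^sub>R u + t *\<^sub>R v \<in> S" using S that by simp
    have 1: "((\<lambda>t. x + s *\<^sub>R u + t *\<^sub>R v) has_derivative (\<lambda>r. r *\<^sub>R v)) (at t)"
      by (auto intro!: derivative_eq_intros)
    note f' = smooth_on_fd[OF f, of u]
    have "((\<lambda>t. fd f (x + s *\<^sub>R u + t *\<^sub>R v) u) has_derivative
        (\<lambda>r. fd (\<lambda>z. fd f z u) (x + s *\<^sub>R u + t *\<^sub>R v) (r *\<^sub>R v))) (at t)"
      using has_derivative_compose[OF 1 smooth_on_has_derivative[OF f' fS]] .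
    then show ?thesis using linear_scale[OF smooth_on_linear_fd[OF f' fS]] by simp
  qed
  have "\<exists>s. 0 < s \<and> s < h \<and> F h - F 0 = (h - 0) * (fd f (x + s *\<^sub>R u + h *\<^sub>R v) u - fd f (x + s *\<^sub>R u + 0 *\<^sub>R v) u)"
  proof -
    have *: "(F has_derivative (\<lambda>r. r * (fd f (x + s *\<^sub>R u + h *\<^sub>R v) u - fd f (x + s *\<^sub>R u + 0 *\<^sub>R v) u))) (at s)"
      if "0 \<le> s" "s \<le> h" for s
      using has_derivative_diff[OF der[OF that, of h] der[OF that, of 0]] h
      unfolding F_def by (simp add: right_diff_distrib)
    have "continuous_on {0..h} F"
      by (rule continuous_at_imp_continuous_on) (use * has_derivative_continuous in fastforce)
    then show ?thesis
      using mvt[of 0 h F "\<lambda>s r. r * (fd f (x + s *\<^sub>R u + h *\<^sub>R v) u - fd f (x + s *\<^sub>R u + 0 *\<^sub>R v) u)"] h *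
      by (metis less_eq_real_def)
  qed
  then obtain s where s: "0 < s" "s < h"
    "F h - F 0 = h * (fd f (x + s *\<^sub>R u + h *\<^sub>R v) u - fd f (x + s *\<^sub>R u + 0 *\<^sub>R v) u)" by auto
  have "\<exists>t. 0 < t \<and> t < h \<and> fd f (x + s *\<^sub>R u + h *\<^sub>R v) u - fd f (x + s *\<^sub>R u + 0 *\<^sub>R v) u
     = (h - 0) * fd (\<lambda>z. fd f z u) (x + s *\<^sub>R u + t *\<^sub>R v) v"
  proof -
    let ?G = "\<lambda>t. fd f (x + s *\<^sub>R u + t *\<^sub>R v) u"
    note * = der2[of s] 
    have "continuous_on {0..h} ?G"
      by (rule continuous_at_imp_continuous_on) (use * s has_derivative_continuous in fastforce)
    then show ?thesis
      using mvt[of 0 h ?G "\<lambda>t r. r * fd (\<lambda>z. fd f z u) (x + s *\<^sub>R u + t *\<^sub>R v) v"] h * s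
      by (metis less_eq_real_def)
  qed
  then obtain t where t: "0 < t" "t < h" "fd f (x + s *\<^sub>R u + h *\<^sub>R v) u - fd f (x + s *\<^sub>R u + 0 *\<^sub>R v) u
     = h * fd (\<lambda>z. fd f z u) (x + s *\<^sub>R u + t *\<^sub>R v) v" by auto
  show ?thesis
  proof (intro bexI)
    show "f (x + h *\<^sub>R u + h *\<^sub>R v) - f (x + h *\<^sub>R u) - (f (x + h *\<^sub>R v) - f x)
       = h * h * fd (\<lambda>z. fd f z u) (x + s *\<^sub>R u + t *\<^sub>R v) v"
      using s(3) t(3) by (simp add: F_def)
  qed (use s t in auto)
qed

text \<open>The second difference is symmetric in \<open>u\<close> and \<open>v\<close>, so the two
  mixed derivatives take equal values at suitable points arbitrarily close to \<open>x\<close>;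
  their continuity carries this over to \<open>x\<close>.\<close>

lemma second_derivative_symmetric_real:
  fixes f :: "'a::euclidean_space \<Rightarrow> real"
  assumes "open S" and f: "smooth_on f S" and x: "x \<in> S"
  shows "fd (\<lambda>z. fd f z u) x v = fd (\<lambda>z. fd f z v) x u"
proof (rule ccontr)
  let ?A = "\<lambda>z. fd (\<lambda>z. fd f z u) z v" and ?B = "\<lambda>z. fd (\<lambda>z. fd f z v) z u"
  assume neq: "?A x \<noteq> ?B x"
  \<comment> \<open>Half the gap: two values closer than \<open>e\<close> to \<open>?A x\<close> and
    to \<open>?B x\<close> respectively cannot coincide.\<close>
  define e where "e = \<bar>?A x - ?B x\<bar> / 2"
  have e: "e > 0" using neq e_def by simp
  have cont: "continuous (at x) ?A" "continuous (at x) ?B"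
    using smooth_on_continuous[OF smooth_on_fd[OF smooth_on_fd[OF f]]] assms(1) x
      continuous_on_eq_continuous_at by blast+
  obtain d1 where d1: "d1 > 0" "\<And>z. dist z x < d1 \<Longrightarrow> dist (?A z) (?A x) < e"
    using cont(1) e unfolding continuous_at_eps_delta by meson
  obtain d2 where d2: "d2 > 0" "\<And>z. dist z x < d2 \<Longrightarrow> dist (?B z) (?B x) < e"
    using cont(2) e unfolding continuous_at_eps_delta by meson
  obtain d3 where d3: "d3 > 0" "ball x d3 \<subseteq> S" using assms(1) x open_contains_ball by blast
  define d where "d = min d1 (min d2 d3)"
  \<comment> \<open>Small enough that the parallelogram with sides \<open>h *\<^sub>R u\<close> and
    \<open>h *\<^sub>R v\<close> stays within \<open>d / 2\<close> of \<open>x\<close>; the summand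
    1 keeps the denominator positive when both vectors vanish.\<close>
  define h where "h = d / (2 * (norm u + norm v + 1))"
  have d: "d > 0" using d1 d2 d3 by (simp add: d_def)
  have h: "h > 0" unfolding h_def using d by (simp add: add_nonneg_pos)
  have near: "dist (x + s *\<^sub>R u + t *\<^sub>R v) x < d" if "0 \<le> s" "s \<le> h" "0 \<le> t" "t \<le> h" for s t
  proof -
    have "dist (x + s *\<^sub>R u + t *\<^sub>R v) x \<le> s * norm u + t * norm v"
      using that norm_triangle_ineq[of "s *\<^sub>R u" "t *\<^sub>R v"] by (simp add: dist_norm)
    also have "\<dots> \<le> h * norm u + h * norm v"
      using that mult_right_mono[of s h "norm u"] mult_right_mono[of t h "norm v"] by simp
    also have "\<dots> \<le> h * (norm u + norm v + 1)" using h by (simp add: algebra_simps)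
    also have "\<dots> = d / 2"
      unfolding h_def using add_nonneg_pos[of "norm u + norm v" 1] by (simp add: field_simps)
    also have "\<dots> < d" using d by simp
    finally show ?thesis .
  qed
  then have inS: "x + s *\<^sub>R u + t *\<^sub>R v \<in> S" if "0 \<le> s" "s \<le> h" "0 \<le> t" "t \<le> h" for s t
    using that d3(2) d_def by (metis dist_commute mem_ball min_less_iff_conj subsetD)
  obtain s t where st: "0 \<le> s" "s \<le> h" "0 \<le> t" "t \<le> h"
    "f (x + h *\<^sub>R u + h *\<^sub>R v) - f (x + h *\<^sub>R u) - (f (x + h *\<^sub>R v) - f x) = h * h * ?A (x + s *\<^sub>R u + t *\<^sub>R v)"
    using second_difference_mvt[OF f h, of x u v] inS by auto
  have inS': "x + s *\<^sub>R v + t *\<^sub>R u \<in> S" if "0 \<le> s" "s \<le> h" "0 \<le> t" "t \<le> h" for s t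
    using inS[of t s] that by (simp add: add.assoc add.commute add.left_commute)
  obtain s' t' where st': "0 \<le> s'" "s' \<le> h" "0 \<le> t'" "t' \<le> h"
    "f (x + h *\<^sub>R v + h *\<^sub>R u) - f (x + h *\<^sub>R v) - (f (x + h *\<^sub>R u) - f x) = h * h * ?B (x + s' *\<^sub>R v + t' *\<^sub>R u)"
    using second_difference_mvt[OF f h, of x v u] inS' by auto
  have "f (x + h *\<^sub>R u + h *\<^sub>R v) - f (x + h *\<^sub>R u) - (f (x + h *\<^sub>R v) - f x)
      = f (x + h *\<^sub>R v + h *\<^sub>R u) - f (x + h *\<^sub>R v) - (f (x + h *\<^sub>R u) - f x)"
    by (simp add: algebra_simps)
  then have "h * h * ?A (x + s *\<^sub>R u + t *\<^sub>R v) = h * h * ?B (x + s' *\<^sub>R v + t' *\<^sub>R u)"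
    using st(5) st'(5) by metis
  then have "?A (x + s *\<^sub>R u + t *\<^sub>R v) = ?B (x + s' *\<^sub>R v + t' *\<^sub>R u)" using h by simp
  moreover have "dist (?A (x + s *\<^sub>R u + t *\<^sub>R v)) (?A x) < e"
    using near[OF st(1-4)] by (intro d1) (simp add: d_def)
  moreover have "dist (?B (x + s' *\<^sub>R v + t' *\<^sub>R u)) (?B x) < e"
    using near[OF st'(3,4,1,2)] by (intro d2) (simp add: d_def add.assoc add.commute add.left_commute)
  ultimately show False unfolding e_def dist_real_def by (simp add: abs_if split: if_splits)
qed

lemma fd_linear_compose:
  assumes "bounded_linear L" "f differentiable at x"
  shows "fd (\<lambda>z. L (f z)) x v = L (fd f x v)"
proof -
  have "((\<lambda>z. L (f z)) has_derivative (\<lambda>v. L (fd f x v))) (at x)"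
    using assms(2) by (intro bounded_linear.has_derivative[OF assms(1)]) (simp add: frechet_derivative_works)
  from fd_eqI[OF this] show ?thesis by simp
qed

lemma second_derivative_symmetric:
  fixes f :: "'a::euclidean_space \<Rightarrow> 'b::euclidean_space"
  assumes S: "open S" and f: "smooth_on f S" and x: "x \<in> S"
  shows "fd (\<lambda>z. fd f z u) x v = fd (\<lambda>z. fd f z v) x u"
proof (rule euclidean_eqI)
  fix c :: 'b
  have *: "fd (\<lambda>z. fd (\<lambda>y. f y \<bullet> c) z u) x v = fd (\<lambda>z. fd f z u) x v \<bullet> c" for u v
  proof -
    have "fd (\<lambda>z. fd (\<lambda>y. f y \<bullet> c) z u) x = fd (\<lambda>z. fd f z u \<bullet> c) x"
      by (rule fd_cong_open[OF S x fd_linear_compose[OF bounded_linear_inner_left smooth_on_differentiable[OF f]]])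
    then show ?thesis
      using fd_linear_compose[OF bounded_linear_inner_left smooth_on_differentiable[OF smooth_on_fd[OF f] x]]
      by simp
  qed
  have "smooth_on (\<lambda>y. f y \<bullet> c) S" using S f by (intro smooth_intros)
  from second_derivative_symmetric_real[OF S this x, of u v] * 
  show "fd (\<lambda>z. fd f z u) x v \<bullet> c = fd (\<lambda>z. fd f z v) x u \<bullet> c" by simp
qed

subsection \<open>Smooth bump functions\<close>

text \<open>Differentiating \<open>exp (- (1 / t))\<close> produces negative powers of
  \<open>t\<close>. Admitting all of them makes the family closed under differentiation, so one
  induction on the order of smoothness treats every \<open>n\<close>.\<close>

definition flat_exp :: "nat \<Rightarrow> real \<Rightarrow> real" where
  "flat_exp n t = (if t \<le> 0 then 0 else exp (- (1 / t)) / t ^ n)"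

lemma flat_exp_tendsto_0: "(flat_exp n \<longlongrightarrow> 0) (at_right 0)"
proof -
  have "((\<lambda>s::real. s ^ n / exp s) \<longlongrightarrow> 0) at_top" by (rule tendsto_power_div_exp_0)
  then have "((\<lambda>t::real. (inverse t) ^ n / exp (inverse t)) \<longlongrightarrow> 0) (at_right 0)"
    by (rule filterlim_compose[OF _ filterlim_inverse_at_top_right])
  moreover have "eventually (\<lambda>t::real. (inverse t) ^ n / exp (inverse t) = flat_exp n t) (at_right 0)"
    using eventually_at_right_less[of 0]
    by eventually_elim (simp add: flat_exp_def exp_minus divide_inverse power_inverse mult.commute)
  ultimately show ?thesis by (rule Lim_transform_eventually)
qed

lemma flat_exp_has_derivative:
  "(flat_exp n has_real_derivative (flat_exp (n + 2) t - n * flat_exp (n + 1) t)) (at t)"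
proof -
  consider "t < 0" | "t = 0" | "t > 0" by linarith
  then show ?thesis
  proof cases
    case 1
    have "((\<lambda>_. 0) has_real_derivative 0) (at t)" by simp
    then have "(flat_exp n has_real_derivative 0) (at t)"
      by (rule has_field_derivative_transform_within_open[where S = "{..<0}"]) (use 1 in \<open>auto simp: flat_exp_def\<close>)
    then show ?thesis using 1 by (simp add: flat_exp_def)
  next
    case 2
    have "((\<lambda>h. (flat_exp n (0 + h) - flat_exp n 0) / h) \<longlongrightarrow> 0) (at 0)"
    proof (rule filterlim_split_at)
      have "eventually (\<lambda>h. 0 = (flat_exp n (0 + h) - flat_exp n 0) / h) (at_left (0::real))"
        using eventually_at_left_real[of "-1" "0::real"]
        by (auto elim!: eventually_mono simp: flat_exp_def)
      then show "((\<lambda>h. (flat_exp n (0 + h) - flat_exp n 0) / h) \<longlongrightarrow> 0) (at_left 0)"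
        by (rule Lim_transform_eventually[OF tendsto_const])
      \<comment> \<open>To the right of 0 the difference quotient at 0 is itself a member of the
        family, whose limit is known.\<close>
      have "eventually (\<lambda>h. flat_exp (n + 1) h = (flat_exp n (0 + h) - flat_exp n 0) / h) (at_right (0::real))"
        using eventually_at_right_less[of 0] by eventually_elim (simp add: flat_exp_def)
      then show "((\<lambda>h. (flat_exp n (0 + h) - flat_exp n 0) / h) \<longlongrightarrow> 0) (at_right 0)"
        by (rule Lim_transform_eventually[OF flat_exp_tendsto_0])
    qed
    then show ?thesis using 2 by (simp add: DERIV_def flat_exp_def)
  next
    case 3
    have "((\<lambda>t. exp (- (1 / t)) / t ^ n) has_real_derivative
        (exp (- (1 / t)) / t ^ (n + 2) - n * (exp (- (1 / t)) / t ^ (n + 1)))) (at t)"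
      using 3 by (auto intro!: derivative_eq_intros simp: field_simps power2_eq_square)
         (cases n; simp add: field_simps)+
    then have "(flat_exp n has_real_derivative
        (exp (- (1 / t)) / t ^ (n + 2) - n * (exp (- (1 / t)) / t ^ (n + 1)))) (at t)"
      by (rule has_field_derivative_transform_within_open[where S = "{0<..}"]) (use 3 in \<open>auto simp: flat_exp_def\<close>)
    then show ?thesis using 3 by (simp add: flat_exp_def)
  qed
qed

lemma smooth_on_flat_exp: "smooth_on (flat_exp n) UNIV"
proof -
  have "Ck_on k (flat_exp n) UNIV" for k
  proof (induction k arbitrary: n)
    case 0
    then show ?case
      using flat_exp_has_derivative DERIV_isCont continuous_at_imp_continuous_on by (metis Ck_on.simps(1))
  next
    case (Suc k)
    show ?case
    proof (rule Ck_on_SucI)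
      show "(flat_exp n has_derivative (\<lambda>v. (flat_exp (n + 2) t - n * flat_exp (n + 1) t) * v)) (at t)" for t
        using flat_exp_has_derivative has_field_derivative_def by blast
      show "Ck_on k (\<lambda>t. (flat_exp (n + 2) t - real n * flat_exp (n + 1) t) * v) UNIV" for v
      proof -
        have "Ck_on k (\<lambda>t. flat_exp (n + 2) t * v + flat_exp (n + 1) t * (- real n * v)) UNIV"
          by (intro Ck_on_add bounded_bilinear.Ck_on_bilinear[OF bounded_bilinear_mult] Ck_on_const Suc.IH open_UNIV)
        then show ?thesis by (simp add: algebra_simps)
      qed
    qed auto
  qed
  then show ?thesis unfolding smooth_on_def by blast
qed

text \<open>Applying \<open>flat_exp 0\<close> twice avoids the smoothness of quotients of functions.\<close>

definition smooth_step :: "real \<Rightarrow> real" where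
  "smooth_step t = 1 - flat_exp 0 (flat_exp 0 (1/2) - flat_exp 0 t) / flat_exp 0 (flat_exp 0 (1/2))"

lemma smooth_step_0: "t \<le> 0 \<Longrightarrow> smooth_step t = 0"
  by (simp add: smooth_step_def flat_exp_def)

lemma smooth_step_1: "t \<ge> 1/2 \<Longrightarrow> smooth_step t = 1"
  by (simp add: smooth_step_def flat_exp_def field_simps)

lemma smooth_on_smooth_step: "smooth_on smooth_step UNIV"
proof -
  have "smooth_on (\<lambda>t. 1 - flat_exp 0 (flat_exp 0 (1/2) - flat_exp 0 t) * inverse (flat_exp 0 (flat_exp 0 (1/2)))) UNIV"
    by (intro smooth_intros open_UNIV
        smooth_on_compose[OF open_UNIV open_UNIV _ _ smooth_on_flat_exp, where f = "\<lambda>t. flat_exp 0 (1/2) - flat_exp 0 t"]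
        smooth_on_flat_exp subset_UNIV)
  then show ?thesis unfolding smooth_step_def[abs_def] divide_inverse .
qed

lemma bump_function:
  fixes x :: "'a::euclidean_space"
  assumes "r > 0"
  obtains \<beta> :: "'a \<Rightarrow> real" and s where "smooth_on \<beta> UNIV" "0 < s" "\<And>y. y \<in> ball x s \<Longrightarrow> \<beta> y = 1"
    "\<And>y. y \<notin> cball x r \<Longrightarrow> \<beta> y = 0"
proof
  \<comment> \<open>On the ball of radius \<open>r / 2\<close> this is at least 3/4, hence above the
    threshold 1/2 from which \<open>smooth_step\<close> is 1; outside \<open>cball x r\<close> it is
    at most 0. The squared norm keeps it smooth at \<open>x\<close>.\<close>
  let ?h = "\<lambda>y. 1 - ((y - x) \<bullet> (y - x)) * inverse (r\<^sup>2)"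
  have "smooth_on ?h UNIV" by (intro smooth_intros open_UNIV)
  then show "smooth_on (\<lambda>y. smooth_step (?h y)) UNIV"
    by (rule smooth_on_compose[OF open_UNIV open_UNIV subset_UNIV _ smooth_on_smooth_step])
  show "0 < r / 2" using assms by simp
  show "smooth_step (?h y) = 1" if "y \<in> ball x (r / 2)" for y
  proof -
    have "norm (y - x) \<le> r / 2" using that by (simp add: dist_norm norm_minus_commute)
    then have "(norm (y - x))\<^sup>2 \<le> (r / 2)\<^sup>2" by (simp add: power_mono)
    then have "(y - x) \<bullet> (y - x) \<le> r\<^sup>2 / 4"
      by (simp add: power2_norm_eq_inner power_divide)
    also have "\<dots> \<le> 1 / 2 * r\<^sup>2" by simp
    finally have "(y - x) \<bullet> (y - x) * inverse (r\<^sup>2) \<le> 1 / 2"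
      using assms by (simp only: divide_inverse[symmetric] pos_divide_le_eq zero_less_power)
    then have "1 - (y - x) \<bullet> (y - x) * inverse (r\<^sup>2) \<ge> 1 / 2" by linarith
    then show ?thesis by (rule smooth_step_1)
  qed
  show "smooth_step (?h y) = 0" if "y \<notin> cball x r" for y
  proof -
    have "r \<le> norm (y - x)" using that by (simp add: dist_norm norm_minus_commute)
    then have "r\<^sup>2 \<le> (norm (y - x))\<^sup>2" using assms by (simp add: power_mono)
    then have "1 \<le> (y - x) \<bullet> (y - x) * inverse (r\<^sup>2)"
      using assms by (simp add: power2_norm_eq_inner field_simps)
    then have "1 - (y - x) \<bullet> (y - x) * inverse (r\<^sup>2) \<le> 0" by linarith
    then show ?thesis by (rule smooth_step_0)
  qed
qed

subsection \<open>Charts, transition maps and tangent vectors\<close>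

abbreviation overlap :: "('i,'p,'e) atlas \<Rightarrow> 'i \<Rightarrow> 'i \<Rightarrow> 'e set" where
  "overlap N i j \<equiv> Crd N i ` (Dom N i \<inter> Dom N j)"

abbreviation chg :: "('i,'p,'e) atlas \<Rightarrow> 'i \<Rightarrow> 'i \<Rightarrow> 'e \<Rightarrow> 'e" where
  "chg N i j \<equiv> Crd N j \<circ> Prm N i"

locale satlas =
  fixes N :: "('i, 'p, 'e::euclidean_space) atlas"
  assumes atlas: "smooth_atlas N"
begin

lemma charts_at_iff: "i \<in> charts_at N p \<longleftrightarrow> i \<in> Idx N \<and> p \<in> Dom N i"
  by (auto simp: charts_at_def)

lemma chart_at_mem: "p \<in> carrier N \<Longrightarrow> chart_at N p \<in> charts_at N p"
  unfolding chart_at_def by (rule someI_ex) (auto simp: carrier_def charts_at_def)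

lemma Dom_carrier: "i \<in> Idx N \<Longrightarrow> p \<in> Dom N i \<Longrightarrow> p \<in> carrier N"
  by (auto simp: carrier_def)

lemma inj_Crd: "i \<in> Idx N \<Longrightarrow> inj_on (Crd N i) (Dom N i)"
  using atlas by (simp add: smooth_atlas_def)

lemma Prm_Crd: "i \<in> Idx N \<Longrightarrow> p \<in> Dom N i \<Longrightarrow> Prm N i (Crd N i p) = p"
  unfolding Prm_def using inj_Crd inv_into_f_f by metis

lemma Crd_Img: "p \<in> Dom N i \<Longrightarrow> Crd N i p \<in> Img N i"
  by (simp add: Img_def)

lemma Prm_Dom: "y \<in> Img N i \<Longrightarrow> Prm N i y \<in> Dom N i"
  by (simp add: Img_def Prm_def inv_into_into)

lemma Crd_Prm: "y \<in> Img N i \<Longrightarrow> Crd N i (Prm N i y) = y"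
  by (simp add: Img_def Prm_def f_inv_into_f)

lemma Prm_carrier: "i \<in> Idx N \<Longrightarrow> y \<in> Img N i \<Longrightarrow> Prm N i y \<in> carrier N"
  using Prm_Dom Dom_carrier by blast

lemma open_overlap: "i \<in> Idx N \<Longrightarrow> j \<in> Idx N \<Longrightarrow> open (overlap N i j)"
  using atlas by (simp add: smooth_atlas_def)

lemma open_Img: "i \<in> Idx N \<Longrightarrow> open (Img N i)"
  using open_overlap[of i i] by (simp add: Img_def)

lemma overlap_subset: "overlap N i j \<subseteq> Img N i"
  by (auto simp: Img_def)

lemma mem_overlap_iff: "i \<in> Idx N \<Longrightarrow> y \<in> overlap N i j \<longleftrightarrow> y \<in> Img N i \<and> Prm N i y \<in> Dom N j"
  using Prm_Crd Crd_Prm Prm_Dom overlap_subset by (force simp: Img_def)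

lemma Crd_overlap: "p \<in> Dom N i \<Longrightarrow> p \<in> Dom N j \<Longrightarrow> Crd N i p \<in> overlap N i j"
  by blast

lemma trans_smooth: "i \<in> Idx N \<Longrightarrow> j \<in> Idx N \<Longrightarrow> smooth_on (chg N i j) (overlap N i j)"
  using atlas by (simp add: smooth_atlas_def)

lemma trans_self: "y \<in> Img N i \<Longrightarrow> chg N i i y = y"
  by (simp add: Crd_Prm)

lemma Prm_trans: "i \<in> Idx N \<Longrightarrow> j \<in> Idx N \<Longrightarrow> y \<in> overlap N i j \<Longrightarrow> Prm N j (chg N i j y) = Prm N i y"
  by (simp add: Prm_Crd mem_overlap_iff)

lemma trans_overlap: "i \<in> Idx N \<Longrightarrow> j \<in> Idx N \<Longrightarrow> y \<in> overlap N i j \<Longrightarrow> chg N i j y \<in> overlap N j i"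
  using Prm_Crd by fastforce

lemma trans_trans:
  "i \<in> Idx N \<Longrightarrow> j \<in> Idx N \<Longrightarrow> y \<in> overlap N i j \<Longrightarrow> chg N j k (chg N i j y) = chg N i k y"
  using Prm_trans by simp

lemma trans_inverse:
  "i \<in> Idx N \<Longrightarrow> j \<in> Idx N \<Longrightarrow> y \<in> overlap N i j \<Longrightarrow> chg N j i (chg N i j y) = y"
  using Prm_trans Crd_Prm overlap_subset[of i j] by (metis comp_apply subsetD)

lemma trans_has_derivative:
  "i \<in> Idx N \<Longrightarrow> j \<in> Idx N \<Longrightarrow> y \<in> overlap N i j \<Longrightarrow>
     (chg N i j has_derivative fd (chg N i j) y) (at y)"
  by (rule smooth_on_has_derivative[OF trans_smooth])

lemma linear_jac: "i \<in> Idx N \<Longrightarrow> j \<in> Idx N \<Longrightarrow> y \<in> overlap N i j \<Longrightarrow> linear (fd (chg N i j) y)"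
  by (rule smooth_on_linear_fd[OF trans_smooth])

lemma jac_self: assumes "i \<in> Idx N" "y \<in> Img N i" shows "fd (chg N i i) y u = u"
proof -
  have "fd (chg N i i) y = fd (\<lambda>y. y) y"
    using trans_self by (rule fd_cong_open[OF open_Img[OF assms(1)] assms(2)])
  then show ?thesis using fd_eqI[OF has_derivative_ident, of y] by simp
qed

lemma jac_jac:
  assumes "i \<in> Idx N" "j \<in> Idx N" "k \<in> Idx N" "y \<in> overlap N i j" "y \<in> overlap N i k"
  shows "fd (chg N j k) (chg N i j y) (fd (chg N i j) y u) = fd (chg N i k) y u"
proof -
  have *: "chg N i j y \<in> overlap N j k" using assms by (simp add: mem_overlap_iff Prm_trans Prm_Crd Crd_Img)
  have "((\<lambda>y. chg N j k (chg N i j y)) has_derivative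
      (\<lambda>u. fd (chg N j k) (chg N i j y) (fd (chg N i j) y u))) (at y)"
    using has_derivative_compose[OF trans_has_derivative[OF assms(1,2,4)] trans_has_derivative[OF assms(2,3) *]] .
  moreover have "fd (\<lambda>y. chg N j k (chg N i j y)) y = fd (chg N i k) y"
    by (rule fd_cong_open[OF open_overlap[OF assms(1,2)] assms(4)]) (rule trans_trans[OF assms(1,2)])
  ultimately show ?thesis using fd_eqI by metis
qed

lemma jac_inverse:
  assumes "i \<in> Idx N" "j \<in> Idx N" "y \<in> overlap N i j"
  shows "fd (chg N j i) (chg N i j y) (fd (chg N i j) y u) = u"
proof -
  have y: "y \<in> Img N i" using assms(3) overlap_subset by blast
  then have "y \<in> overlap N i i" by (simp add: Img_def)
  from jac_jac[OF assms(1,2,1,3) this] jac_self[OF assms(1) y] show ?thesis by simp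
qed

lemma transition_deriv_eq: "transition_deriv N p i j = fd (chg N i j) (Crd N i p)"
  by (simp add: transition_deriv_def)

lemma chart_vec_component:
  "j \<in> charts_at N p \<Longrightarrow> chart_vec N i p u j = fd (chg N i j) (Crd N i p) u"
  by (simp add: chart_vec_def transition_deriv_eq)

lemma chart_vec_self: "i \<in> charts_at N p \<Longrightarrow> chart_vec N i p u i = u"
  using chart_vec_component jac_self charts_at_iff Crd_Img by metis

lemma chart_vec_tangent:
  assumes "i \<in> charts_at N p" shows "chart_vec N i p u \<in> tangent_space N p"
proof -
  have "chart_vec N i p u k = transition_deriv N p j k (chart_vec N i p u j)"
    if "j \<in> charts_at N p" "k \<in> charts_at N p" for j k
    using jac_jac[of i j k "Crd N i p" u] assms that
    by (simp add: chart_vec_component transition_deriv_eq charts_at_iff Prm_Crd)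
  moreover have "chart_vec N i p u k = 0" if "k \<notin> charts_at N p" for k
    using that by (simp add: chart_vec_def)
  ultimately show ?thesis unfolding tangent_space_def by blast
qed

lemma tangent_component:
  "v \<in> tangent_space N p \<Longrightarrow> i \<in> charts_at N p \<Longrightarrow> j \<in> charts_at N p \<Longrightarrow>
    v j = fd (chg N i j) (Crd N i p) (v i)"
  unfolding tangent_space_def transition_deriv_eq by blast

lemma chart_vec_eq:
  "v \<in> tangent_space N p \<Longrightarrow> i \<in> charts_at N p \<Longrightarrow> chart_vec N i p (v i) = v"
proof (rule ext)
  fix j assume v: "v \<in> tangent_space N p" and i: "i \<in> charts_at N p"
  show "chart_vec N i p (v i) j = v j"
  proof (cases "j \<in> charts_at N p")
    case True
    then show ?thesis using tangent_component[OF v i True] by (simp add: chart_vec_component)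
  next
    case False
    moreover have "v j = 0" using v False unfolding tangent_space_def by blast
    ultimately show ?thesis by (simp add: chart_vec_def)
  qed
qed

lemma tangent_eqI:
  "u \<in> tangent_space N p \<Longrightarrow> v \<in> tangent_space N p \<Longrightarrow> i \<in> charts_at N p \<Longrightarrow> u i = v i \<Longrightarrow> u = v"
  using chart_vec_eq by metis

lemma tangent_linear_transition: "i \<in> charts_at N p \<Longrightarrow> j \<in> charts_at N p \<Longrightarrow> linear (transition_deriv N p i j)"
  unfolding transition_deriv_eq by (intro linear_jac Crd_overlap) (auto simp: charts_at_iff)

lemma lincomb_tangent:
  assumes "u \<in> tangent_space N p" "v \<in> tangent_space N p"
  shows "lincomb r u s v \<in> tangent_space N p"
  unfolding tangent_space_def
proof (clarsimp, intro conjI ballI allI impI)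
  fix i j assume ij: "i \<in> charts_at N p" "j \<in> charts_at N p"
  have "u j = transition_deriv N p i j (u i)" "v j = transition_deriv N p i j (v i)"
    using assms ij unfolding tangent_space_def by blast+
  then show "lincomb r u s v j = transition_deriv N p i j (lincomb r u s v i)"
    using tangent_linear_transition[OF ij] by (simp add: lincomb_def linear_add linear_scale)
next
  fix i assume i: "i \<notin> charts_at N p"
  have "u i = 0" "v i = 0" using assms i unfolding tangent_space_def by blast+
  then show "lincomb r u s v i = 0" by (simp add: lincomb_def)
qed

lemma zero_tangent: "(\<lambda>_. 0) \<in> tangent_space N p"
  unfolding tangent_space_def using tangent_linear_transition linear_0 by fastforce

lemma scale_tangent: "u \<in> tangent_space N p \<Longrightarrow> (\<lambda>i. r *\<^sub>R u i) \<in> tangent_space N p"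
  using lincomb_tangent[of u p u r 0] by (simp add: lincomb_def)

lemma chart_vec_lincomb:
  assumes "i \<in> charts_at N p"
  shows "chart_vec N i p (r *\<^sub>R u + s *\<^sub>R v) = lincomb r (chart_vec N i p u) s (chart_vec N i p v)"
proof (rule tangent_eqI[of _ p _ i])
  show "lincomb r (chart_vec N i p u) s (chart_vec N i p v) \<in> tangent_space N p"
    using assms by (intro lincomb_tangent chart_vec_tangent)
qed (simp_all add: assms chart_vec_self lincomb_def chart_vec_tangent)

lemma vfield_tangent: "X \<in> vector_fields N \<Longrightarrow> p \<in> carrier N \<Longrightarrow> X p \<in> tangent_space N p"
  by (simp add: vector_fields_def)

lemma vfield_smooth: "X \<in> vector_fields N \<Longrightarrow> i \<in> Idx N \<Longrightarrow> smooth_on (vfield_crd N i X) (Img N i)"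
  by (simp add: vector_fields_def)

subsection \<open>The atlas topology\<close>

lemma openin_atlas_topology:
  "openin (atlas_topology N) U \<longleftrightarrow> U \<subseteq> carrier N \<and> (\<forall>i\<in>Idx N. open (Crd N i ` (U \<inter> Dom N i)))"
proof -
  have "istopology (\<lambda>U. U \<subseteq> carrier N \<and> (\<forall>i\<in>Idx N. open (Crd N i ` (U \<inter> Dom N i))))"
    unfolding istopology_def
  proof (intro conjI allI impI ballI)
    fix S T assume S: "S \<subseteq> carrier N \<and> (\<forall>i\<in>Idx N. open (Crd N i ` (S \<inter> Dom N i)))"
      and T: "T \<subseteq> carrier N \<and> (\<forall>i\<in>Idx N. open (Crd N i ` (T \<inter> Dom N i)))"
    then show "S \<inter> T \<subseteq> carrier N" by blast
    fix i assume i: "i \<in> Idx N"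
    \<comment> \<open>Images commute with intersections here because the chart is injective.\<close>
    have "Crd N i ` (S \<inter> T \<inter> Dom N i) = Crd N i ` (S \<inter> Dom N i) \<inter> Crd N i ` (T \<inter> Dom N i)"
      using inj_Crd[OF i] by (auto simp: inj_on_def)
    then show "open (Crd N i ` (S \<inter> T \<inter> Dom N i))" using S T i by auto
  next
    fix \<K> assume K: "\<forall>K\<in>\<K>. K \<subseteq> carrier N \<and> (\<forall>i\<in>Idx N. open (Crd N i ` (K \<inter> Dom N i)))"
    then show "\<Union>\<K> \<subseteq> carrier N" by blast
    fix i assume i: "i \<in> Idx N"
    have "Crd N i ` (\<Union>\<K> \<inter> Dom N i) = (\<Union>K\<in>\<K>. Crd N i ` (K \<inter> Dom N i))" by auto
    then show "open (Crd N i ` (\<Union>\<K> \<inter> Dom N i))" using K i by auto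
  qed
  from topology_inverse'[OF this] show ?thesis unfolding atlas_topology_def by simp
qed

lemma topspace_atlas_topology: "topspace (atlas_topology N) = carrier N"
proof -
  have "openin (atlas_topology N) (carrier N)"
    unfolding openin_atlas_topology
  proof (intro conjI ballI order_refl)
    fix i assume i: "i \<in> Idx N"
    then have "carrier N \<inter> Dom N i = Dom N i" using Dom_carrier by blast
    then show "open (Crd N i ` (carrier N \<inter> Dom N i))" using open_Img[OF i] by (simp add: Img_def)
  qed
  then show ?thesis unfolding topspace_def using openin_atlas_topology by blast
qed

lemma openin_Dom: "i \<in> Idx N \<Longrightarrow> openin (atlas_topology N) (Dom N i)"
  unfolding openin_atlas_topology using Dom_carrier open_overlap by (auto simp: Int_commute)

text \<open>Seen in another chart \<open>j\<close>, the set is the preimage of \<open>V\<close>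
  under a transition map, and transition maps are continuous on open sets.\<close>

lemma openin_Prm_image:
  assumes i: "i \<in> Idx N" and V: "open V" "V \<subseteq> Img N i"
  shows "openin (atlas_topology N) (Prm N i ` V)"
  unfolding openin_atlas_topology
proof (intro conjI ballI)
  show "Prm N i ` V \<subseteq> carrier N" using Prm_carrier i V by blast
  fix j assume j: "j \<in> Idx N"
  have "Crd N j ` (Prm N i ` V \<inter> Dom N j) = chg N j i -` V \<inter> overlap N j i"
  proof (intro equalityI subsetI)
    fix z assume "z \<in> Crd N j ` (Prm N i ` V \<inter> Dom N j)"
    then obtain y where y: "y \<in> V" "Prm N i y \<in> Dom N j" "z = chg N i j y" by auto
    then have "y \<in> overlap N i j" using V i by (auto simp: mem_overlap_iff)
    then show "z \<in> chg N j i -` V \<inter> overlap N j i"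
      using y trans_overlap[OF i j] trans_inverse[OF i j] by auto
  next
    fix z assume z: "z \<in> chg N j i -` V \<inter> overlap N j i"
    then have "Prm N j z = Prm N i (chg N j i z)" "z = Crd N j (Prm N j z)"
      using Prm_trans[OF j i] Crd_Prm by (auto simp: mem_overlap_iff[OF j])
    moreover have "Prm N j z \<in> Dom N j" using z by (auto simp: mem_overlap_iff[OF j] Prm_Dom)
    ultimately show "z \<in> Crd N j ` (Prm N i ` V \<inter> Dom N j)" using z by auto
  qed
  then show "open (Crd N j ` (Prm N i ` V \<inter> Dom N j))"
    using smooth_on_continuous[OF trans_smooth[OF j i]] open_overlap[OF j i] V
    by (metis (no_types, lifting) continuous_on_open_vimage)
qed

lemma Crd_preimage_eq: "i \<in> Idx N \<Longrightarrow> {y \<in> Img N i. Prm N i y \<in> U} = Crd N i ` (U \<inter> Dom N i)"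
  using Prm_Crd Crd_Prm Prm_Dom Crd_Img by force

lemma continuous_map_Prm:
  "i \<in> Idx N \<Longrightarrow> continuous_map (top_of_set (Img N i)) (atlas_topology N) (Prm N i)"
  unfolding continuous_map_def
proof (intro conjI allI impI)
  assume i: "i \<in> Idx N"
  show "Prm N i \<in> topspace (top_of_set (Img N i)) \<rightarrow> topspace (atlas_topology N)"
    using Prm_carrier[OF i] by (auto simp: topspace_atlas_topology)
  fix U assume U: "openin (atlas_topology N) U"
  then have "open (Crd N i ` (U \<inter> Dom N i))" using i openin_atlas_topology by blast
  then show "openin (top_of_set (Img N i)) {y \<in> topspace (top_of_set (Img N i)). Prm N i y \<in> U}"
    using Crd_preimage_eq[OF i, of U] open_Img[OF i] by (auto simp: openin_open_eq)
qed

text \<open>By the chain rule the derivative taken in the arbitrarily chosen chart can be computed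
  in any chart at \<open>p\<close>. Differentiability is required because
  \<open>frechet_derivative\<close> is meaningful only then.\<close>

lemma dir_deriv_eq:
  assumes "i \<in> charts_at N p" "v \<in> tangent_space N p" "(f \<circ> Prm N i) differentiable at (Crd N i p)"
  shows "dir_deriv N p v f = fd (f \<circ> Prm N i) (Crd N i p) (v i)"
proof -
  define k where "k = chart_at N p"
  have k: "k \<in> charts_at N p" unfolding k_def using assms(1) chart_at_mem Dom_carrier charts_at_iff by metis
  have ik: "i \<in> Idx N" "k \<in> Idx N" "p \<in> Dom N i" "p \<in> Dom N k" using k assms(1) by (auto simp: charts_at_iff)
  note ov = Crd_overlap[OF ik(4,3)]
  have tp: "chg N k i (Crd N k p) = Crd N i p" using Prm_Crd ik by simp
  have "((\<lambda>z. (f \<circ> Prm N i) (chg N k i z)) has_derivative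
      (\<lambda>w. fd (f \<circ> Prm N i) (Crd N i p) (fd (chg N k i) (Crd N k p) w))) (at (Crd N k p))"
    using has_derivative_compose[OF trans_has_derivative[OF ik(2,1) ov], of "f \<circ> Prm N i"] assms(3)
    unfolding tp by (simp add: frechet_derivative_works)
  moreover have "fd (\<lambda>z. (f \<circ> Prm N i) (chg N k i z)) (Crd N k p) = fd (f \<circ> Prm N k) (Crd N k p)"
    by (rule fd_cong_open[OF open_overlap[OF ik(2,1)] ov]) (use Prm_trans[OF ik(2,1)] in simp)
  ultimately have "fd (f \<circ> Prm N k) (Crd N k p) = (\<lambda>w. fd (f \<circ> Prm N i) (Crd N i p) (fd (chg N k i) (Crd N k p) w))"
    using fd_eqI by metis
  then show ?thesis
    unfolding dir_deriv_def Let_def k_def[symmetric]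
    using tangent_component[OF assms(2) k assms(1)] by simp
qed

end

subsection \<open>Global extensions\<close>

locale smanifold =
  fixes N :: "('i, 'p, 'e::euclidean_space) atlas"
  assumes manifold: "smooth_manifold N"

sublocale smanifold \<subseteq> satlas
  using manifold by unfold_locales (simp add: smooth_manifold_def)

context smanifold
begin

text \<open>The set \<open>K\<close> is the copy in the manifold of a closed ball in the chart. It
  is compact, and the Hausdorff property makes it closed in the whole manifold and not merely in the
  chart domain; this is what permits extension by zero.\<close>

lemma cutoff:
  assumes i: "i \<in> Idx N" and p: "p \<in> Dom N i"
  shows "\<exists>(\<beta> :: 'e \<Rightarrow> real) U K. smooth_on \<beta> UNIV \<and> open U \<and> Crd N i p \<in> U \<and> U \<subseteq> Img N i \<and>
    (\<forall>y\<in>U. \<beta> y = 1) \<and> K \<subseteq> Dom N i \<and> openin (atlas_topology N) (carrier N - K) \<and>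
    (\<forall>q\<in>Dom N i - K. \<beta> (Crd N i q) = 0)"
proof -
  obtain r where r: "r > 0" "cball (Crd N i p) r \<subseteq> Img N i"
    using open_Img[OF i] Crd_Img[OF p] open_contains_cball by blast
  obtain \<beta> s where \<beta>: "smooth_on \<beta> UNIV" "0 < s" "\<And>y. y \<in> ball (Crd N i p) s \<Longrightarrow> \<beta> y = (1::real)"
    "\<And>y. y \<notin> cball (Crd N i p) r \<Longrightarrow> \<beta> y = 0"
    using bump_function[OF r(1)] by blast
  define K where "K = Prm N i ` cball (Crd N i p) r"
  have "compactin (top_of_set (Img N i)) (cball (Crd N i p) r)"
    using r(2) by (simp add: compactin_subtopology)
  then have "compactin (atlas_topology N) K"
    unfolding K_def using continuous_map_Prm[OF i] image_compactin by blast
  moreover have "Hausdorff_space (atlas_topology N)" using manifold by (simp add: smooth_manifold_def)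
  ultimately have "closedin (atlas_topology N) K" by (rule compactin_imp_closedin[rotated])
  then have K1: "openin (atlas_topology N) (carrier N - K)" by (simp add: closedin_def topspace_atlas_topology)
  have K2: "K \<subseteq> Dom N i" unfolding K_def using r(2) Prm_Dom by blast
  have K3: "\<forall>q\<in>Dom N i - K. \<beta> (Crd N i q) = 0"
  proof
    fix q assume q: "q \<in> Dom N i - K"
    then have "Crd N i q \<notin> cball (Crd N i p) r" using Prm_Crd[OF i, of q] unfolding K_def by force
    then show "\<beta> (Crd N i q) = 0" by (rule \<beta>(4))
  qed
  have "\<forall>y\<in>ball (Crd N i p) s \<inter> Img N i. \<beta> y = 1" using \<beta>(3) by blast
  moreover have "open (ball (Crd N i p) s \<inter> Img N i)" "Crd N i p \<in> ball (Crd N i p) s \<inter> Img N i"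
    using open_Img[OF i] Crd_Img[OF p] \<beta>(2) by auto
  ultimately show ?thesis using \<beta>(1) K1 K2 K3 Int_lower2 by metis
qed

text \<open>The chart image is covered by two open sets: the overlap with chart \<open>i\<close>,
  where \<open>F\<close> is smooth, and the image of the complement of \<open>K\<close>, where
  \<open>F\<close> vanishes.\<close>

lemma smooth_on_extend_by_zero:
  assumes i: "i \<in> Idx N" and j: "j \<in> Idx N" and K: "openin (atlas_topology N) (carrier N - K)" "K \<subseteq> Dom N i"
    and F: "smooth_on F (overlap N j i)" and z: "\<And>y. y \<in> Img N j \<Longrightarrow> Prm N j y \<notin> K \<Longrightarrow> F y = 0"
  shows "smooth_on F (Img N j)"
proof -
  let ?V = "Crd N j ` ((carrier N - K) \<inter> Dom N j)"
  have V: "open ?V" using K(1) j unfolding openin_atlas_topology by blast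
  have F0: "F y = 0" if "y \<in> ?V" for y
    using that z Crd_Img Prm_Crd[OF j] by force
  have "smooth_on F ?V" by (rule smooth_on_eqI[OF V smooth_on_const F0])
  then have "smooth_on F (overlap N j i \<union> ?V)" using F V open_overlap[OF j i] smooth_on_Un by blast
  moreover have "Img N j \<subseteq> overlap N j i \<union> ?V"
    unfolding Img_def using K(2) Dom_carrier[OF j] by blast
  ultimately show ?thesis using smooth_on_subset by blast
qed

lemma smooth_on_chg_compose:
  assumes "i \<in> Idx N" "j \<in> Idx N" "smooth_on h (Img N i)"
  shows "smooth_on (\<lambda>y. h (chg N j i y)) (overlap N j i)"
proof (rule smooth_on_compose[OF open_overlap open_Img _ trans_smooth assms(3)])
  show "chg N j i ` overlap N j i \<subseteq> Img N i"
    using trans_overlap[OF assms(2,1)] overlap_subset by blast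
qed (use assms in auto)

lemma smooth_function_cutoff:
  assumes i: "i \<in> Idx N" and K: "openin (atlas_topology N) (carrier N - K)" "K \<subseteq> Dom N i"
    and h: "smooth_on h (Img N i)" "\<forall>q\<in>Dom N i - K. h (Crd N i q) = 0"
  shows "smooth_function N (\<lambda>q. if q \<in> Dom N i then h (Crd N i q) else 0)"
  unfolding smooth_function_def
proof
  fix j assume j: "j \<in> Idx N"
  let ?F = "(\<lambda>q. if q \<in> Dom N i then h (Crd N i q) else 0) \<circ> Prm N j"
  show "smooth_on ?F (Img N j)"
  proof (rule smooth_on_extend_by_zero[OF i j K])
    have eq: "?F y = h (chg N j i y)" if "y \<in> overlap N j i" for y
      using that by (simp add: mem_overlap_iff[OF j])
    show "smooth_on ?F (overlap N j i)"
      by (rule smooth_on_eqI[OF open_overlap[OF j i] smooth_on_chg_compose[OF i j h(1)] eq])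
  qed (use h(2) in auto)
qed

lemma cutoff_vfield:
  assumes i: "i \<in> Idx N" and K: "openin (atlas_topology N) (carrier N - K)" "K \<subseteq> Dom N i"
    and \<beta>: "smooth_on \<beta> (Img N i)" "\<forall>q\<in>Dom N i - K. \<beta> (Crd N i q) = 0"
  shows "(\<lambda>q j. if q \<in> Dom N i then \<beta> (Crd N i q) *\<^sub>R chart_vec N i q u j else 0) \<in> vector_fields N"
    (is "?X \<in> _")
  unfolding vector_fields_def
proof (intro CollectI conjI ballI allI impI)
  fix p assume "p \<in> carrier N"
  show "?X p \<in> tangent_space N p"
    using scale_tangent[OF chart_vec_tangent] zero_tangent i by (cases "p \<in> Dom N i") (auto simp: charts_at_iff)
next
  fix p assume "p \<notin> carrier N"
  then have "p \<notin> Dom N i" using Dom_carrier[OF i] by blast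
  then show "?X p = (\<lambda>_. 0)" by simp
next
  fix j assume j: "j \<in> Idx N"
  show "smooth_on (vfield_crd N j ?X) (Img N j)"
  proof (rule smooth_on_extend_by_zero[OF i j K])
    have eq: "vfield_crd N j ?X y = \<beta> (chg N j i y) *\<^sub>R fd (chg N i j) (chg N j i y) u"
      if "y \<in> overlap N j i" for y
      using that j by (simp add: vfield_crd_def mem_overlap_iff[OF j] chart_vec_component charts_at_iff Prm_Dom)
    have "smooth_on (\<lambda>y. fd (chg N i j) (chg N j i y) u) (overlap N j i)"
      by (rule smooth_on_compose[OF open_overlap[OF j i] open_overlap[OF i j] _ trans_smooth[OF j i]
            smooth_on_fd[OF trans_smooth[OF i j]]]) (use trans_overlap[OF j i] in blast)
    then have "smooth_on (\<lambda>y. \<beta> (chg N j i y) *\<^sub>R fd (chg N i j) (chg N j i y) u) (overlap N j i)"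
      by (rule smooth_on_scaleR[OF open_overlap[OF j i] smooth_on_chg_compose[OF i j \<beta>(1)]])
    then show "smooth_on (vfield_crd N j ?X) (overlap N j i)"
      using smooth_on_cong[OF open_overlap[OF j i] eq] by simp
  qed (use \<beta>(2) in \<open>auto simp: vfield_crd_def\<close>)
qed

lemma locally_constant_vfield:
  assumes i: "i \<in> Idx N" and p: "p \<in> Dom N i"
  obtains X U where "X \<in> vector_fields N" "open U" "Crd N i p \<in> U" "U \<subseteq> Img N i"
    "\<And>y. y \<in> U \<Longrightarrow> vfield_crd N i X y = u"
proof -
  obtain \<beta> U K where *: "smooth_on \<beta> UNIV" "open U" "Crd N i p \<in> U" "U \<subseteq> Img N i"
    "\<forall>y\<in>U. \<beta> y = 1" "K \<subseteq> Dom N i" "openin (atlas_topology N) (carrier N - K)"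
    "\<forall>q\<in>Dom N i - K. \<beta> (Crd N i q) = (0::real)"
    using cutoff[OF i p] by (elim exE conjE)
  let ?X = "\<lambda>q j. if q \<in> Dom N i then \<beta> (Crd N i q) *\<^sub>R chart_vec N i q u j else 0"
  have "?X \<in> vector_fields N"
    by (rule cutoff_vfield[OF i *(7,6) smooth_on_subset[OF *(1) subset_UNIV] *(8)])
  moreover have "vfield_crd N i ?X y = u" if "y \<in> U" for y
    using that *(4,5) i Prm_Dom Crd_Prm by (auto simp: vfield_crd_def chart_vec_self charts_at_iff)
  ultimately show ?thesis using that *(2-4) by blast
qed

text \<open>The vanishing first derivatives serve to read off coefficients: they remove the
  derivative term of a connection and the vertical part of the complete lift in this chart.\<close>

lemma vfield_through:
  assumes "v \<in> tangent_space N p" "i \<in> charts_at N p"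
  obtains X where "X \<in> vector_fields N" "X p = v"
    "fd (vfield_crd N i X) (Crd N i p) = (\<lambda>_. 0)"
proof -
  have i: "i \<in> Idx N" "p \<in> Dom N i" using assms(2) by (auto simp: charts_at_iff)
  obtain X U where X: "X \<in> vector_fields N" "open U" "Crd N i p \<in> U" "U \<subseteq> Img N i"
    "\<And>y. y \<in> U \<Longrightarrow> vfield_crd N i X y = v i"
    using locally_constant_vfield[OF i] by metis
  have "X p i = v i" using X(5)[OF X(3)] i by (simp add: vfield_crd_def Prm_Crd)
  then have "X p = v"
    using tangent_eqI[OF vfield_tangent[OF X(1) Dom_carrier[OF i]] assms] by blast
  moreover have "fd (vfield_crd N i X) (Crd N i p) = fd (\<lambda>_. v i) (Crd N i p)"
    by (rule fd_cong_open[OF X(2,3,5)])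
  ultimately show ?thesis using that X(1) by (simp add: frechet_derivative_const)
qed

lemma one_form_through:
  assumes i: "i \<in> Idx N" and p: "p \<in> Dom N i"
  obtains \<alpha> where "\<alpha> \<in> one_forms N" "\<And>v. v \<in> tangent_space N p \<Longrightarrow> \<alpha> p v = w \<bullet> v i"
proof -
  obtain \<beta> U K where *: "smooth_on \<beta> UNIV" "open U" "Crd N i p \<in> U" "U \<subseteq> Img N i"
    "\<forall>y\<in>U. \<beta> y = 1" "K \<subseteq> Dom N i" "openin (atlas_topology N) (carrier N - K)"
    "\<forall>q\<in>Dom N i - K. \<beta> (Crd N i q) = (0::real)"
    using cutoff[OF i p] by (elim exE conjE)
  let ?a = "\<lambda>q v. if q \<in> Dom N i \<and> v \<in> tangent_space N q then \<beta> (Crd N i q) * (w \<bullet> v i) else 0"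
  have "?a \<in> one_forms N"
    unfolding one_forms_def
  proof (intro CollectI conjI ballI)
    fix q assume "q \<in> carrier N"
    show "?a q \<in> cotangent_space N q"
      unfolding cotangent_space_def
      by (auto simp: lincomb_tangent lincomb_apply inner_add_right algebra_simps)
  next
    fix j assume j: "j \<in> Idx N"
    let ?F = "\<lambda>y. covec_crd N j (Prm N j y) (?a (Prm N j y))"
    show "smooth_on ?F (Img N j)"
    proof (rule smooth_on_extend_by_zero[OF i j *(7,6)])
      have eq: "?F y = (\<Sum>c\<in>Basis. (\<beta> (chg N j i y) * (w \<bullet> fd (chg N j i) y c)) *\<^sub>R c)"
        if "y \<in> overlap N j i" for y
        using that i j unfolding covec_crd_def mem_overlap_iff[OF j]
        by (intro sum.cong refl arg_cong2[where f = scaleR])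
           (auto simp: chart_vec_tangent charts_at_iff Prm_Dom chart_vec_component Crd_Prm)
      have "smooth_on (\<lambda>y. \<Sum>c\<in>Basis. (\<beta> (chg N j i y) * (w \<bullet> fd (chg N j i) y c)) *\<^sub>R c) (overlap N j i)"
        by (intro smooth_intros open_overlap finite_Basis smooth_on_chg_compose smooth_on_subset[OF *(1)]
            smooth_on_fd trans_smooth i j subset_UNIV)
      then show "smooth_on ?F (overlap N j i)"
        using smooth_on_cong[OF open_overlap[OF j i] eq] by simp
    next
      show "?F y = 0" if "y \<in> Img N j" "Prm N j y \<notin> K" for y
        unfolding covec_crd_def by (intro sum.neutral) (simp add: *(8) that)
    qed
  qed
  moreover have "?a p v = w \<bullet> v i" if "v \<in> tangent_space N p" for v
    using that p *(3,5) by simp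
  ultimately show ?thesis using that by blast
qed

lemma scale_vfield:
  assumes f: "smooth_function N f" and X: "X \<in> vector_fields N"
  shows "(\<lambda>q i. f q *\<^sub>R X q i) \<in> vector_fields N"
  unfolding vector_fields_def
proof (intro CollectI conjI ballI allI impI)
  fix p assume "p \<in> carrier N"
  then show "(\<lambda>i. f p *\<^sub>R X p i) \<in> tangent_space N p"
    using X by (intro scale_tangent vfield_tangent)
next
  fix p assume "p \<notin> carrier N"
  then show "(\<lambda>i. f p *\<^sub>R X p i) = (\<lambda>_. 0)" using X by (simp add: vector_fields_def)
next
  fix i assume i: "i \<in> Idx N"
  have "smooth_on (f \<circ> Prm N i) (Img N i)" using f i by (simp add: smooth_function_def)
  from smooth_on_scaleR[OF open_Img[OF i] this vfield_smooth[OF X i]] show "smooth_on (vfield_crd N i (\<lambda>q i. f q *\<^sub>R X q i)) (Img N i)"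
    by (simp add: vfield_crd_def[abs_def])
qed

lemma lincomb_vfield:
  assumes "X \<in> vector_fields N" "Y \<in> vector_fields N"
  shows "(\<lambda>q. lincomb r (X q) s (Y q)) \<in> vector_fields N"
  unfolding vector_fields_def
proof (intro CollectI conjI ballI allI impI)
  fix p assume "p \<in> carrier N"
  then show "lincomb r (X p) s (Y p) \<in> tangent_space N p"
    using assms by (intro lincomb_tangent vfield_tangent)
next
  fix p assume "p \<notin> carrier N"
  then show "lincomb r (X p) s (Y p) = (\<lambda>_. 0)" using assms by (simp add: vector_fields_def lincomb_def)
next
  fix i assume i: "i \<in> Idx N"
  have "smooth_on (\<lambda>y. r *\<^sub>R vfield_crd N i X y + s *\<^sub>R vfield_crd N i Y y) (Img N i)"
    using assms i by (intro smooth_intros open_Img vfield_smooth)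
  then show "smooth_on (vfield_crd N i (\<lambda>q. lincomb r (X q) s (Y q))) (Img N i)"
    by (simp add: vfield_crd_def[abs_def] lincomb_def)
qed

lemma zero_vfield: "(\<lambda>_ _. 0) \<in> vector_fields N"
  by (simp add: vector_fields_def zero_tangent vfield_crd_def[abs_def] smooth_on_const)

lemma sum_vfield:
  assumes "finite A" "\<And>c. c \<in> A \<Longrightarrow> X c \<in> vector_fields N"
  shows "(\<lambda>q i. \<Sum>c\<in>A. X c q i) \<in> vector_fields N"
  using assms
proof (induction A)
  case empty
  then show ?case by (simp add: zero_vfield)
next
  case (insert a A)
  have "(\<lambda>q i. \<Sum>c\<in>A. X c q i) \<in> vector_fields N" by (rule insert.IH) (simp add: insert.prems)
  then have "(\<lambda>q. lincomb 1 (X a q) 1 (\<lambda>i. \<Sum>c\<in>A. X c q i)) \<in> vector_fields N"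
    by (intro lincomb_vfield insert.prems insertI1)
  then show ?case using insert by (simp add: lincomb_def)
qed

subsection \<open>Linear connections in charts\<close>

text \<open>The map \<open>\<Gamma> y\<close> bundles the Christoffel symbols at the coordinate
  point \<open>y\<close>. Nothing is said about its dependence on \<open>y\<close>, since the
  coefficients are obtained point by point.\<close>

definition connection_coeffs :: "('i,'p,'e) conn \<Rightarrow> 'i \<Rightarrow> ('e \<Rightarrow> 'e \<Rightarrow> 'e \<Rightarrow> 'e) \<Rightarrow> bool" where
  "connection_coeffs D i \<Gamma> \<longleftrightarrow>
     (\<forall>y\<in>Img N i. bilinear (\<Gamma> y)) \<and>
     (\<forall>p\<in>Dom N i. \<forall>X\<in>vector_fields N. \<forall>v\<in>tangent_space N p.
        D p v X i = fd (vfield_crd N i X) (Crd N i p) (v i) + \<Gamma> (Crd N i p) (v i) (X p i))"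

text \<open>Closure of a connection is stated for pairs of fields, so the single vector
  \<open>v\<close> is first extended to a global field.\<close>

lemma connection_tangent:
  assumes D: "linear_connection N D" and X: "X \<in> vector_fields N"
    and p: "p \<in> carrier N" and v: "v \<in> tangent_space N p"
  shows "D p v X \<in> tangent_space N p"
proof -
  obtain V where V: "V \<in> vector_fields N" "V p = v"
    using vfield_through[OF v chart_at_mem[OF p]] by blast
  have "cov_deriv N D V X \<in> vector_fields N" using D V X by (simp add: linear_connection_def)
  from vfield_tangent[OF this p] show ?thesis using V p by (simp add: cov_deriv_def)
qed

lemma connection_lincomb_left:
  "linear_connection N D \<Longrightarrow> p \<in> carrier N \<Longrightarrow> u \<in> tangent_space N p \<Longrightarrow> v \<in> tangent_space N p \<Longrightarrow>
    Y \<in> vector_fields N \<Longrightarrow> D p (lincomb r u s v) Y = lincomb r (D p u Y) s (D p v Y)"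
  unfolding linear_connection_def by blast

lemma connection_lincomb_right:
  "linear_connection N D \<Longrightarrow> p \<in> carrier N \<Longrightarrow> v \<in> tangent_space N p \<Longrightarrow> Y \<in> vector_fields N \<Longrightarrow>
    Z \<in> vector_fields N \<Longrightarrow> D p v (\<lambda>q. lincomb r (Y q) s (Z q)) = lincomb r (D p v Y) s (D p v Z)"
  unfolding linear_connection_def by blast

lemma connection_Leibniz:
  "linear_connection N D \<Longrightarrow> p \<in> carrier N \<Longrightarrow> v \<in> tangent_space N p \<Longrightarrow> Y \<in> vector_fields N \<Longrightarrow>
    smooth_function N f \<Longrightarrow>
    D p v (\<lambda>q i. f q *\<^sub>R Y q i) = lincomb (dir_deriv N p v f) (Y p) (f p) (D p v Y)"
  unfolding linear_connection_def by blast

lemma connection_sum: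
  assumes D: "linear_connection N D" and p: "p \<in> carrier N" and v: "v \<in> tangent_space N p"
    and "finite A" "\<And>c. c \<in> A \<Longrightarrow> X c \<in> vector_fields N"
  shows "D p v (\<lambda>q i. \<Sum>c\<in>A. X c q i) i = (\<Sum>c\<in>A. D p v (X c) i)"
  using assms(4,5)
proof (induction A)
  case empty
  show ?case
    using connection_lincomb_right[OF D p v zero_vfield zero_vfield, of 0 0] by (simp add: lincomb_def)
next
  case (insert a A)
  have "D p v (\<lambda>q. lincomb 1 (X a q) 1 (\<lambda>i. \<Sum>c\<in>A. X c q i))
      = lincomb 1 (D p v (X a)) 1 (D p v (\<lambda>q i. \<Sum>c\<in>A. X c q i))"
    by (intro connection_lincomb_right[OF D p v] sum_vfield insert.hyps insert.prems insertI1 insertI2)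
  then show ?case using insert by (simp add: lincomb_def)
qed

text \<open>Near \<open>p\<close> a field is \<open>\<Sum>\<^sub>c X\<^sup>c E\<^sub>c\<close> for global fields \<open>E\<^sub>c\<close> extending the coordinate frame; the
  cut-off remainder \<open>(1 - \<kappa>) X\<close> has derivative \<open>0\<close> at \<open>p\<close> because \<open>1 - \<kappa>\<close> vanishes near \<open>p\<close>.\<close>

lemma connection_coeffs_pointwise:
  assumes D: "linear_connection N D" and i: "i \<in> Idx N" and p: "p \<in> Dom N i"
  shows "\<exists>G. bilinear G \<and> (\<forall>X\<in>vector_fields N. \<forall>v\<in>tangent_space N p.
        D p v X i = fd (vfield_crd N i X) (Crd N i p) (v i) + G (v i) (X p i))"
proof -
  note pc = Dom_carrier[OF i p]
  have ip: "i \<in> charts_at N p" using i p by (simp add: charts_at_iff)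
  obtain \<beta> U K where \<beta>: "smooth_on \<beta> UNIV" "open U" "Crd N i p \<in> U" "U \<subseteq> Img N i"
    "\<forall>y\<in>U. \<beta> y = 1" "K \<subseteq> Dom N i" "openin (atlas_topology N) (carrier N - K)"
    "\<forall>q\<in>Dom N i - K. \<beta> (Crd N i q) = (0::real)"
    using cutoff[OF i p] by (elim exE conjE)
  note \<beta>s = smooth_on_subset[OF \<beta>(1) subset_UNIV, of "Img N i"]
  define E where "E = (\<lambda>c q j. if q \<in> Dom N i then \<beta> (Crd N i q) *\<^sub>R chart_vec N i q c j else 0)"
  have E: "E c \<in> vector_fields N" for c
    unfolding E_def by (rule cutoff_vfield[OF i \<beta>(7,6) \<beta>s \<beta>(8)])
  have Ep: "E c p i = c" for c using p \<beta>(3,5) by (simp add: E_def chart_vec_self ip)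
  define G where "G = (\<lambda>u x. \<Sum>c\<in>Basis. (x \<bullet> c) *\<^sub>R D p (chart_vec N i p u) (E c) i)"
  have "bilinear G"
    unfolding bilinear_def
  proof (intro conjI allI linearI)
    fix u v x and r :: real
    have *: "D p (chart_vec N i p (r *\<^sub>R u + s *\<^sub>R v)) (E c) i
       = r *\<^sub>R D p (chart_vec N i p u) (E c) i + s *\<^sub>R D p (chart_vec N i p v) (E c) i" for r s c
      unfolding chart_vec_lincomb[OF ip]
      by (subst connection_lincomb_left[OF D pc chart_vec_tangent[OF ip] chart_vec_tangent[OF ip] E])
         (simp add: lincomb_def)
    show "G (u + v) x = G u x + G v x"
      using *[of 1 1] by (simp add: G_def scaleR_add_right sum.distrib)
    show "G (r *\<^sub>R u) x = r *\<^sub>R G u x"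
      using *[of r 0] by (simp add: G_def scaleR_sum_right mult.commute)
  qed (simp_all add: G_def inner_add_left scaleR_add_left sum.distrib scaleR_sum_right)
  moreover have "D p v X i = fd (vfield_crd N i X) (Crd N i p) (v i) + G (v i) (X p i)"
    if X: "X \<in> vector_fields N" and v: "v \<in> tangent_space N p" for X v
  proof -
    define f where "f = (\<lambda>c q. if q \<in> Dom N i then \<beta> (Crd N i q) * (vfield_crd N i X (Crd N i q) \<bullet> c) else 0)"
    \<comment> \<open>Both \<open>f c\<close> and \<open>E c\<close> carry a factor
      \<open>\<beta>\<close>, so the frame expansion reproduces \<open>\<beta>\<^sup>2 X\<close> and
      not \<open>X\<close>; \<open>\<kappa>\<close> is this square.\<close>
    define \<kappa> where "\<kappa> = (\<lambda>q. if q \<in> Dom N i then \<beta> (Crd N i q) * \<beta> (Crd N i q) else 0)"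
    have f: "smooth_function N (f c)" for c
      unfolding f_def
    proof (rule smooth_function_cutoff[OF i \<beta>(7,6), where h = "\<lambda>y. \<beta> y * (vfield_crd N i X y \<bullet> c)"])
      show "smooth_on (\<lambda>y. \<beta> y * (vfield_crd N i X y \<bullet> c)) (Img N i)"
        by (intro smooth_intros open_Img i \<beta>s vfield_smooth[OF X])
    qed (simp add: \<beta>(8))
    have \<kappa>: "smooth_function N \<kappa>"
      unfolding \<kappa>_def
    proof (rule smooth_function_cutoff[OF i \<beta>(7,6), where h = "\<lambda>y. \<beta> y * \<beta> y"])
      show "smooth_on (\<lambda>y. \<beta> y * \<beta> y) (Img N i)" by (intro smooth_intros open_Img i \<beta>s)
    qed (simp add: \<beta>(8))
    have \<kappa>': "smooth_function N (\<lambda>q. 1 - \<kappa> q)"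
      using \<kappa> open_Img unfolding smooth_function_def comp_def by (auto intro: smooth_intros)
    have sum_eq: "(\<Sum>c\<in>Basis. f c q *\<^sub>R E c q j) = \<kappa> q *\<^sub>R X q j" for q j
    proof (cases "q \<in> Dom N i")
      case True
      have iq: "i \<in> charts_at N q" using i True by (simp add: charts_at_iff)
      note Xq = vfield_tangent[OF X Dom_carrier[OF i True]]
      have lin: "linear (\<lambda>u. chart_vec N i q u j)"
        using tangent_linear_transition[OF iq] by (cases "j \<in> charts_at N q") (simp_all add: chart_vec_def[abs_def] linear_zero)
      have "X q j = chart_vec N i q (X q i) j" by (simp add: chart_vec_eq[OF Xq iq])
      also have "\<dots> = (\<Sum>c\<in>Basis. (X q i \<bullet> c) *\<^sub>R chart_vec N i q c j)"
        by (rule linear_sum_Basis[OF lin])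
      finally have X_eq: "X q j = (\<Sum>c\<in>Basis. (X q i \<bullet> c) *\<^sub>R chart_vec N i q c j)" .
      have "(\<Sum>c\<in>Basis. f c q *\<^sub>R E c q j)
          = (\<Sum>c\<in>Basis. \<kappa> q *\<^sub>R ((X q i \<bullet> c) *\<^sub>R chart_vec N i q c j))"
        using True by (simp add: f_def E_def \<kappa>_def vfield_crd_def Prm_Crd[OF i] ac_simps)
      then show ?thesis by (simp only: X_eq scaleR_sum_right)
    next
      case False
      then show ?thesis by (simp add: f_def \<kappa>_def)
    qed
    have near: "(h \<circ> Prm N i) differentiable at (Crd N i p) \<and> fd (h \<circ> Prm N i) (Crd N i p) = fd h' (Crd N i p)"
      if "\<And>y. y \<in> U \<Longrightarrow> h (Prm N i y) = h' y" "h' differentiable at (Crd N i p)" for h h' :: "_ \<Rightarrow> real"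
      using that differentiable_cong_open[OF \<beta>(2,3), of "h \<circ> Prm N i" h'] fd_cong_open[OF \<beta>(2,3), of "h \<circ> Prm N i" h']
      by simp
    have d\<kappa>: "dir_deriv N p v (\<lambda>q. 1 - \<kappa> q) = 0"
    proof -
      have *: "1 - \<kappa> (Prm N i y) = (\<lambda>_. 0) y" if "y \<in> U" for y
        using that \<beta>(4,5) Prm_Dom Crd_Prm by (auto simp: \<kappa>_def)
      from near[of "\<lambda>q. 1 - \<kappa> q", OF this] show ?thesis
        using dir_deriv_eq[OF ip v, of "\<lambda>q. 1 - \<kappa> q"] by (simp add: frechet_derivative_const)
    qed
    have Xd: "vfield_crd N i X differentiable at (Crd N i p)"
      using smooth_on_differentiable[OF vfield_smooth[OF X i] Crd_Img[OF p]] .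
    have df: "dir_deriv N p v (f c) = fd (vfield_crd N i X) (Crd N i p) (v i) \<bullet> c" for c
    proof -
      have *: "f c (Prm N i y) = vfield_crd N i X y \<bullet> c" if "y \<in> U" for y
        using that \<beta>(4,5) Prm_Dom Crd_Prm by (auto simp: f_def)
      have d: "(\<lambda>y. vfield_crd N i X y \<bullet> c) differentiable at (Crd N i p)"
        using bounded_linear.has_derivative[OF bounded_linear_inner_left] Xd
        unfolding differentiable_def by blast
      from near[of "f c", OF * d] show ?thesis
        using dir_deriv_eq[OF ip v, of "f c"] fd_linear_compose[OF bounded_linear_inner_left Xd, of c "v i"] by simp
    qed
    have \<kappa>p: "\<kappa> p = 1" using p \<beta>(3,5) by (simp add: \<kappa>_def)
    have fp: "f c p = X p i \<bullet> c" for c using p \<beta>(3,5) by (simp add: f_def vfield_crd_def Prm_Crd[OF i])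
    have v_eq: "chart_vec N i p (v i) = v" by (rule chart_vec_eq[OF v ip])
    let ?Y = "\<lambda>q i. (1 - \<kappa> q) *\<^sub>R X q i" and ?Z = "\<lambda>q i. \<Sum>c\<in>Basis. f c q *\<^sub>R E c q i"
    have Y: "?Y \<in> vector_fields N" by (rule scale_vfield[OF \<kappa>' X])
    have fE: "(\<lambda>q i. f c q *\<^sub>R E c q i) \<in> vector_fields N" for c by (rule scale_vfield[OF f E])
    have Z: "?Z \<in> vector_fields N" by (rule sum_vfield[OF finite_Basis fE])
    have DY: "D p v ?Y i = 0"
      unfolding connection_Leibniz[OF D pc v X \<kappa>'] d\<kappa> \<kappa>p by (simp add: lincomb_def)
    have "D p v ?Z i = (\<Sum>c\<in>Basis. D p v (\<lambda>q i. f c q *\<^sub>R E c q i) i)"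
      by (rule connection_sum[OF D pc v finite_Basis fE])
    also have "\<dots> = (\<Sum>c\<in>Basis. (fd (vfield_crd N i X) (Crd N i p) (v i) \<bullet> c) *\<^sub>R c
        + (X p i \<bullet> c) *\<^sub>R D p v (E c) i)"
      by (intro sum.cong refl) (simp add: connection_Leibniz[OF D pc v E f] df fp lincomb_def Ep)
    also have "\<dots> = fd (vfield_crd N i X) (Crd N i p) (v i) + G (v i) (X p i)"
      by (simp add: sum.distrib euclidean_representation G_def v_eq)
    finally have DZ: "D p v ?Z i = fd (vfield_crd N i X) (Crd N i p) (v i) + G (v i) (X p i)" .
    have "X = (\<lambda>q. lincomb 1 (?Y q) 1 (?Z q))"
      by (intro ext) (simp add: lincomb_def sum_eq algebra_simps)
    then have "D p v X = lincomb 1 (D p v ?Y) 1 (D p v ?Z)"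
      using connection_lincomb_right[OF D pc v Y Z, of 1 1] by simp
    then show ?thesis using DY DZ by (simp add: lincomb_def)
  qed
  ultimately show ?thesis by blast
qed

lemma connection_coeffs_exist:
  assumes D: "linear_connection N D" and i: "i \<in> Idx N"
  obtains \<Gamma> where "connection_coeffs D i \<Gamma>"
proof -
  have "\<forall>y. y \<in> Img N i \<longrightarrow> (\<exists>G. bilinear G \<and> (\<forall>X\<in>vector_fields N. \<forall>v\<in>tangent_space N (Prm N i y).
        D (Prm N i y) v X i = fd (vfield_crd N i X) (Crd N i (Prm N i y)) (v i) + G (v i) (X (Prm N i y) i)))"
    using connection_coeffs_pointwise[OF D i Prm_Dom] by blast
  then obtain \<Gamma> where \<Gamma>: "\<forall>y. y \<in> Img N i \<longrightarrow> bilinear (\<Gamma> y) \<and> (\<forall>X\<in>vector_fields N. \<forall>v\<in>tangent_space N (Prm N i y).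
        D (Prm N i y) v X i = fd (vfield_crd N i X) (Crd N i (Prm N i y)) (v i) + \<Gamma> y (v i) (X (Prm N i y) i))"
    by metis
  have "connection_coeffs D i \<Gamma>"
    unfolding connection_coeffs_def
  proof (intro conjI ballI)
    fix p X v assume "p \<in> Dom N i" "X \<in> vector_fields N" "v \<in> tangent_space N p"
    then show "D p v X i = fd (vfield_crd N i X) (Crd N i p) (v i) + \<Gamma> (Crd N i p) (v i) (X p i)"
      using \<Gamma>[rule_format, OF Crd_Img[of p i]] by (simp add: Prm_Crd[OF i])
  qed (use \<Gamma> in blast)
  then show ?thesis by (rule that)
qed

text \<open>The derivative terms of the two covariant derivatives are exactly the bracket, so the
  torsion retains only the antisymmetric part of \<open>\<Gamma>\<close>.\<close>

lemma connection_coeffs_symmetric: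
  assumes T: "torsion_free N D" and \<Gamma>: "connection_coeffs D i \<Gamma>" and i: "i \<in> Idx N" and y: "y \<in> Img N i"
  shows "\<Gamma> y u v = \<Gamma> y v u"
proof -
  define p where "p = Prm N i y"
  have p: "p \<in> Dom N i" "Crd N i p = y" using Prm_Dom[OF y] Crd_Prm[OF y] by (simp_all add: p_def)
  have ip: "i \<in> charts_at N p" using i p by (simp add: charts_at_iff)
  note pc = Dom_carrier[OF i p(1)]
  obtain X where X: "X \<in> vector_fields N" "X p = chart_vec N i p u"
    using vfield_through[OF chart_vec_tangent[OF ip] ip] by blast
  obtain Y where Y: "Y \<in> vector_fields N" "Y p = chart_vec N i p v"
    using vfield_through[OF chart_vec_tangent[OF ip] ip] by blast
  have "cov_deriv N D X Y p i - cov_deriv N D Y X p i = bracket N X Y p i"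
    using T X Y pc by (simp add: torsion_free_def)
  moreover have "D p (X p) Y i = fd (vfield_crd N i Y) y u + \<Gamma> y u v"
    "D p (Y p) X i = fd (vfield_crd N i X) y v + \<Gamma> y v u"
    using \<Gamma> X Y p vfield_tangent[OF X(1) pc] vfield_tangent[OF Y(1) pc]
    by (auto simp: connection_coeffs_def chart_vec_self[OF ip])
  ultimately show ?thesis
    using pc X Y p ip by (simp add: cov_deriv_def bracket_def chart_vec_self)
qed

text \<open>The coordinate form of \<open>R(u, v) w = 0\<close>. For fields with constant components
  the first covariant derivative is \<open>\<Gamma>(b, w)\<close> on a whole neighbourhood, as is
  needed in order to differentiate it again.\<close>

lemma flat_coeffs:
  assumes D: "linear_connection N D" and T: "torsion_free N D" and F: "flat N D"
    and \<Gamma>: "connection_coeffs D i \<Gamma>" and i: "i \<in> Idx N" and y: "y \<in> Img N i"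
  shows "fd (\<lambda>z. \<Gamma> z v w) y u + \<Gamma> y u (\<Gamma> y v w) = fd (\<lambda>z. \<Gamma> z u w) y v + \<Gamma> y v (\<Gamma> y u w)"
proof -
  define p where "p = Prm N i y"
  have p: "p \<in> Dom N i" "Crd N i p = y" using Prm_Dom[OF y] Crd_Prm[OF y] by (simp_all add: p_def)
  have ip: "i \<in> charts_at N p" using i p by (simp add: charts_at_iff)
  note pc = Dom_carrier[OF i p(1)]
  obtain X U where X: "X \<in> vector_fields N" "open U" "y \<in> U" "U \<subseteq> Img N i" "\<And>y. y \<in> U \<Longrightarrow> vfield_crd N i X y = u"
    using locally_constant_vfield[OF i p(1)] unfolding p(2) by metis
  obtain Y V where Y: "Y \<in> vector_fields N" "open V" "y \<in> V" "V \<subseteq> Img N i" "\<And>y. y \<in> V \<Longrightarrow> vfield_crd N i Y y = v"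
    using locally_constant_vfield[OF i p(1)] unfolding p(2) by metis
  obtain Z W where Z: "Z \<in> vector_fields N" "open W" "y \<in> W" "W \<subseteq> Img N i" "\<And>y. y \<in> W \<Longrightarrow> vfield_crd N i Z y = w"
    using locally_constant_vfield[OF i p(1)] unfolding p(2) by metis
  have comp: "X p i = u" "Y p i = v" "Z p i = w"
    using X(3,5) Y(3,5) Z(3,5) by (simp_all add: vfield_crd_def p_def)
  have lc: "fd (vfield_crd N i A) z = (\<lambda>_. 0)"
    if "open B" "z \<in> B" "\<And>z. z \<in> B \<Longrightarrow> vfield_crd N i A z = a" for A B a z
    using fd_cong_open[OF that(1,2), of "vfield_crd N i A" "\<lambda>_. a"] that(3) by (simp add: frechet_derivative_const)
  have DD: "cov_deriv N D A (cov_deriv N D B Z) p i = fd (\<lambda>z. \<Gamma> z b w) y a + \<Gamma> y a (\<Gamma> y b w)"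
    if A: "A \<in> vector_fields N" "A p i = a" and B: "B \<in> vector_fields N" "open S" "y \<in> S" "S \<subseteq> Img N i"
      "\<And>y. y \<in> S \<Longrightarrow> vfield_crd N i B y = b" for A B S a b
  proof -
    have *: "vfield_crd N i (cov_deriv N D B Z) z = \<Gamma> z b w" if z: "z \<in> S \<inter> W" for z
    proof -
      have zi: "z \<in> Img N i" using z B(4) by blast
      note q = Prm_Dom[OF zi] Crd_Prm[OF zi] Prm_carrier[OF i zi]
      have "vfield_crd N i (cov_deriv N D B Z) z = fd (vfield_crd N i Z) z (B (Prm N i z) i) + \<Gamma> z (B (Prm N i z) i) (Z (Prm N i z) i)"
        using \<Gamma> q Z(1) vfield_tangent[OF B(1) q(3)]
        by (auto simp: connection_coeffs_def vfield_crd_def cov_deriv_def)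
      then show ?thesis
        using z B(5)[of z] Z(5)[of z] lc[OF Z(2) _ Z(5), of z] by (simp add: vfield_crd_def)
    qed
    have "cov_deriv N D B Z \<in> vector_fields N" using D B(1) Z(1) by (simp add: linear_connection_def)
    then have "cov_deriv N D A (cov_deriv N D B Z) p i
        = fd (vfield_crd N i (cov_deriv N D B Z)) y a + \<Gamma> y a (cov_deriv N D B Z p i)"
      using \<Gamma> p A pc vfield_tangent[OF A(1) pc] by (auto simp: connection_coeffs_def cov_deriv_def[of N D A])
    moreover have "fd (vfield_crd N i (cov_deriv N D B Z)) y = fd (\<lambda>z. \<Gamma> z b w) y"
      by (rule fd_cong_open[of "S \<inter> W", OF _ _ *]) (use B(2,3) Z(2,3) in auto)
    moreover have "cov_deriv N D B Z p i = \<Gamma> y b w"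
      using *[of y] B(3) Z(3) by (simp add: vfield_crd_def p_def)
    ultimately show ?thesis by simp
  qed
  \<comment> \<open>Vanishing at \<open>p\<close> suffices, because \<open>D p\<close> sees its
    direction only through the value there. That the bracket is tangent follows here from the
    absence of torsion.\<close>
  have br: "bracket N X Y p = (\<lambda>_. 0)"
  proof (rule tangent_eqI[OF _ zero_tangent ip])
    have "bracket N X Y p = lincomb 1 (D p (X p) Y) (-1) (D p (Y p) X)"
      using T X(1) Y(1) pc by (intro ext) (simp add: torsion_free_def cov_deriv_def lincomb_def)
    then show "bracket N X Y p \<in> tangent_space N p"
      using X(1) Y(1) pc D by (simp add: lincomb_tangent connection_tangent vfield_tangent)
    show "bracket N X Y p i = 0"
      using ip p lc[OF X(2,3,5)] lc[OF Y(2,3,5)] by (simp add: bracket_def)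
  qed
  have "D p (\<lambda>_. 0) Z i = 0"
  proof -
    have "D p (lincomb 0 (X p) 0 (X p)) Z = lincomb 0 (D p (X p) Z) 0 (D p (X p) Z)"
      by (intro connection_lincomb_left D pc Z vfield_tangent X)
    then show ?thesis by (simp add: lincomb_def)
  qed
  then have "cov_deriv N D (bracket N X Y) Z p i = 0" using br pc by (simp add: cov_deriv_def)
  moreover have "curvature N D X Y Z p i = 0" using F X(1) Y(1) Z(1) pc by (simp add: flat_def)
  ultimately show ?thesis
    using DD[OF X(1) comp(1) Y] DD[OF Y(1) comp(2) X] by (simp add: curvature_def)
qed

end

subsection \<open>Musical isomorphism and Christoffel symbols\<close>

definition nondegenerate :: "('a::real_vector \<Rightarrow> 'a \<Rightarrow> real) \<Rightarrow> bool" where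
  "nondegenerate B \<longleftrightarrow> (\<forall>z. (\<forall>v. B z v = 0) \<longrightarrow> z = 0)"

lemma bilinear_linear_left: "bilinear B \<Longrightarrow> linear (\<lambda>u. B u v)"
  and bilinear_linear_right: "bilinear B \<Longrightarrow> linear (B u)"
  by (simp_all add: bilinear_def)

lemma nondegenerate_eqI:
  assumes "bilinear B" "nondegenerate B" "\<And>v. B z v = B z' v"
  shows "z = z'"
proof -
  have "B (z - z') v = 0" for v using assms(3) bilinear_lsub[OF assms(1)] by simp
  then show ?thesis using assms(2) unfolding nondegenerate_def by force
qed

lemma sharp_eqI:
  assumes "bilinear B" "nondegenerate B" "\<And>v. B z v = c \<bullet> v"
  shows "sharp B c = z"
  unfolding sharp_def
proof (rule the_equality)
  show "\<forall>v. B z v = c \<bullet> v" using assms(3) by blast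
  fix z' assume "\<forall>v. B z' v = c \<bullet> v"
  then have "B z' v = B z v" for v using assms(3) by simp
  then show "z' = z" by (rule nondegenerate_eqI[OF assms(1,2)])
qed

text \<open>Nondegeneracy makes the map from vectors to covectors injective, hence surjective in
  finite dimension. So the definite description in \<open>sharp\<close> denotes a vector.\<close>

lemma sharp_property:
  fixes B :: "'e::euclidean_space \<Rightarrow> 'e \<Rightarrow> real"
  assumes "bilinear B" "nondegenerate B"
  shows "B (sharp B c) v = c \<bullet> v"
proof -
  define L where "L = (\<lambda>z. \<Sum>e\<in>Basis. B z e *\<^sub>R e)"
  have L: "linear L"
    unfolding L_def
    by (rule linearI) (simp_all add: bilinear_ladd[OF assms(1)] bilinear_lmul[OF assms(1)]
        scaleR_add_left sum.distrib scaleR_sum_right)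
  have Lv: "L z \<bullet> v = B z v" for z v
  proof -
    have "B z v = (\<Sum>e\<in>Basis. (v \<bullet> e) *\<^sub>R B z e)"
      by (rule linear_sum_Basis[OF bilinear_linear_right[OF assms(1)]])
    then show ?thesis unfolding L_def inner_sum_left by (simp add: inner_commute[of v] mult.commute)
  qed
  have "inj L"
    unfolding linear_injective_0[OF L] using assms(2) Lv unfolding nondegenerate_def by (metis inner_zero_left)
  then obtain z where "L z = c" using linear_injective_imp_surjective[OF L] by (metis surjD)
  then have "B z v = c \<bullet> v" for v using Lv by metis
  then show ?thesis using sharp_eqI[OF assms] by metis
qed

text \<open>Koszul's expression for commuting coordinate fields, that is, twice the Christoffel
  symbol of the first kind.\<close>

definition koszul :: "('e::euclidean_space \<Rightarrow> 'e \<Rightarrow> 'e \<Rightarrow> real) \<Rightarrow> 'e \<Rightarrow> 'e \<Rightarrow> 'e \<Rightarrow> 'e \<Rightarrow> real" where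
  "koszul G y u v c = fd (\<lambda>z. G z v c) y u + fd (\<lambda>z. G z u c) y v - fd (\<lambda>z. G z u v) y c"

lemma christoffel_koszul: "christoffel G y u v = sharp (G y) (\<Sum>c\<in>Basis. (koszul G y u v c / 2) *\<^sub>R c)"
  by (simp add: christoffel_def koszul_def)

lemma christoffel_property:
  assumes "bilinear (G y)" "nondegenerate (G y)" "c \<in> Basis"
  shows "2 * G y (christoffel G y u v) c = koszul G y u v c"
  unfolding christoffel_koszul sharp_property[OF assms(1,2)] using assms(3)
  by (simp add: inner_sum_left_Basis)

lemma christoffel_eqI:
  assumes "bilinear (G y)" "nondegenerate (G y)" "\<And>c. c \<in> Basis \<Longrightarrow> 2 * G y z c = koszul G y u v c"
  shows "christoffel G y u v = z"
  unfolding christoffel_koszul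
proof (rule sharp_eqI[OF assms(1,2)])
  fix v'
  have "G y z v' = (\<Sum>c\<in>Basis. (v' \<bullet> c) *\<^sub>R G y z c)"
    by (rule linear_sum_Basis[OF bilinear_linear_right[OF assms(1)]])
  also have "\<dots> = (\<Sum>c\<in>Basis. (v' \<bullet> c) *\<^sub>R (koszul G y u v c / 2))"
    using assms(3) by (intro sum.cong refl) (metis nonzero_mult_div_cancel_left zero_neq_numeral)
  finally show "G y z v' = (\<Sum>c\<in>Basis. (koszul G y u v c / 2) *\<^sub>R c) \<bullet> v'"
    unfolding inner_sum_left by (simp add: inner_commute[of v'] mult.commute)
qed

lemma linear_fd_family:
  fixes L :: "'a::euclidean_space \<Rightarrow> 'b::real_vector \<Rightarrow> 'c::real_normed_vector"
  assumes "open T" "y \<in> T" "\<And>z. z \<in> T \<Longrightarrow> linear (L z)" "\<And>c. (\<lambda>z. L z c) differentiable at y"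
  shows "linear (\<lambda>c. fd (\<lambda>z. L z c) y r)"
proof -
  have D: "((\<lambda>z. L z a) has_derivative fd (\<lambda>z. L z a) y) (at y)" for a
    using assms(4) by (simp add: frechet_derivative_works[symmetric])
  have "fd (\<lambda>z. L z (a + b)) y = fd (\<lambda>z. L z a + L z b) y"
    "fd (\<lambda>z. L z (s *\<^sub>R a)) y = fd (\<lambda>z. s *\<^sub>R L z a) y" for a b s
    by (rule fd_cong_open[OF assms(1,2)], simp add: linear_add linear_scale assms(3))+
  then show ?thesis
    using fd_eqI[OF has_derivative_add[OF D D]] fd_eqI[OF has_derivative_scaleR_right[OF D]]
    by (auto intro!: linearI)
qed

lemma linear_koszul:
  assumes "open T" "y \<in> T" "\<And>z. z \<in> T \<Longrightarrow> bilinear (G z)" "\<And>u v. (\<lambda>z. G z u v) differentiable at y"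
  shows "linear (koszul G y u v)"
proof -
  have "linear (\<lambda>w. fd (\<lambda>z. G z c w) y r)" for c r
    by (rule linear_fd_family[OF assms(1,2) bilinear_linear_right[OF assms(3)] assms(4)])
  then show ?thesis
    unfolding koszul_def[abs_def] using linear_fd[OF assms(4)]
    by (intro linear_compose_add linear_compose_sub)
qed

text \<open>The definition of \<open>christoffel\<close> tests on basis vectors only; linearity of
  \<open>koszul\<close> in its last argument gives the identity for all vectors.\<close>

lemma christoffel_property_all:
  assumes "bilinear (G y)" "nondegenerate (G y)" "linear (koszul G y u v)"
  shows "2 * G y (christoffel G y u v) w = koszul G y u v w"
proof -
  have "2 * G y (christoffel G y u v) w = (\<Sum>c\<in>Basis. (w \<bullet> c) *\<^sub>R (2 * G y (christoffel G y u v) c))"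
    by (subst linear_sum_Basis[OF bilinear_linear_right[OF assms(1)], of _ w]) (simp add: sum_distrib_left ac_simps)
  also have "\<dots> = (\<Sum>c\<in>Basis. (w \<bullet> c) *\<^sub>R koszul G y u v c)"
    by (intro sum.cong refl) (simp add: christoffel_property[of G y, OF assms(1,2)])
  also have "\<dots> = koszul G y u v w" by (rule linear_sum_Basis[OF assms(3), symmetric])
  finally show ?thesis .
qed

lemma koszul_symmetric:
  assumes "open S" "y \<in> S" "\<And>z. z \<in> S \<Longrightarrow> G z u v = G z v u"
  shows "koszul G y u v c = koszul G y v u c"
  using fd_cong_open[OF assms(1,2), of "\<lambda>z. G z u v" "\<lambda>z. G z v u"] assms(3) by (simp add: koszul_def)

lemma christoffel_symmetric:
  assumes "open S" "y \<in> S" "\<And>z. z \<in> S \<Longrightarrow> G z u v = G z v u"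
  shows "christoffel G y u v = christoffel G y v u"
proof -
  have "koszul G y u v c = koszul G y v u c" for c by (rule koszul_symmetric[of S y G u v, OF assms])
  then show ?thesis by (simp add: christoffel_koszul)
qed

text \<open>Affine behaviour along one line determines the derivative in that direction. It applies
  to functions that are affine in a fibre coordinate and complicated in the base.\<close>

lemma fd_along_line:
  assumes "f differentiable at x" "\<And>t. f (x + t *\<^sub>R u) = f x + t *\<^sub>R d"
  shows "fd f x u = d"
proof -
  have f': "(f has_derivative fd f x) (at (x + 0 *\<^sub>R u))"
    using assms(1) by (simp add: frechet_derivative_works[symmetric])
  have "((\<lambda>t::real. x + t *\<^sub>R u) has_derivative (\<lambda>t. t *\<^sub>R u)) (at 0)"
    by (auto intro!: derivative_eq_intros)
  from has_derivative_compose[OF this f']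
  have 1: "((\<lambda>t. f (x + t *\<^sub>R u)) has_derivative (\<lambda>t. fd f x (t *\<^sub>R u))) (at 0)" .
  have 2: "((\<lambda>t::real. f x + t *\<^sub>R d) has_derivative (\<lambda>t. t *\<^sub>R d)) (at 0)"
    by (auto intro!: derivative_eq_intros)
  have "(\<lambda>t. f (x + t *\<^sub>R u)) = (\<lambda>t. f x + t *\<^sub>R d)" using assms(2) by blast
  then have "(\<lambda>t. fd f x (t *\<^sub>R u)) = (\<lambda>t. t *\<^sub>R d)"
    using has_derivative_unique[OF 1] 2 by metis
  from fun_cong[OF this, of 1] show ?thesis by simp
qed

lemma has_derivative_bilinear_family:
  fixes B :: "'a::euclidean_space \<Rightarrow> 'b::euclidean_space \<Rightarrow> 'c::euclidean_space \<Rightarrow> 'd::real_normed_vector"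
    and f :: "'f::euclidean_space \<Rightarrow> 'a"
  assumes T: "open T" "f x \<in> T" and f: "(f has_derivative f') (at x)"
    and S: "open S" "x \<in> S" "f ` S \<subseteq> T" and fd: "\<And>z. z \<in> S \<Longrightarrow> f differentiable at z"
    and a: "(a has_derivative a') (at x)" and b: "(b has_derivative b') (at x)"
    and diff: "\<And>c d. (\<lambda>y. B y c d) differentiable at (f x)" and bil: "\<And>y. y \<in> T \<Longrightarrow> bilinear (B y)"
  shows "((\<lambda>z. B (f z) (a z) (b z)) has_derivative
    (\<lambda>v. fd (\<lambda>y. B y (a x) (b x)) (f x) (f' v) + B (f x) (a' v) (b x) + B (f x) (a x) (b' v))) (at x)"
proof -
  have 1: "((\<lambda>z. B (f z) c (b z)) has_derivative
      (\<lambda>v. fd (\<lambda>y. B y c (b x)) (f x) (f' v) + B (f x) c (b' v))) (at x)" for c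
    by (rule has_derivative_linear_family[OF T f b diff bilinear_linear_right[OF bil]])
  \<comment> \<open>The product rule is used a second time with the source as parameter space:
    \<open>b\<close> is absorbed into a family that is linear in the remaining argument.\<close>
  have 2: "((\<lambda>z. B (f z) (a z) (b z)) has_derivative
      (\<lambda>v. fd (\<lambda>z. B (f z) (a x) (b z)) x v + B (f x) (a' v) (b x))) (at x)"
  proof (rule has_derivative_linear_family[where f = "\<lambda>z. z" and L = "\<lambda>z c. B (f z) c (b z)", OF S(1,2) has_derivative_ident a])
    show "(\<lambda>z. B (f z) c (b z)) differentiable at x" for c using 1 unfolding differentiable_def by blast
    show "linear (\<lambda>c. B (f y) c (b y))" if "y \<in> S" for y
      by (rule bilinear_linear_left[OF bil]) (use that S(3) in auto)
  qed
  show ?thesis using 2 unfolding fd_eqI[OF 1] by (simp add: algebra_simps)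
qed

section \<open>Bilinear forms and endomorphism fields in a chart\<close>

context satlas
begin

lemma bform_chart:
  assumes "i \<in> charts_at N p" "u \<in> tangent_space N p" "v \<in> tangent_space N p"
  shows "g p u v = bform_crd N i g (Crd N i p) (u i) (v i)"
  using assms by (simp add: bform_crd_def Prm_Crd charts_at_iff chart_vec_eq)

lemma bform_crd_bilinear:
  assumes g: "bform_field N g" and i: "i \<in> Idx N" and y: "y \<in> Img N i"
  shows "bilinear (bform_crd N i g y)"
proof -
  let ?p = "Prm N i y"
  have ip: "i \<in> charts_at N ?p" using i y by (simp add: charts_at_iff Prm_Dom)
  have pc: "?p \<in> carrier N" using i y by (rule Prm_carrier)
  have lin: "bform_crd N i g y (r *\<^sub>R u + s *\<^sub>R v) w = r * bform_crd N i g y u w + s * bform_crd N i g y v w"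
    "bform_crd N i g y w (r *\<^sub>R u + s *\<^sub>R v) = r * bform_crd N i g y w u + s * bform_crd N i g y w v" for r s u v w
    using g pc chart_vec_tangent[OF ip] unfolding bform_crd_def chart_vec_lincomb[OF ip] bform_field_def by blast+
  show ?thesis
    unfolding bilinear_def
    using lin(1)[of 1 _ 1] lin(2)[of _ 1 _ 1] lin(1)[of _ _ 0] lin(2)[of _ _ _ 0] by (auto intro!: linearI)
qed

lemma bform_crd_smooth: "bform_field N g \<Longrightarrow> i \<in> Idx N \<Longrightarrow> smooth_on (\<lambda>y. bform_crd N i g y u v) (Img N i)"
  by (simp add: bform_field_def)

lemma bform_crd_chg:
  assumes i: "i \<in> Idx N" and j: "j \<in> Idx N" and y: "y \<in> overlap N i j"
  shows "bform_crd N i g y u v = bform_crd N j g (chg N i j y) (fd (chg N i j) y u) (fd (chg N i j) y v)"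
proof -
  let ?p = "Prm N i y"
  have p: "i \<in> charts_at N ?p" "j \<in> charts_at N ?p" using i j y by (auto simp: charts_at_iff mem_overlap_iff[OF i] Prm_Dom)
  have "Crd N i ?p = y" using y overlap_subset Crd_Prm by blast
  then show ?thesis
    unfolding bform_crd_def[of N i]
    using bform_chart[OF p(2) chart_vec_tangent[OF p(1)] chart_vec_tangent[OF p(1)], of g u v]
    by (simp add: chart_vec_component[OF p(2)])
qed

definition endo_crd :: "'i \<Rightarrow> ('i,'p,'e) endo \<Rightarrow> 'e \<Rightarrow> 'e \<Rightarrow> 'e" where
  "endo_crd i T y u = T (Prm N i y) (chart_vec N i (Prm N i y) u) i"

lemma endo_chart:
  assumes "i \<in> charts_at N p" "v \<in> tangent_space N p"
  shows "T p v i = endo_crd i T (Crd N i p) (v i)"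
  using assms by (simp add: endo_crd_def Prm_Crd charts_at_iff chart_vec_eq)

lemma endo_tangent:
  "endo_field N T \<Longrightarrow> p \<in> carrier N \<Longrightarrow> v \<in> tangent_space N p \<Longrightarrow> T p v \<in> tangent_space N p"
  unfolding endo_field_def by blast

lemma endo_crd_linear:
  assumes T: "endo_field N T" and i: "i \<in> Idx N" and y: "y \<in> Img N i"
  shows "linear (endo_crd i T y)"
proof -
  let ?p = "Prm N i y"
  have ip: "i \<in> charts_at N ?p" using i y by (simp add: charts_at_iff Prm_Dom)
  have pc: "?p \<in> carrier N" using i y by (rule Prm_carrier)
  have "T ?p (lincomb r (chart_vec N i ?p u) s (chart_vec N i ?p v))
      = lincomb r (T ?p (chart_vec N i ?p u)) s (T ?p (chart_vec N i ?p v))" for r s u v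
    using T pc chart_vec_tangent[OF ip] unfolding endo_field_def by blast
  then have "endo_crd i T y (r *\<^sub>R u + s *\<^sub>R v) = r *\<^sub>R endo_crd i T y u + s *\<^sub>R endo_crd i T y v" for r s u v
    unfolding endo_crd_def chart_vec_lincomb[OF ip] by (simp add: lincomb_apply)
  from this[of 1 _ 1] this[of _ _ 0] show ?thesis by (auto intro!: linearI)
qed

lemma endo_crd_smooth: "endo_field N T \<Longrightarrow> i \<in> Idx N \<Longrightarrow> smooth_on (\<lambda>y. endo_crd i T y u) (Img N i)"
  by (simp add: endo_field_def endo_crd_def)

subsection \<open>The tangent bundle\<close>

abbreviation TN :: "('i, 'p \<times> ('i,'e) tvec, 'e \<times> 'e) atlas" where "TN \<equiv> tangent_bundle N"

lemma TN_simps [simp]: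
  "Idx TN = Idx N" "(p, v) \<in> Dom TN i \<longleftrightarrow> p \<in> Dom N i \<and> v \<in> tangent_space N p"
  "Crd TN i (p, v) = (Crd N i p, v i)"
  by (simp_all add: tangent_bundle_def)

lemma TN_charts_at: "v \<in> tangent_space N p \<Longrightarrow> charts_at TN (p, v) = charts_at N p"
  by (auto simp: charts_at_def)

lemma TN_carrier: "(p, v) \<in> carrier TN \<longleftrightarrow> p \<in> carrier N \<and> v \<in> tangent_space N p"
  by (auto simp: carrier_def)

lemma TN_inj:
  assumes i: "i \<in> Idx N" shows "inj_on (Crd TN i) (Dom TN i)"
proof (rule inj_onI, clarsimp)
  fix p v q w
  assume *: "p \<in> Dom N i" "v \<in> tangent_space N p" "q \<in> Dom N i" "w \<in> tangent_space N q"
    "Crd N i p = Crd N i q" "v i = w i"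
  then have "p = q" using inj_Crd[OF i] by (simp add: inj_on_def)
  then show "p = q \<and> v = w" using * i tangent_eqI[of v p w i] by (simp add: charts_at_iff)
qed

lemma TN_overlap:
  assumes i: "i \<in> Idx N" shows "overlap TN i j = overlap N i j \<times> UNIV"
proof (intro equalityI subsetI)
  fix z assume "z \<in> overlap TN i j" then show "z \<in> overlap N i j \<times> UNIV" by auto
next
  fix z assume "z \<in> overlap N i j \<times> (UNIV :: 'e set)"
  then obtain p u where p: "p \<in> Dom N i" "p \<in> Dom N j" "z = (Crd N i p, u)" by auto
  have ip: "i \<in> charts_at N p" using p i by (simp add: charts_at_iff)
  have "z = Crd TN i (p, chart_vec N i p u)" by (simp add: p chart_vec_self[OF ip])
  moreover have "(p, chart_vec N i p u) \<in> Dom TN i \<inter> Dom TN j" using p chart_vec_tangent[OF ip] by simp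
  ultimately show "z \<in> overlap TN i j" by blast
qed

lemma TN_Prm:
  assumes i: "i \<in> Idx N" and y: "y \<in> Img N i"
  shows "Prm TN i (y, v) = (Prm N i y, chart_vec N i (Prm N i y) v)"
proof -
  have ip: "i \<in> charts_at N (Prm N i y)" using i y by (simp add: charts_at_iff Prm_Dom)
  have "(y, v) = Crd TN i (Prm N i y, chart_vec N i (Prm N i y) v)"
    using y by (simp add: Crd_Prm chart_vec_self[OF ip])
  moreover have "(Prm N i y, chart_vec N i (Prm N i y) v) \<in> Dom TN i"
    using y by (simp add: Prm_Dom chart_vec_tangent[OF ip])
  ultimately show ?thesis unfolding Prm_def[of TN] using TN_inj[OF i] by (metis inv_into_f_f)
qed

lemma TN_chg:
  assumes i: "i \<in> Idx N" and j: "j \<in> Idx N" and y: "y \<in> overlap N i j"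
  shows "chg TN i j (y, v) = (chg N i j y, fd (chg N i j) y v)"
proof -
  have y': "y \<in> Img N i" "Prm N i y \<in> Dom N j" using y by (auto simp: mem_overlap_iff[OF i])
  then show ?thesis
    using i j by (simp add: TN_Prm chart_vec_component charts_at_iff Crd_Prm)
qed

lemma TN_chg_smooth:
  assumes i: "i \<in> Idx N" and j: "j \<in> Idx N"
  shows "smooth_on (chg TN i j) (overlap TN i j)"
proof (rule smooth_on_eqI)
  let ?S = "overlap TN i j"
  have S: "?S = overlap N i j \<times> UNIV" by (rule TN_overlap[OF i])
  show o: "open ?S" unfolding S by (intro open_Times open_overlap i j open_UNIV)
  have fst: "smooth_on fst ?S" "fst ` ?S \<subseteq> overlap N i j"
    using smooth_on_fst[OF o smooth_on_id] S by auto
  have snd: "smooth_on snd ?S" using smooth_on_snd[OF o smooth_on_id] by simp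
  show "smooth_on (\<lambda>z. (chg N i j (fst z), fd (chg N i j) (fst z) (snd z))) ?S"
  proof (rule smooth_on_Pair[OF o])
    show "smooth_on (\<lambda>z. chg N i j (fst z)) ?S"
      by (rule smooth_on_compose[OF o open_overlap[OF i j] fst(2,1) trans_smooth[OF i j]])
    show "smooth_on (\<lambda>z. fd (chg N i j) (fst z) (snd z)) ?S"
      by (rule smooth_on_linear_family[OF o open_overlap[OF i j] fst(2,1) snd smooth_on_fd[OF trans_smooth[OF i j]] linear_jac[OF i j]])
  qed
  show "chg TN i j z = (chg N i j (fst z), fd (chg N i j) (fst z) (snd z))" if "z \<in> ?S" for z
    using that TN_chg[OF i j, of "fst z" "snd z"] unfolding S by auto
qed

lemma TN_satlas: "satlas TN"
proof
  show "smooth_atlas TN"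
    unfolding smooth_atlas_def
  proof (intro conjI ballI)
    fix i j assume ij: "i \<in> Idx TN" "j \<in> Idx TN"
    show "open (overlap TN i j)"
      using ij TN_overlap[of i j] by (simp add: open_Times open_overlap)
    show "smooth_on (chg TN i j) (overlap TN i j)" using ij TN_chg_smooth by simp
  qed (simp add: TN_inj)
qed

text \<open>The product rule for \<open>fd (chg N i j) z v\<close> in \<open>z\<close> and
  \<open>v\<close>. Its second derivatives of the transition map are the terms that the complete
  lift of a metric has to absorb.\<close>

lemma TN_jac:
  assumes i: "i \<in> Idx N" and j: "j \<in> Idx N" and y: "y \<in> overlap N i j"
  shows "fd (chg TN i j) (y, v) (u, u') = (fd (chg N i j) y u, fd (\<lambda>z. fd (chg N i j) z v) y u + fd (chg N i j) y u')"
proof -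
  note o = open_overlap[OF i j]
  have fst: "(fst has_derivative fst) (at (y, v))" and snd: "(snd has_derivative snd) (at (y, v))"
    by (auto intro!: derivative_eq_intros)
  have 1: "((\<lambda>z. chg N i j (fst z)) has_derivative (\<lambda>h. fd (chg N i j) y (fst h))) (at (y, v))"
    using has_derivative_compose[OF fst, of "chg N i j"] trans_has_derivative[OF i j y] by simp
  have 2: "((\<lambda>z. fd (chg N i j) (fst z) (snd z)) has_derivative
      (\<lambda>h. fd (\<lambda>z. fd (chg N i j) z v) y (fst h) + fd (chg N i j) y (snd h))) (at (y, v))"
    using has_derivative_linear_family[OF o _ fst snd, of "fd (chg N i j)"] y
      smooth_on_differentiable[OF smooth_on_fd[OF trans_smooth[OF i j]] y] linear_jac[OF i j] by simp
  have "fd (chg TN i j) (y, v) = fd (\<lambda>z. (chg N i j (fst z), fd (chg N i j) (fst z) (snd z))) (y, v)"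
    by (rule fd_cong_open[OF open_Times[OF o open_UNIV]]) (use y TN_chg[OF i j] in auto)
  then show ?thesis using fd_eqI[OF has_derivative_Pair[OF 1 2]] by simp
qed

text \<open>The complete lift is evaluated in an arbitrary chart \<open>k\<close>; passing to chart \<open>i\<close> produces second
  derivatives of the transition map that match by their symmetry.\<close>

lemma complete_lift_metric_crd:
  assumes h: "bform_field N h" and i: "i \<in> Idx N" and y: "y \<in> Img N i"
  shows "bform_crd TN i (complete_lift_metric N h) (y, v) (u, u') (w, w')
    = fd (\<lambda>z. bform_crd N i h z u w) y v + bform_crd N i h y u w' + bform_crd N i h y u' w"
proof -
  interpret T: satlas TN by (rule TN_satlas)
  define p where "p = Prm N i y"
  define k where "k = chart_at N p"
  have pc: "p \<in> carrier N" unfolding p_def using i y by (rule Prm_carrier)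
  have kp: "k \<in> charts_at N p" unfolding k_def using pc by (rule chart_at_mem)
  have ip: "i \<in> charts_at N p" unfolding p_def using i y by (simp add: charts_at_iff Prm_Dom)
  have k: "k \<in> Idx N" "p \<in> Dom N k" using kp by (auto simp: charts_at_iff)
  have yp: "Crd N i p = y" unfolding p_def using y by (rule Crd_Prm)
  have ov: "y \<in> overlap N i k" using k y by (simp add: mem_overlap_iff[OF i] p_def)
  note o = open_overlap[OF i k(1)]
  let ?\<psi> = "chg N i k" and ?V = "chart_vec N i p v"
  let ?J = "fd ?\<psi> y" and ?H = "bform_crd N k h" and ?x = "?\<psi> y"
  have x: "Crd N k p = ?x" by (simp add: p_def)
  have Vt: "?V \<in> tangent_space N p" by (rule chart_vec_tangent[OF ip])
  have P: "Prm TN i (y, v) = (p, ?V)" unfolding p_def by (rule TN_Prm[OF i y])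
  have kT: "k \<in> charts_at TN (p, ?V)" "i \<in> charts_at TN (p, ?V)" using kp ip by (simp_all add: TN_charts_at[OF Vt])
  have cv: "chart_vec TN i (p, ?V) (a, a') k = (?J a, fd (\<lambda>z. fd ?\<psi> z v) y a + ?J a')" for a a'
    using T.chart_vec_component[OF kT(1), of i "(a, a')"] TN_jac[OF i k(1) ov] yp chart_vec_self[OF ip] by simp
  have Vk: "?V k = ?J v" using chart_vec_component[OF kp] yp by simp
  have xI: "?x \<in> Img N k" using trans_overlap[OF i k(1) ov] overlap_subset by blast
  have LHS: "bform_crd TN i (complete_lift_metric N h) (y, v) (u, u') (w, w')
      = fd (\<lambda>z. ?H z (?J u) (?J w)) ?x (?J v)
        + ?H ?x (?J u) (fd (\<lambda>z. fd ?\<psi> z v) y w + ?J w') + ?H ?x (fd (\<lambda>z. fd ?\<psi> z v) y u + ?J u') (?J w)"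
    unfolding bform_crd_def[of TN] P complete_lift_metric_def Let_def prod.case k_def[symmetric] cv Vk x ..
  have Hb: "bilinear (?H z)" if "z \<in> Img N k" for z using h k(1) that by (rule bform_crd_bilinear)
  have sym: "fd (\<lambda>z. fd ?\<psi> z a) y v = fd (\<lambda>z. fd ?\<psi> z v) y a" for a
    by (rule second_derivative_symmetric[OF o trans_smooth[OF i k(1)] ov])
  have J: "((\<lambda>z. fd ?\<psi> z a) has_derivative fd (\<lambda>z. fd ?\<psi> z a) y) (at y)" for a
    by (rule smooth_on_has_derivative[OF smooth_on_fd[OF trans_smooth[OF i k(1)]] ov])
  have img: "?\<psi> ` overlap N i k \<subseteq> Img N k" using trans_overlap[OF i k(1)] overlap_subset by blast
  have H': "((\<lambda>z. ?H (?\<psi> z) (fd ?\<psi> z u) (fd ?\<psi> z w)) has_derivative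
      (\<lambda>d. fd (\<lambda>z. ?H z (?J u) (?J w)) ?x (?J d) + ?H ?x (fd (\<lambda>z. fd ?\<psi> z u) y d) (?J w)
        + ?H ?x (?J u) (fd (\<lambda>z. fd ?\<psi> z w) y d))) (at y)"
    by (rule has_derivative_bilinear_family[OF open_Img[OF k(1)] xI trans_has_derivative[OF i k(1) ov] o ov img
        smooth_on_differentiable[OF trans_smooth[OF i k(1)]] J J
        smooth_on_differentiable[OF bform_crd_smooth[OF h k(1)] xI] Hb])
  have "fd (\<lambda>z. bform_crd N i h z u w) y = fd (\<lambda>z. ?H (?\<psi> z) (fd ?\<psi> z u) (fd ?\<psi> z w)) y"
    by (rule fd_cong_open[OF o ov bform_crd_chg[OF i k(1)]])
  then have "fd (\<lambda>z. bform_crd N i h z u w) y v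
    = fd (\<lambda>z. ?H z (?J u) (?J w)) ?x (?J v) + ?H ?x (fd (\<lambda>z. fd ?\<psi> z u) y v) (?J w)
        + ?H ?x (?J u) (fd (\<lambda>z. fd ?\<psi> z w) y v)"
    unfolding fd_eqI[OF H'] by simp
  then show ?thesis
    unfolding LHS bform_crd_chg[OF i k(1) ov]
    by (simp add: bilinear_ladd[OF Hb[OF xI]] bilinear_radd[OF Hb[OF xI]] sym[of u] sym[of w] del: o_apply)
qed

subsection \<open>Harmonic endomorphism fields\<close>

definition nabla_endo_crd :: "('i,'p,'e) bform \<Rightarrow> ('i,'p,'e) endo \<Rightarrow> 'i \<Rightarrow> 'e \<Rightarrow> 'e \<Rightarrow> 'e \<Rightarrow> 'e" where
  "nabla_endo_crd h T i y u v =
     fd (\<lambda>z. endo_crd i T z v) y u + christoffel (bform_crd N i h) y u (endo_crd i T y v)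
     - endo_crd i T y (christoffel (bform_crd N i h) y u v)"

lemma smooth_map_endo:
  assumes T: "endo_field N T"
  shows "smooth_map TN TN (\<lambda>(p, v). (p, T p v))" (is "smooth_map _ _ ?F")
  unfolding smooth_map_def
proof (intro conjI ballI)
  show "?F ` carrier TN \<subseteq> carrier TN" using endo_tangent[OF T] by (auto simp: TN_carrier)
  fix i j assume "i \<in> Idx TN" "j \<in> Idx TN"
  then have i: "i \<in> Idx N" and j: "j \<in> Idx N" by simp_all
  \<comment> \<open>The map \<open>?F\<close> keeps the base point and sends tangent vectors to
    tangent vectors, so pulling back a chart domain imposes no new condition.\<close>
  have "Dom TN i \<inter> ?F -` Dom TN j = Dom TN i \<inter> Dom TN j"
    using endo_tangent[OF T Dom_carrier[OF i]] by auto
  then have S: "Crd TN i ` (Dom TN i \<inter> ?F -` Dom TN j) = overlap N i j \<times> UNIV"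
    using TN_overlap[OF i, of j] by simp
  have o: "open (overlap N i j \<times> (UNIV :: 'e set))" (is "open ?S") by (intro open_Times open_overlap i j open_UNIV)
  then show "open (Crd TN i ` (Dom TN i \<inter> ?F -` Dom TN j))" unfolding S .
  have fst: "smooth_on fst ?S" "fst ` ?S \<subseteq> overlap N i j" using smooth_on_fst[OF o smooth_on_id] by auto
  have snd: "smooth_on snd ?S" using smooth_on_snd[OF o smooth_on_id] by simp
  have "smooth_on (\<lambda>z. endo_crd i T (fst z) (snd z)) ?S"
  proof (rule smooth_on_linear_family[OF o open_Img[OF i] _ fst(1) snd endo_crd_smooth[OF T i] endo_crd_linear[OF T i]])
    show "fst ` ?S \<subseteq> Img N i" using fst(2) overlap_subset by blast
  qed
  then have "smooth_on (\<lambda>z. (chg N i j (fst z), fd (chg N i j) (fst z) (endo_crd i T (fst z) (snd z)))) ?S"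
    by (intro smooth_on_Pair[OF o] smooth_on_compose[OF o open_overlap[OF i j] fst(2,1) trans_smooth[OF i j]]
        smooth_on_linear_family[OF o open_overlap[OF i j] fst(2,1) _ smooth_on_fd[OF trans_smooth[OF i j]] linear_jac[OF i j]])
  moreover have "(Crd TN j \<circ> ?F \<circ> Prm TN i) z
      = (chg N i j (fst z), fd (chg N i j) (fst z) (endo_crd i T (fst z) (snd z)))" if "z \<in> ?S" for z
  proof -
    obtain y v where z: "z = (y, v)" by (cases z)
    have y: "y \<in> overlap N i j" using that z by auto
    then have y': "y \<in> Img N i" "Prm N i y \<in> Dom N j" by (auto simp: mem_overlap_iff[OF i])
    let ?p = "Prm N i y"
    have ip: "i \<in> charts_at N ?p" "j \<in> charts_at N ?p" using y' i j by (auto simp: charts_at_iff Prm_Dom)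
    have "T ?p (chart_vec N i ?p v) \<in> tangent_space N ?p"
      by (rule endo_tangent[OF T Prm_carrier[OF i y'(1)] chart_vec_tangent[OF ip(1)]])
    from tangent_component[OF this ip] show ?thesis
      by (simp add: z TN_Prm[OF i y'(1)] endo_crd_def Crd_Prm[OF y'(1)])
  qed
  ultimately show "smooth_on (Crd TN j \<circ> ?F \<circ> Prm TN i) (Crd TN i ` (Dom TN i \<inter> ?F -` Dom TN j))"
    unfolding S by (rule smooth_on_eqI[OF o])
qed

text \<open>The tension field of \<open>(p, v) \<mapsto> (p, T v)\<close> is vertical with component
  \<open>\<Sum>\<^sub>c (\<nabla>\<^sub>c T) c\<^sup>\<sharp> + (\<nabla>\<^bsub>c\<^sup>\<sharp>\<^esub> T) c\<close>, the two summands coming from the basis vectors \<open>(c, 0)\<close> and \<open>(0, c)\<close>.\<close>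

lemma harmonic_endoI:
  assumes h: "bform_field N h"
    and sym: "\<And>i y u v. i \<in> Idx N \<Longrightarrow> y \<in> Img N i \<Longrightarrow> bform_crd N i h y u v = bform_crd N i h y v u"
    and nd: "\<And>i y. i \<in> Idx N \<Longrightarrow> y \<in> Img N i \<Longrightarrow> nondegenerate (bform_crd N i h y)"
    and T: "endo_field N T"
    and zero: "\<And>i y c. i \<in> Idx N \<Longrightarrow> y \<in> Img N i \<Longrightarrow> c \<in> Basis \<Longrightarrow>
      nabla_endo_crd h T i y c (sharp (bform_crd N i h y) c) = 0 \<and>
      nabla_endo_crd h T i y (sharp (bform_crd N i h y) c) c = 0"
  shows "harmonic_endo N h T"
  unfolding harmonic_endo_def harmonic_map_def
proof (intro conjI smooth_map_endo[OF T] ballI)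
  interpret T: satlas TN by (rule TN_satlas)
  let ?F = "\<lambda>(p, v). (p, T p v)" and ?hC = "complete_lift_metric N h"
  fix P assume P: "P \<in> carrier TN"
  obtain p V where pV: "P = (p, V)" by (cases P)
  have p: "p \<in> carrier N" and V: "V \<in> tangent_space N p" using P by (auto simp: pV TN_carrier)
  have TV: "T p V \<in> tangent_space N p" by (rule endo_tangent[OF T p V])
  define i where "i = chart_at N p"
  have ip: "i \<in> charts_at N p" unfolding i_def using p by (rule chart_at_mem)
  have i: "i \<in> Idx N" "p \<in> Dom N i" using ip by (simp_all add: charts_at_iff)
  \<comment> \<open>The charts at a point of the tangent bundle depend only on its base point, so
    the arbitrary choices at \<open>p\<close>, at \<open>P\<close> and at its image
    coincide.\<close>
  have ch: "chart_at TN P = i" "chart_at TN (?F P) = i"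
    by (simp_all add: chart_at_def i_def pV TN_charts_at V TV)
  define y where "y = Crd N i p"
  define v where "v = V i"
  have y: "y \<in> Img N i" unfolding y_def by (rule Crd_Img[OF i(2)])
  have P_crd: "Crd TN i P = (y, v)" by (simp add: pV y_def v_def)
  let ?t = "endo_crd i T"
  note lin_t = endo_crd_linear[OF T i(1)] and sm_t = endo_crd_smooth[OF T i(1)]
  define H where "H = bform_crd N i h"
  define G where "G = bform_crd TN i ?hC"
  define f where "f = Crd TN i \<circ> ?F \<circ> Prm TN i"
  let ?S = "Img N i \<times> (UNIV :: 'e set)"
  have S: "open ?S" by (intro open_Times open_Img i(1) open_UNIV)
  have H_bil: "bilinear (H z)" if "z \<in> Img N i" for z unfolding H_def by (rule bform_crd_bilinear[OF h i(1) that])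
  have H_sm: "smooth_on (\<lambda>z. H z a b) (Img N i)" for a b unfolding H_def by (rule bform_crd_smooth[OF h i(1)])
  have H_nd: "nondegenerate (H z)" if "z \<in> Img N i" for z unfolding H_def by (rule nd[OF i(1) that])
  have G: "G (z, x) (u, u') (w, w') = fd (\<lambda>z. H z u w) z x + H z u w' + H z u' w"
    if "z \<in> Img N i" for z x u u' w w'
    unfolding G_def H_def by (rule complete_lift_metric_crd[OF h i(1) that])
  have f_eq: "f (z, x) = (z, ?t z x)" if "z \<in> Img N i" for z x
    using TN_Prm[OF i(1) that] that by (simp add: f_def endo_crd_def Crd_Prm)
  have fst_S: "smooth_on fst ?S" "fst ` ?S \<subseteq> Img N i" using smooth_on_fst[OF S smooth_on_id] by auto
  have snd_S: "smooth_on snd ?S" using smooth_on_snd[OF S smooth_on_id] by simp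
  have t_sm: "smooth_on (\<lambda>z. ?t (fst z) (snd z)) ?S"
    by (rule smooth_on_linear_family[OF S open_Img[OF i(1)] fst_S(2,1) snd_S sm_t lin_t])
  have f_sm: "smooth_on f ?S"
    by (rule smooth_on_eqI[OF S smooth_on_Pair[OF S fst_S(1) t_sm]]) (use f_eq in auto)
  have fst_D: "(fst has_derivative fst) (at z)" and snd_D: "(snd has_derivative snd) (at z)" for z :: "'e \<times> 'e"
    by (auto intro!: derivative_eq_intros)
  have df: "fd f (z, x) (d, d') = (d, fd (\<lambda>z. ?t z x) z d + ?t z d')" if z: "z \<in> Img N i" for z x d d'
  proof -
    have 2: "((\<lambda>z. ?t (fst z) (snd z)) has_derivative (\<lambda>h. fd (\<lambda>z. ?t z x) z (fst h) + ?t z (snd h))) (at (z, x))"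
      using has_derivative_linear_family[OF open_Img[OF i(1)] _ fst_D snd_D, of "(z, x)" ?t] z
        smooth_on_differentiable[OF sm_t z] lin_t by simp
    have "fd f (z, x) = fd (\<lambda>z. (fst z, ?t (fst z) (snd z))) (z, x)"
      by (rule fd_cong_open[OF S]) (use z f_eq in auto)
    then show ?thesis using fd_eqI[OF has_derivative_Pair[OF fst_D 2]] by simp
  qed
  have H0: "fd (\<lambda>z. H z 0 w) z x = 0" "fd (\<lambda>z. H z w 0) z x = 0" if "z \<in> Img N i" for z x w
    using fd_cong_open[OF open_Img[OF i(1)] that, of "\<lambda>z. H z 0 w" "\<lambda>_. 0"]
      fd_cong_open[OF open_Img[OF i(1)] that, of "\<lambda>z. H z w 0" "\<lambda>_. 0"]
    by (simp_all add: bilinear_lzero[OF H_bil] bilinear_rzero[OF H_bil] frechet_derivative_const)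
  have G_bil: "bilinear (G z)" if "z \<in> ?S" for z
  proof -
    obtain z1 z2 where z: "z = (z1, z2)" "z1 \<in> Img N i" using \<open>z \<in> ?S\<close> by auto
    note Hb = H_bil[OF z(2)]
    have l: "linear (\<lambda>u. fd (\<lambda>z. H z u w) z1 z2)" "linear (\<lambda>u. fd (\<lambda>z. H z w u) z1 z2)" for w
      using linear_fd_family[OF open_Img[OF i(1)] z(2) bilinear_linear_left[OF H_bil] smooth_on_differentiable[OF H_sm z(2)]]
        linear_fd_family[OF open_Img[OF i(1)] z(2) bilinear_linear_right[OF H_bil] smooth_on_differentiable[OF H_sm z(2)]]
      by auto
    show ?thesis
      unfolding bilinear_def z(1)
      using linear_add[OF l(1)] linear_scale[OF l(1)] linear_add[OF l(2)] linear_scale[OF l(2)]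
      by (auto intro!: linearI simp: G[OF z(2)] bilinear_ladd[OF Hb] bilinear_lmul[OF Hb] bilinear_radd[OF Hb]
          bilinear_rmul[OF Hb] algebra_simps)
  qed
  have G_nd: "nondegenerate (G z)" if "z \<in> ?S" for z
    unfolding nondegenerate_def
  proof (intro allI impI)
    obtain z1 z2 where z: "z = (z1, z2)" "z1 \<in> Img N i" using \<open>z \<in> ?S\<close> by auto
    note Hb = H_bil[OF z(2)]
    fix X assume X: "\<forall>Y. G z X Y = 0"
    obtain x x' where x: "X = (x, x')" by (cases X)
    have "H z1 x w' = 0" for w'
      using X[rule_format, of "(0, w')"] H0(2)[OF z(2)] by (simp add: z(1) x G[OF z(2)] bilinear_rzero[OF Hb])
    then have x0: "x = 0" using H_nd[OF z(2)] unfolding nondegenerate_def by blast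
    have "H z1 x' w = 0" for w
      using X[rule_format, of "(w, 0)"] H0(1)[OF z(2)] by (simp add: z(1) x x0 G[OF z(2)] bilinear_lzero[OF Hb])
    then have "x' = 0" using H_nd[OF z(2)] unfolding nondegenerate_def by blast
    then show "X = 0" using x x0 by (simp add: zero_prod_def)
  qed
  have G_diff: "(\<lambda>z. G z (u, u') (w, w')) differentiable at (z, x)" if z: "z \<in> Img N i" for z x u u' w w'
  proof -
    have 1: "smooth_on (\<lambda>q. fd (\<lambda>z. H z u w) (fst q) (snd q)) ?S"
      by (rule smooth_on_linear_family[OF S open_Img[OF i(1)] fst_S(2,1) snd_S smooth_on_fd[OF H_sm] smooth_on_linear_fd[OF H_sm]])
    have 2: "smooth_on (\<lambda>q. H (fst q) a b) ?S" for a b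
      by (rule smooth_on_compose[OF S open_Img[OF i(1)] fst_S(2,1) H_sm])
    have "smooth_on (\<lambda>q. G q (u, u') (w, w')) ?S"
      by (rule smooth_on_eqI[OF S smooth_on_add[OF S smooth_on_add[OF S 1 2[of u w']] 2[of u' w]]]) (use G in auto)
    then show ?thesis using smooth_on_differentiable z by blast
  qed
  \<comment> \<open>Christoffel vectors of the complete lift with one vertical argument are vertical
    and come from \<open>H\<close> alone. In every term of the trace one of the two arguments is
    vertical, before and after applying the differential of \<open>f\<close>.\<close>
  have chr: "christoffel G (z, x) (e, e') (0, d) = (0, christoffel H z e d)"
    "christoffel G (z, x) (0, d) (e, e') = (0, christoffel H z e d)" if z: "z \<in> Img N i" for z x e e' d
  proof -
    have zS: "(z, x) \<in> ?S" using z by simp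
    note Hb = H_bil[OF z]
    have along: "fd (\<lambda>q. H (fst q) a b) (z, x) (r, r') = fd (\<lambda>z. H z a b) z r" for a b r r'
    proof -
      have "((\<lambda>q. H (fst q) a b) has_derivative (\<lambda>q. fd (\<lambda>z. H z a b) z (fst q))) (at (z, x))"
        using has_derivative_compose[OF fst_D, of "\<lambda>z. H z a b"] smooth_on_has_derivative[OF H_sm z, of a b] by simp
      from fd_eqI[OF this] show ?thesis by simp
    qed
    have a: "fd (\<lambda>q. G q (0, d) (w, w')) (z, x) (r, r') = fd (\<lambda>z. H z d w) z r" for w w' r r'
      using fd_cong_open[OF S zS, of "\<lambda>q. G q (0, d) (w, w')" "\<lambda>q. H (fst q) d w"] along
      by (auto simp: G H0 bilinear_lzero[OF H_bil])
    have a': "fd (\<lambda>q. G q (w, w') (0, d)) (z, x) (r, r') = fd (\<lambda>z. H z w d) z r" for w w' r r'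
      using fd_cong_open[OF S zS, of "\<lambda>q. G q (w, w') (0, d)" "\<lambda>q. H (fst q) w d"] along
      by (auto simp: G H0 bilinear_rzero[OF H_bil])
    \<comment> \<open>The metric is affine in the fibre coordinate, with the derivative of
      \<open>H\<close> as slope.\<close>
    have b: "fd (\<lambda>q. G q (e, e') (w, w')) (z, x) (0, d) = fd (\<lambda>z. H z e w) z d" for w w'
    proof (rule fd_along_line[OF G_diff[OF z]])
      fix t :: real
      have "linear (fd (\<lambda>z. H z e w) z)" by (rule smooth_on_linear_fd[OF H_sm z])
      then show "G ((z, x) + t *\<^sub>R (0, d)) (e, e') (w, w') = G (z, x) (e, e') (w, w') + t *\<^sub>R fd (\<lambda>z. H z e w) z d"
        by (simp add: G[OF z] linear_add linear_scale)
    qed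
    have swap: "fd (\<lambda>z. H z d e) z = fd (\<lambda>z. H z e d) z"
      by (rule fd_cong_open[OF open_Img[OF i(1)] z]) (simp add: H_def sym[OF i(1)])
    have K: "2 * H z (christoffel H z e d) w = koszul H z e d w" for w
      by (rule christoffel_property_all[of H z, OF Hb H_nd[OF z] linear_koszul[of "Img N i" z H,
            OF open_Img[OF i(1)] z H_bil smooth_on_differentiable[OF H_sm z]]])
    show "christoffel G (z, x) (e, e') (0, d) = (0, christoffel H z e d)"
    proof (rule christoffel_eqI[of G "(z, x)", OF G_bil[OF zS] G_nd[OF zS]])
      fix c :: "'e \<times> 'e" obtain w w' where c: "c = (w, w')" by (cases c)
      show "2 * G (z, x) (0, christoffel H z e d) c = koszul G (z, x) (e, e') (0, d) c"
        using K[of w] by (simp add: c koszul_def a a' b G[OF z] H0[OF z] bilinear_lzero[OF Hb])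
    qed
    show "christoffel G (z, x) (0, d) (e, e') = (0, christoffel H z e d)"
    proof (rule christoffel_eqI[of G "(z, x)", OF G_bil[OF zS] G_nd[OF zS]])
      fix c :: "'e \<times> 'e" obtain w w' where c: "c = (w, w')" by (cases c)
      show "2 * G (z, x) (0, christoffel H z e d) c = koszul G (z, x) (0, d) (e, e') c"
        using K[of w] by (simp add: c koszul_def a a' b G[OF z] H0[OF z] bilinear_lzero[OF Hb] swap)
    qed
  qed
  have yS: "(y, v) \<in> ?S" using y by simp
  have Hsym: "H z a b = H z b a" if "z \<in> Img N i" for z a b unfolding H_def by (rule sym[OF i(1) that])
  have term0: "fd (\<lambda>z. fd f z (sharp (G (y, v)) c)) (y, v) c - fd f (y, v) (christoffel G (y, v) c (sharp (G (y, v)) c))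
      + christoffel G (f (y, v)) (fd f (y, v) c) (fd f (y, v) (sharp (G (y, v)) c)) = 0" if c: "c \<in> Basis" for c
  proof -
    obtain e e' where ce: "c = (e, e')" by (cases c)
    consider "e \<in> Basis" "e' = 0" | "e = 0" "e' \<in> Basis" using c ce by (auto simp: Basis_prod_def)
    then show ?thesis
    proof cases
      case 1
      let ?s = "sharp (H y) e"
      \<comment> \<open>The complete lift pairs base with fibre directions, so the dual vector of a
        base covector is vertical.\<close>
      have sh: "sharp (G (y, v)) c = (0, ?s)"
      proof (rule sharp_eqI[OF G_bil[OF yS] G_nd[OF yS]])
        fix X :: "'e \<times> 'e" obtain w w' where X: "X = (w, w')" by (cases X)
        show "G (y, v) (0, ?s) X = c \<bullet> X"
          by (simp add: X ce 1 G[OF y] H0[OF y] bilinear_lzero[OF H_bil[OF y]] sharp_property[OF H_bil[OF y] H_nd[OF y]])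
      qed
      have "fd (\<lambda>z. fd f z (0, ?s)) (y, v) (e, 0) = (0, fd (\<lambda>z. ?t z ?s) y e)"
      proof -
        have t0: "fd (\<lambda>z. ?t z x) z 0 = 0" if "z \<in> Img N i" for z x
          by (rule linear_0[OF smooth_on_linear_fd[OF sm_t that]])
        have "fd (\<lambda>z. fd f z (0, ?s)) (y, v) = fd (\<lambda>z. (0, ?t (fst z) ?s)) (y, v)"
          by (rule fd_cong_open[OF S yS]) (auto simp: df t0)
        moreover have "((\<lambda>z. ?t (fst z) ?s) has_derivative (\<lambda>q. fd (\<lambda>z. ?t z ?s) y (fst q))) (at (y, v))"
          using has_derivative_compose[OF fst_D, of "\<lambda>z. ?t z ?s"] smooth_on_has_derivative[OF sm_t y, of ?s] by simp
        from fd_eqI[OF has_derivative_Pair[OF has_derivative_const[of "0::'e"] this]]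
        have "fd (\<lambda>z. (0::'e, ?t (fst z) ?s)) (y, v) (e, 0) = (0, fd (\<lambda>z. ?t z ?s) y e)" by simp
        ultimately show ?thesis by simp
      qed
      moreover have "fd (\<lambda>z. ?t z v) y 0 = 0"
        by (rule linear_0[OF smooth_on_linear_fd[OF sm_t y]])
      ultimately show ?thesis
        unfolding sh using zero[OF i(1) y 1(1)]
        by (simp add: ce 1 chr[OF y] df[OF y] f_eq[OF y] H_def[symmetric] nabla_endo_crd_def linear_0[OF lin_t[OF y]]
            zero_prod_def algebra_simps)
    next
      case 2
      let ?s = "sharp (H y) e'"
      \<comment> \<open>Only the base part \<open>s\<close> of the dual vector matters. The fibre
        part \<open>s'\<close> drops out, since \<open>f\<close> is linear along the fibres and
        \<open>chr\<close> ignores the fibre part of the non-vertical argument.\<close>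
      obtain s s' where sh: "sharp (G (y, v)) c = (s, s')" by (cases "sharp (G (y, v)) c")
      have "H y s w' = e' \<bullet> w'" for w'
        using sharp_property[OF G_bil[OF yS] G_nd[OF yS], of c "(0, w')"] unfolding sh
        by (simp add: ce 2 G[OF y] H0[OF y] bilinear_rzero[OF H_bil[OF y]])
      from sharp_eqI[OF H_bil[OF y] H_nd[OF y] this] have s: "?s = s" .
      have d1: "fd (\<lambda>z. fd f z (s, s')) (y, v) (0, e') = (0, fd (\<lambda>z. ?t z e') y s)"
      proof (rule fd_along_line)
        show "(\<lambda>z. fd f z (s, s')) differentiable at (y, v)"
          by (rule smooth_on_differentiable[OF smooth_on_fd[OF f_sm] yS])
        fix r :: real
        have D: "((\<lambda>z. ?t z x) has_derivative fd (\<lambda>z. ?t z x) y) (at y)" for x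
          by (rule smooth_on_has_derivative[OF sm_t y])
        have "fd (\<lambda>z. ?t z (v + r *\<^sub>R e')) y = fd (\<lambda>z. ?t z v + r *\<^sub>R ?t z e') y"
          by (rule fd_cong_open[OF open_Img[OF i(1)] y]) (simp add: linear_add[OF lin_t] linear_scale[OF lin_t])
        then have "fd (\<lambda>z. ?t z (v + r *\<^sub>R e')) y s = fd (\<lambda>z. ?t z v) y s + r *\<^sub>R fd (\<lambda>z. ?t z e') y s"
          using fd_eqI[OF has_derivative_add[OF D has_derivative_scaleR_right[OF D]]] by simp
        then show "fd f ((y, v) + r *\<^sub>R (0, e')) (s, s') = fd f (y, v) (s, s') + r *\<^sub>R (0, fd (\<lambda>z. ?t z e') y s)"
          by (simp add: df[OF y])
      qed
      have t0: "fd (\<lambda>z. ?t z v) y 0 = 0"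
        by (rule linear_0[OF smooth_on_linear_fd[OF sm_t y]])
      have cs: "christoffel H y a b = christoffel H y b a" for a b
        by (rule christoffel_symmetric[of "Img N i" y H, OF open_Img[OF i(1)] y Hsym])
      show ?thesis
        unfolding sh using zero[OF i(1) y 2(2)] d1
        by (simp add: ce 2 chr[OF y] df[OF y] f_eq[OF y] H_def[symmetric] nabla_endo_crd_def linear_0[OF lin_t[OF y]]
            zero_prod_def s t0 algebra_simps)
    qed
  qed
  have iT: "i \<in> charts_at TN (?F P)" by (simp add: pV TN_charts_at[OF TV] ip)
  have cv0: "chart_vec TN i (?F P) 0 = (\<lambda>_. 0)"
    using T.tangent_eqI[OF T.chart_vec_tangent[OF iT] T.zero_tangent iT] T.chart_vec_self[OF iT] by metis
  show "tension_field TN ?hC TN ?hC ?F P = (\<lambda>_. 0)"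
    unfolding tension_field_def ch Let_def P_crd f_def[symmetric] G_def[symmetric]
    using term0 cv0 by (simp add: sum.neutral)
qed

end

section \<open>Images of vector fields under endomorphisms and brackets\<close>

context satlas
begin

lemma endo_apply_vfield:
  assumes T: "endo_field N T" and X: "X \<in> vector_fields N"
  shows "endo_apply N T X \<in> vector_fields N"
  unfolding vector_fields_def
proof (intro CollectI conjI ballI allI impI)
  fix p assume "p \<in> carrier N"
  then show "endo_apply N T X p \<in> tangent_space N p"
    using endo_tangent[OF T] vfield_tangent[OF X] by (simp add: endo_apply_def)
next
  fix i assume i: "i \<in> Idx N"
  have eq: "vfield_crd N i (endo_apply N T X) y = endo_crd i T y (vfield_crd N i X y)" if y: "y \<in> Img N i" for y
  proof -
    have ip: "i \<in> charts_at N (Prm N i y)" using i y by (simp add: charts_at_iff Prm_Dom)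
    note pc = Prm_carrier[OF i y]
    show ?thesis
      using endo_chart[OF ip vfield_tangent[OF X pc], of T] pc y
      by (simp add: vfield_crd_def endo_apply_def Crd_Prm)
  qed
  have "smooth_on (\<lambda>y. endo_crd i T y (vfield_crd N i X y)) (Img N i)"
    by (rule smooth_on_linear_family[where f = "\<lambda>y. y" and T = "Img N i"])
       (use i open_Img smooth_on_id vfield_smooth[OF X i] endo_crd_smooth[OF T i] endo_crd_linear[OF T i] in auto)
  then show "smooth_on (vfield_crd N i (endo_apply N T X)) (Img N i)"
    by (rule smooth_on_eqI[OF open_Img[OF i] _ eq])
qed (simp add: endo_apply_def)

text \<open>The components in chart \<open>j\<close> are the Jacobian applied to those in chart
  \<open>i\<close>, and the product rule differentiates both. The first summand is the non-tensorial
  part.\<close>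

lemma vfield_crd_chg_derivative:
  assumes X: "X \<in> vector_fields N" and i: "i \<in> charts_at N p" and j: "j \<in> charts_at N p"
  defines "\<Phi> \<equiv> fd (chg N j i) (Crd N j p)"
  shows "fd (vfield_crd N j X) (Crd N j p) d
    = fd (\<lambda>y. fd (chg N i j) y (X p i)) (Crd N i p) (\<Phi> d)
      + fd (chg N i j) (Crd N i p) (fd (vfield_crd N i X) (Crd N i p) (\<Phi> d))"
proof -
  have ij: "i \<in> Idx N" "j \<in> Idx N" "p \<in> Dom N i" "p \<in> Dom N j" using i j by (auto simp: charts_at_iff)
  note ov = Crd_overlap[OF ij(4,3)] and ov' = Crd_overlap[OF ij(3,4)]
  note o = open_overlap[OF ij(2,1)]
  have c: "chg N j i (Crd N j p) = Crd N i p" using Prm_Crd ij by simp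
  have Xi: "vfield_crd N i X (Crd N i p) = X p i" using ij by (simp add: vfield_crd_def Prm_Crd)
  have eq: "vfield_crd N j X z = fd (chg N i j) (chg N j i z) (vfield_crd N i X (chg N j i z))"
    if "z \<in> overlap N j i" for z
  proof -
    have z: "z \<in> Img N j" "Prm N j z \<in> Dom N i" using that by (auto simp: mem_overlap_iff[OF ij(2)])
    have q: "i \<in> charts_at N (Prm N j z)" "j \<in> charts_at N (Prm N j z)"
      using z ij by (auto simp: charts_at_iff Prm_Dom)
    show ?thesis
      using tangent_component[OF vfield_tangent[OF X Dom_carrier[OF ij(1) z(2)]] q] z
      by (simp add: vfield_crd_def Prm_Crd[OF ij(1)])
  qed
  note D1 = trans_has_derivative[OF ij(2,1) ov]
  have D2: "((\<lambda>z. vfield_crd N i X (chg N j i z)) has_derivative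
      (\<lambda>d. fd (vfield_crd N i X) (Crd N i p) (\<Phi> d))) (at (Crd N j p))"
    using has_derivative_compose[OF D1, of "vfield_crd N i X"]
      smooth_on_has_derivative[OF vfield_smooth[OF X ij(1)] Crd_Img[OF ij(3)]]
    unfolding c \<Phi>_def by blast
  have "((\<lambda>z. fd (chg N i j) (chg N j i z) (vfield_crd N i X (chg N j i z))) has_derivative
     (\<lambda>d. fd (\<lambda>y. fd (chg N i j) y (vfield_crd N i X (chg N j i (Crd N j p)))) (chg N j i (Crd N j p)) (\<Phi> d)
       + fd (chg N i j) (chg N j i (Crd N j p)) (fd (vfield_crd N i X) (Crd N i p) (\<Phi> d)))) (at (Crd N j p))"
    unfolding \<Phi>_def
    by (rule has_derivative_linear_family[where f = "chg N j i" and L = "fd (chg N i j)",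
          OF open_overlap[OF ij(1,2)] _ D1 D2[unfolded \<Phi>_def]
          smooth_on_differentiable[OF smooth_on_fd[OF trans_smooth[OF ij(1,2)]]] linear_jac[OF ij(1,2)]])
       (use ov' c in auto)
  from fd_eqI[OF this] show ?thesis
    unfolding c Xi using fd_cong_open[OF o ov eq] by simp
qed

text \<open>The non-tensorial parts of the two derivatives cancel by symmetry of the second
  derivatives of the transition map.\<close>

lemma bracket_tangent:
  assumes X: "X \<in> vector_fields N" and Y: "Y \<in> vector_fields N" and p: "p \<in> carrier N"
  shows "bracket N X Y p \<in> tangent_space N p"
  unfolding tangent_space_def
proof (intro CollectI conjI ballI allI impI)
  fix i j assume i: "i \<in> charts_at N p" and j: "j \<in> charts_at N p"
  have ij: "i \<in> Idx N" "j \<in> Idx N" "p \<in> Dom N i" "p \<in> Dom N j" using i j by (auto simp: charts_at_iff)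
  note ov = Crd_overlap[OF ij(3,4)]
  have inv: "fd (chg N j i) (Crd N j p) (Z p j) = Z p i" if "Z \<in> vector_fields N" for Z
    using tangent_component[OF vfield_tangent[OF that p] j i] by simp
  show "bracket N X Y p j = transition_deriv N p i j (bracket N X Y p i)"
    using second_derivative_symmetric[OF open_overlap[OF ij(1,2)] trans_smooth[OF ij(1,2)] ov, of "X p i" "Y p i"]
    unfolding bracket_def transition_deriv_eq
    by (simp add: i j vfield_crd_chg_derivative[OF X i j] vfield_crd_chg_derivative[OF Y i j] inv X Y
        linear_diff[OF linear_jac[OF ij(1,2) ov]])
qed (simp add: bracket_def)

subsection \<open>The cotangent bundle\<close>

abbreviation CT :: "('i, 'p \<times> ('i,'e) covec, 'e \<times> 'e) atlas" where "CT \<equiv> cotangent_bundle N"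

definition covec_of :: "'i \<Rightarrow> 'p \<Rightarrow> 'e \<Rightarrow> ('i,'e) covec" where
  "covec_of i p w = (\<lambda>v. if v \<in> tangent_space N p then w \<bullet> v i else 0)"

lemma covec_of_cotangent: "covec_of i p w \<in> cotangent_space N p"
  by (auto simp: cotangent_space_def covec_of_def lincomb_tangent lincomb_apply inner_add_right)

lemma covec_crd_of: "i \<in> charts_at N p \<Longrightarrow> covec_crd N i p (covec_of i p w) = w"
  by (simp add: covec_crd_def covec_of_def chart_vec_tangent chart_vec_self euclidean_representation)

lemma covec_crd_inner:
  fixes L :: "'e \<Rightarrow> real"
  assumes "linear L" shows "(\<Sum>c\<in>Basis. L c *\<^sub>R c) \<bullet> u = L u"
proof -
  have "L u = (\<Sum>c\<in>Basis. (u \<bullet> c) *\<^sub>R L c)" by (rule linear_sum_Basis[OF assms])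
  then show ?thesis unfolding inner_sum_left by (simp add: inner_commute[of u] mult.commute)
qed

lemma covec_eval:
  assumes w: "\<omega> \<in> cotangent_space N p" and v: "v \<in> tangent_space N p" and i: "i \<in> charts_at N p"
  shows "\<omega> v = covec_crd N i p \<omega> \<bullet> v i"
proof -
  have "\<omega> (lincomb r (chart_vec N i p u) s (chart_vec N i p u')) = r * \<omega> (chart_vec N i p u) + s * \<omega> (chart_vec N i p u')"
    for r s u u' using w chart_vec_tangent[OF i] unfolding cotangent_space_def by blast
  from this[of 1 _ 1] this[of _ _ 0] have "linear (\<lambda>u. \<omega> (chart_vec N i p u))"
    using chart_vec_lincomb[OF i, of 1 _ 1] chart_vec_lincomb[OF i, of _ _ 0] by (auto intro!: linearI)
  from covec_crd_inner[OF this, of "v i"] show ?thesis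
    unfolding covec_crd_def chart_vec_eq[OF v i] by simp
qed

lemma covec_eqI:
  assumes "\<omega> \<in> cotangent_space N p" "\<theta> \<in> cotangent_space N p" "i \<in> charts_at N p"
    "covec_crd N i p \<omega> = covec_crd N i p \<theta>"
  shows "\<omega> = \<theta>"
proof
  fix v
  show "\<omega> v = \<theta> v"
  proof (cases "v \<in> tangent_space N p")
    case True
    then show ?thesis using covec_eval[OF assms(1) True assms(3)] covec_eval[OF assms(2) True assms(3)] assms(4) by simp
  next
    case False
    then show ?thesis using assms(1,2) by (simp add: cotangent_space_def)
  qed
qed

text \<open>The transpose of the inverse Jacobian, by which covector components transform.\<close>

definition cojac :: "'i \<Rightarrow> 'i \<Rightarrow> 'e \<Rightarrow> 'e \<Rightarrow> 'e" where
  "cojac i j y w = (\<Sum>c\<in>Basis. (w \<bullet> fd (chg N j i) (chg N i j y) c) *\<^sub>R c)"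

lemma linear_cojac: "linear (cojac i j y)"
  by (rule linearI) (simp_all add: cojac_def inner_add_left scaleR_add_left sum.distrib scaleR_sum_right)

lemma cojac_inner:
  assumes "i \<in> Idx N" "j \<in> Idx N" "y \<in> overlap N i j"
  shows "cojac i j y w \<bullet> u = w \<bullet> fd (chg N j i) (chg N i j y) u"
proof -
  have "linear (\<lambda>u. w \<bullet> fd (chg N j i) (chg N i j y) u)"
    using linear_jac[OF assms(2,1) trans_overlap[OF assms]]
    by (auto intro!: linearI simp: linear_add linear_scale inner_add_right)
  then show ?thesis unfolding cojac_def by (rule covec_crd_inner)
qed

lemma covec_crd_chg:
  assumes w: "\<omega> \<in> cotangent_space N p" and i: "i \<in> charts_at N p" and j: "j \<in> charts_at N p"
  shows "covec_crd N j p \<omega> = cojac i j (Crd N i p) (covec_crd N i p \<omega>)"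
proof -
  have ij: "i \<in> Idx N" "j \<in> Idx N" "p \<in> Dom N i" "p \<in> Dom N j" using i j by (auto simp: charts_at_iff)
  have c: "chg N i j (Crd N i p) = Crd N j p" using Prm_Crd ij by simp
  show ?thesis
    unfolding covec_crd_def[of N j] cojac_def c
    by (intro sum.cong refl) (simp add: covec_eval[OF w chart_vec_tangent[OF j] i] chart_vec_component[OF i])
qed

lemma CT_simps [simp]:
  "Idx CT = Idx N" "(p, \<omega>) \<in> Dom CT i \<longleftrightarrow> p \<in> Dom N i \<and> \<omega> \<in> cotangent_space N p"
  "Crd CT i (p, \<omega>) = (Crd N i p, covec_crd N i p \<omega>)"
  by (simp_all add: cotangent_bundle_def)

lemma CT_charts_at: "\<omega> \<in> cotangent_space N p \<Longrightarrow> charts_at CT (p, \<omega>) = charts_at N p"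
  by (auto simp: charts_at_def)

lemma CT_carrier: "(p, \<omega>) \<in> carrier CT \<longleftrightarrow> p \<in> carrier N \<and> \<omega> \<in> cotangent_space N p"
  by (auto simp: carrier_def)

lemma CT_inj:
  assumes i: "i \<in> Idx N" shows "inj_on (Crd CT i) (Dom CT i)"
proof (rule inj_onI, clarsimp)
  fix p v q w
  assume *: "p \<in> Dom N i" "v \<in> cotangent_space N p" "q \<in> Dom N i" "w \<in> cotangent_space N q"
    "Crd N i p = Crd N i q" "covec_crd N i p v = covec_crd N i q w"
  then have "p = q" using inj_Crd[OF i] by (simp add: inj_on_def)
  then show "p = q \<and> v = w" using * i covec_eqI[of v p w i] by (simp add: charts_at_iff)
qed

text \<open>Every vector of the model space occurs as the components of some covector, so sets
  saturated along the fibres have product images. Openness of such sets is thereby decided on the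
  base.\<close>

lemma CT_image:
  assumes i: "i \<in> Idx N"
  shows "Crd CT i ` ({q \<in> carrier CT. fst q \<in> U} \<inter> Dom CT i) = Crd N i ` (U \<inter> Dom N i) \<times> UNIV"
proof (intro equalityI subsetI)
  fix z assume "z \<in> Crd CT i ` ({q \<in> carrier CT. fst q \<in> U} \<inter> Dom CT i)"
  then show "z \<in> Crd N i ` (U \<inter> Dom N i) \<times> UNIV" by auto
next
  fix z assume "z \<in> Crd N i ` (U \<inter> Dom N i) \<times> (UNIV :: 'e set)"
  then obtain p u where p: "p \<in> Dom N i" "p \<in> U" "z = (Crd N i p, u)" by auto
  have ip: "i \<in> charts_at N p" using p i by (simp add: charts_at_iff)
  have "z = Crd CT i (p, covec_of i p u)" by (simp add: p covec_crd_of[OF ip])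
  moreover have "(p, covec_of i p u) \<in> {q \<in> carrier CT. fst q \<in> U} \<inter> Dom CT i"
    using p Dom_carrier[OF i] by (simp add: covec_of_cotangent CT_carrier)
  ultimately show "z \<in> Crd CT i ` ({q \<in> carrier CT. fst q \<in> U} \<inter> Dom CT i)" by blast
qed

lemma CT_overlap:
  assumes i: "i \<in> Idx N" and j: "j \<in> Idx N" shows "overlap CT i j = overlap N i j \<times> UNIV"
proof -
  have "Dom CT i \<inter> Dom CT j = {q \<in> carrier CT. fst q \<in> Dom N j} \<inter> Dom CT i"
    using Dom_carrier[OF j] by (auto simp: CT_carrier)
  then show ?thesis using CT_image[OF i, of "Dom N j"] by (simp add: Int_commute)
qed

lemma CT_Img: "i \<in> Idx N \<Longrightarrow> Img CT i = Img N i \<times> UNIV"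
  using CT_overlap[of i i] by (simp add: Img_def)

lemma CT_Prm:
  assumes i: "i \<in> Idx N" and y: "y \<in> Img N i"
  shows "Prm CT i (y, w) = (Prm N i y, covec_of i (Prm N i y) w)"
proof -
  have ip: "i \<in> charts_at N (Prm N i y)" using i y by (simp add: charts_at_iff Prm_Dom)
  have "(y, w) = Crd CT i (Prm N i y, covec_of i (Prm N i y) w)"
    using y by (simp add: Crd_Prm covec_crd_of[OF ip])
  moreover have "(Prm N i y, covec_of i (Prm N i y) w) \<in> Dom CT i"
    using y by (simp add: Prm_Dom covec_of_cotangent)
  ultimately show ?thesis unfolding Prm_def[of CT] using CT_inj[OF i] by (metis inv_into_f_f)
qed

lemma CT_chg:
  assumes i: "i \<in> Idx N" and j: "j \<in> Idx N" and y: "y \<in> overlap N i j"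
  shows "chg CT i j (y, w) = (chg N i j y, cojac i j y w)"
proof -
  have y': "y \<in> Img N i" "Prm N i y \<in> Dom N j" using y by (auto simp: mem_overlap_iff[OF i])
  have ip: "i \<in> charts_at N (Prm N i y)" "j \<in> charts_at N (Prm N i y)" using y' i j by (auto simp: charts_at_iff Prm_Dom)
  show ?thesis
    using covec_crd_chg[OF covec_of_cotangent ip, of i w] by (simp add: CT_Prm[OF i y'(1)] covec_crd_of[OF ip(1)] Crd_Prm[OF y'(1)])
qed

lemma CT_chg_smooth:
  assumes i: "i \<in> Idx N" and j: "j \<in> Idx N"
  shows "smooth_on (chg CT i j) (overlap CT i j)"
proof (rule smooth_on_eqI)
  let ?S = "overlap CT i j"
  have S: "?S = overlap N i j \<times> UNIV" by (rule CT_overlap[OF i j])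
  show o: "open ?S" unfolding S by (intro open_Times open_overlap i j open_UNIV)
  have fst: "smooth_on fst ?S" "fst ` ?S \<subseteq> overlap N i j" using smooth_on_fst[OF o smooth_on_id] S by auto
  have snd: "smooth_on snd ?S" using smooth_on_snd[OF o smooth_on_id] by simp
  have ch: "smooth_on (\<lambda>z. chg N i j (fst z)) ?S"
    by (rule smooth_on_compose[OF o open_overlap[OF i j] fst(2,1) trans_smooth[OF i j]])
  have img: "(\<lambda>z. chg N i j (fst z)) ` ?S \<subseteq> overlap N j i" using fst(2) trans_overlap[OF i j] by blast
  have "smooth_on (\<lambda>z. fd (chg N j i) (chg N i j (fst z)) c) ?S" for c
    by (rule smooth_on_compose[OF o open_overlap[OF j i] img ch smooth_on_fd[OF trans_smooth[OF j i]]])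
  then have "smooth_on (\<lambda>z. cojac i j (fst z) (snd z)) ?S"
    unfolding cojac_def by (intro smooth_intros o snd finite_Basis)
  then show "smooth_on (\<lambda>z. (chg N i j (fst z), cojac i j (fst z) (snd z))) ?S"
    by (rule smooth_on_Pair[OF o ch])
  show "chg CT i j z = (chg N i j (fst z), cojac i j (fst z) (snd z))" if "z \<in> ?S" for z
    using that CT_chg[OF i j, of "fst z" "snd z"] unfolding S by auto
qed

lemma CT_satlas: "satlas CT"
proof
  show "smooth_atlas CT"
    unfolding smooth_atlas_def
  proof (intro conjI ballI)
    fix i j assume ij: "i \<in> Idx CT" "j \<in> Idx CT"
    show "open (overlap CT i j)"
      using ij CT_overlap[of i j] by (simp add: open_Times open_overlap)
    show "smooth_on (chg CT i j) (overlap CT i j)" using ij CT_chg_smooth by simp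
  qed (simp add: CT_inj)
qed

text \<open>Covector components are multiplied by the inverse Jacobian, which itself varies with the
  base point; the sum over the basis records this variation.\<close>

lemma CT_jac:
  assumes i: "i \<in> Idx N" and j: "j \<in> Idx N" and y: "y \<in> overlap N i j"
  shows "fd (chg CT i j) (y, w) (u, \<theta>) = (fd (chg N i j) y u,
    (\<Sum>c\<in>Basis. (w \<bullet> fd (\<lambda>z. fd (chg N j i) z c) (chg N i j y) (fd (chg N i j) y u)) *\<^sub>R c) + cojac i j y \<theta>)"
proof -
  note o = open_overlap[OF i j]
  have fst: "(fst has_derivative fst) (at (y, w))" and snd: "(snd has_derivative snd) (at (y, w))"
    by (auto intro!: derivative_eq_intros)
  have 1: "((\<lambda>z. chg N i j (fst z)) has_derivative (\<lambda>h. fd (chg N i j) y (fst h))) (at (y, w))"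
    using has_derivative_compose[OF fst, of "chg N i j"] trans_has_derivative[OF i j y] by simp
  have 2: "((\<lambda>z. fd (chg N j i) (chg N i j (fst z)) c) has_derivative
      (\<lambda>h. fd (\<lambda>z. fd (chg N j i) z c) (chg N i j y) (fd (chg N i j) y (fst h)))) (at (y, w))" for c
    using has_derivative_compose[OF 1, of "\<lambda>z. fd (chg N j i) z c"]
      smooth_on_has_derivative[OF smooth_on_fd[OF trans_smooth[OF j i]] trans_overlap[OF i j y], of c] by simp
  have inn: "((\<lambda>z. snd z \<bullet> fd (chg N j i) (chg N i j (fst z)) c) has_derivative
      (\<lambda>h. w \<bullet> fd (\<lambda>z. fd (chg N j i) z c) (chg N i j y) (fd (chg N i j) y (fst h))
         + snd h \<bullet> fd (chg N j i) (chg N i j y) c)) (at (y, w))" for c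
    using has_derivative_inner[OF snd 2[of c]] by simp
  have 3: "((\<lambda>z. cojac i j (fst z) (snd z)) has_derivative
      (\<lambda>h. \<Sum>c\<in>Basis. (w \<bullet> fd (\<lambda>z. fd (chg N j i) z c) (chg N i j y) (fd (chg N i j) y (fst h))
         + snd h \<bullet> fd (chg N j i) (chg N i j y) c) *\<^sub>R c)) (at (y, w))"
    unfolding cojac_def
    by (intro has_derivative_sum has_derivative_scaleR_left inn)
  have "fd (chg CT i j) (y, w) = fd (\<lambda>z. (chg N i j (fst z), cojac i j (fst z) (snd z))) (y, w)"
    by (rule fd_cong_open[OF open_Times[OF o open_UNIV]]) (use y CT_chg[OF i j] in auto)
  then show ?thesis
    using fd_eqI[OF has_derivative_Pair[OF 1 3]]
    by (simp add: scaleR_add_left sum.distrib cojac_def)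
qed

text \<open>For a field with vanishing first derivatives in chart \<open>i\<close> the complete lift has components
  \<open>(X, 0)\<close> there; its transformation law is the derivative of \<open>J\<^sup>-\<^sup>1 J = 1\<close>.\<close>

lemma complete_lift_chart_vec:
  assumes X: "X \<in> vector_fields N" and i: "i \<in> charts_at N p" and w: "\<omega> \<in> cotangent_space N p"
    and X0: "fd (vfield_crd N i X) (Crd N i p) = (\<lambda>_. 0)"
  shows "complete_lift N X (p, \<omega>) = chart_vec CT i (p, \<omega>) (X p i, 0)"
proof (rule ext)
  interpret CT: satlas CT by (rule CT_satlas)
  fix j
  show "complete_lift N X (p, \<omega>) j = chart_vec CT i (p, \<omega>) (X p i, 0) j"
  proof (cases "j \<in> charts_at N p")
    case False
    then show ?thesis using w by (simp add: complete_lift_def chart_vec_def CT_charts_at)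
  next
    case j: True
    have ij: "i \<in> Idx N" "j \<in> Idx N" "p \<in> Dom N i" "p \<in> Dom N j" using i j by (auto simp: charts_at_iff)
    note pc = Dom_carrier[OF ij(1,3)]
    note ov = Crd_overlap[OF ij(3,4)] and ov' = Crd_overlap[OF ij(4,3)]
    define y where "y = Crd N i p"
    define y' where "y' = Crd N j p"
    have c: "chg N i j y = y'" unfolding y_def y'_def using Prm_Crd ij by simp
    have ovs: "y \<in> overlap N i j" "y' \<in> overlap N j i" unfolding y_def y'_def using ov ov' by blast+
    let ?J = "fd (chg N i j) y" and ?\<Phi> = "fd (chg N j i) y'" and ?x = "X p i"
    have jT: "j \<in> charts_at CT (p, \<omega>)" using j w by (simp add: CT_charts_at)
    have second: "fd (\<lambda>z. fd (chg N j i) z d) y' (?J ?x) + ?\<Phi> (fd (\<lambda>z. fd (chg N i j) z ?x) y (?\<Phi> d)) = 0" for d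
    proof -
      have D: "((\<lambda>z. fd (chg N j i) (chg N i j z) (fd (chg N i j) z ?x)) has_derivative
        (\<lambda>d. fd (\<lambda>z. fd (chg N j i) z (?J ?x)) (chg N i j y) (?J d)
           + fd (chg N j i) (chg N i j y) (fd (\<lambda>z. fd (chg N i j) z ?x) y d))) (at y)"
        by (rule has_derivative_linear_family[where f = "chg N i j" and L = "fd (chg N j i)",
              OF open_overlap[OF ij(2,1)] _ trans_has_derivative[OF ij(1,2) ovs(1)]
              smooth_on_has_derivative[OF smooth_on_fd[OF trans_smooth[OF ij(1,2)]] ovs(1)]
              smooth_on_differentiable[OF smooth_on_fd[OF trans_smooth[OF ij(2,1)]]] linear_jac[OF ij(2,1)]])
           (use ovs c in auto)
      have "fd (\<lambda>z. fd (chg N j i) (chg N i j z) (fd (chg N i j) z ?x)) y = fd (\<lambda>_. ?x) y"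
        by (rule fd_cong_open[OF open_overlap[OF ij(1,2)] ovs(1) jac_inverse[OF ij(1,2)]])
      then have "fd (\<lambda>z. fd (chg N j i) z (?J ?x)) y' (?J (?\<Phi> d)) + ?\<Phi> (fd (\<lambda>z. fd (chg N i j) z ?x) y (?\<Phi> d)) = 0"
        using fun_cong[OF fd_eqI[OF D], of "?\<Phi> d"] by (simp add: c[simplified] frechet_derivative_const)
      moreover have "?J (?\<Phi> d) = d"
      proof -
        have "chg N j i y' = y" using trans_inverse[OF ij(1,2) ovs(1)] c by simp
        then show ?thesis using jac_inverse[OF ij(2,1) ovs(2), of d] by simp
      qed
      \<comment> \<open>Symmetry exchanges the direction \<open>d\<close> with the argument
        \<open>?J ?x\<close>, giving the order in which \<open>CT_jac\<close> contains them.\<close>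
      moreover have "fd (\<lambda>z. fd (chg N j i) z (?J ?x)) y' d = fd (\<lambda>z. fd (chg N j i) z d) y' (?J ?x)"
        by (rule second_derivative_symmetric[OF open_overlap[OF ij(2,1)] trans_smooth[OF ij(2,1)] ovs(2)])
      ultimately show ?thesis by simp
    qed
    let ?w = "covec_crd N i p \<omega>"
    have comp: "- (covec_crd N j p \<omega> \<bullet> fd (vfield_crd N j X) y' d) = ?w \<bullet> fd (\<lambda>z. fd (chg N j i) z d) y' (?J ?x)" for d
    proof -
      have "covec_crd N j p \<omega> \<bullet> fd (vfield_crd N j X) y' d = ?w \<bullet> ?\<Phi> (fd (vfield_crd N j X) y' d)"
        using cojac_inner[OF ij(1,2) ovs(1)] c unfolding covec_crd_chg[OF w i j] y_def[symmetric] by simp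
      moreover have X': "fd (vfield_crd N j X) y' d = fd (\<lambda>z. fd (chg N i j) z ?x) y (?\<Phi> d)"
        unfolding y'_def y_def vfield_crd_chg_derivative[OF X i j] X0
        by (simp add: linear_0[OF linear_jac[OF ij(1,2) ov]])
      ultimately show ?thesis
        using arg_cong[OF second[of d], of "\<lambda>v. ?w \<bullet> v"] unfolding X' by (simp add: inner_add_right)
    qed
    have "complete_lift N X (p, \<omega>) j = (X p j, \<Sum>d\<in>Basis. (?w \<bullet> fd (\<lambda>z. fd (chg N j i) z d) y' (?J ?x)) *\<^sub>R d)"
      using jT unfolding complete_lift_def by (simp add: y'_def[symmetric] comp[symmetric] sum_negf)
    also have "X p j = ?J ?x" unfolding y_def by (rule tangent_component[OF vfield_tangent[OF X pc] i j])
    finally show ?thesis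
      using CT_jac[OF ij(1,2) ovs(1), of ?w ?x 0]
      unfolding c CT.chart_vec_component[OF jT] CT_simps(3) y_def[symmetric] linear_0[OF linear_cojac] add_0_right
      by (rule trans[OF _ sym])
  qed
qed

text \<open>Without a base component the second-derivative term of \<open>CT_jac\<close> vanishes,
  and only the transformation law of covectors remains.\<close>

lemma vertical_chart_vec:
  assumes t: "\<theta> \<in> cotangent_space N p" and i: "i \<in> charts_at N p" and w: "\<omega> \<in> cotangent_space N p"
  shows "vertical N (p, \<omega>) \<theta> = chart_vec CT i (p, \<omega>) (0, covec_crd N i p \<theta>)"
proof (rule ext)
  interpret CT: satlas CT by (rule CT_satlas)
  fix j
  show "vertical N (p, \<omega>) \<theta> j = chart_vec CT i (p, \<omega>) (0, covec_crd N i p \<theta>) j"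
  proof (cases "j \<in> charts_at N p")
    case False
    then show ?thesis using w by (simp add: vertical_def chart_vec_def CT_charts_at)
  next
    case j: True
    have ij: "i \<in> Idx N" "j \<in> Idx N" "p \<in> Dom N i" "p \<in> Dom N j" using i j by (auto simp: charts_at_iff)
    note ov = Crd_overlap[OF ij(3,4)]
    have jT: "j \<in> charts_at CT (p, \<omega>)" using j w by (simp add: CT_charts_at)
    have z: "fd (chg N i j) (Crd N i p) 0 = 0" "fd (\<lambda>z. fd (chg N j i) z c) (chg N i j (Crd N i p)) 0 = 0" for c
      using linear_0[OF linear_jac[OF ij(1,2) ov]]
        linear_0[OF smooth_on_linear_fd[OF smooth_on_fd[OF trans_smooth[OF ij(2,1)]] trans_overlap[OF ij(1,2) ov]]]
      by auto
    show ?thesis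
      unfolding CT.chart_vec_component[OF jT] CT_simps(3) CT_jac[OF ij(1,2) ov] z covec_crd_chg[OF t i j, symmetric]
      using jT by (simp add: vertical_def)
  qed
qed

end

section \<open>Topology of the cotangent bundle\<close>

context smanifold
begin

lemma CT_openin_preimage:
  assumes "openin (atlas_topology N) U"
  shows "openin (atlas_topology CT) {q \<in> carrier CT. fst q \<in> U}"
proof -
  interpret CT: satlas CT by (rule CT_satlas)
  show ?thesis
    unfolding CT.openin_atlas_topology
    using assms unfolding openin_atlas_topology by (auto simp: CT_image open_Times simp del: CT_simps(2,3))
qed

text \<open>Points over different base points are separated by preimages of base neighbourhoods,
  points of one fibre by the coordinates of a common chart. A countable basis combines one of the
  base with one of the Euclidean model.\<close>

lemma CT_smanifold: "smanifold CT"
proof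
  interpret CT: satlas CT by (rule CT_satlas)
  obtain p where p: "p \<in> carrier N" using manifold by (auto simp: smooth_manifold_def)
  have ne: "carrier CT \<noteq> {}" using CT_carrier[of p] p covec_of_cotangent by blast
  have T2: "Hausdorff_space (atlas_topology N)" and C2: "second_countable (atlas_topology N)"
    using manifold by (simp_all add: smooth_manifold_def)
  have "Hausdorff_space (atlas_topology CT)"
    unfolding Hausdorff_space_def CT.topspace_atlas_topology
  proof (intro allI impI)
    fix q r assume qr: "q \<in> carrier CT \<and> r \<in> carrier CT \<and> q \<noteq> r"
    obtain x \<omega> where q: "q = (x, \<omega>)" by (cases q)
    obtain z \<theta> where r: "r = (z, \<theta>)" by (cases r)
    have x: "x \<in> carrier N" "z \<in> carrier N" using qr by (auto simp: q r CT_carrier)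
    show "\<exists>U V. openin (atlas_topology CT) U \<and> openin (atlas_topology CT) V \<and> q \<in> U \<and> r \<in> V \<and> disjnt U V"
    proof (cases "x = z")
      case False
      then obtain U V where UV: "openin (atlas_topology N) U" "openin (atlas_topology N) V" "x \<in> U" "z \<in> V" "disjnt U V"
        using T2 x unfolding Hausdorff_space_def topspace_atlas_topology by blast
      show ?thesis
        using CT_openin_preimage[OF UV(1)] CT_openin_preimage[OF UV(2)] UV(3-5) qr
        by (intro exI[of _ "{q \<in> carrier CT. fst q \<in> U}"] exI[of _ "{q \<in> carrier CT. fst q \<in> V}"])
           (auto simp: q r disjnt_def)
    next
      case True
      obtain i where i: "i \<in> Idx N" "x \<in> Dom N i" using x by (auto simp: carrier_def)
      have qi: "q \<in> Dom CT i" "r \<in> Dom CT i" using i qr True by (auto simp: q r CT_carrier)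
      then have "Crd CT i q \<noteq> Crd CT i r" using CT_inj[OF i(1)] qr by (auto dest: inj_onD)
      then obtain A B where AB: "open A" "open B" "Crd CT i q \<in> A" "Crd CT i r \<in> B" "A \<inter> B = {}"
        by (metis hausdorff)
      have iT: "i \<in> Idx CT" using i by simp
      have mem: "s \<in> Prm CT i ` (E \<inter> Img CT i)" if "s \<in> Dom CT i" "Crd CT i s \<in> E" for s E
        using CT.Prm_Crd[OF iT that(1)] CT.Crd_Img[OF that(1)] that(2) by force
      have "openin (atlas_topology CT) (Prm CT i ` (A \<inter> Img CT i))" "openin (atlas_topology CT) (Prm CT i ` (B \<inter> Img CT i))"
        using AB CT.open_Img[OF iT] by (auto intro!: CT.openin_Prm_image[OF iT])
      moreover have "disjnt (Prm CT i ` (A \<inter> Img CT i)) (Prm CT i ` (B \<inter> Img CT i))"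
      proof -
        have "inj_on (Prm CT i) (Img CT i)" using CT.Crd_Prm by (rule inj_on_inverseI)
        then show ?thesis using AB(5) unfolding disjnt_def inj_on_def by blast
      qed
      ultimately show ?thesis using mem[OF qi(1) AB(3)] mem[OF qi(2) AB(4)] by blast
    qed
  qed
  moreover have "second_countable (atlas_topology CT)"
  proof -
    obtain \<B> where \<B>: "countable \<B>" "\<And>V. V \<in> \<B> \<Longrightarrow> openin (atlas_topology N) V"
      "\<And>U x. openin (atlas_topology N) U \<Longrightarrow> x \<in> U \<Longrightarrow> \<exists>V\<in>\<B>. x \<in> V \<and> V \<subseteq> U"
      using C2 unfolding second_countable_def by metis
    \<comment> \<open>The atlas may have uncountably many charts. Selecting one chart for each basic
      open set that fits into some chart domain leaves only countably many.\<close>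
    define \<iota> where "\<iota> b = (SOME i. i \<in> Idx N \<and> b \<subseteq> Dom N i)" for b
    define \<B>' where "\<B>' = {b \<in> \<B>. \<exists>i\<in>Idx N. b \<subseteq> Dom N i}"
    have \<iota>: "\<iota> b \<in> Idx N" "b \<subseteq> Dom N (\<iota> b)" if "b \<in> \<B>'" for b
      using someI_ex[of "\<lambda>i. i \<in> Idx N \<and> b \<subseteq> Dom N i"] that by (auto simp: \<iota>_def \<B>'_def)
    obtain \<E> :: "('e \<times> 'e) set set" where \<E>: "countable \<E>" "topological_basis \<E>"
      using ex_countable_basis by blast
    define \<C> where "\<C> = (\<lambda>(b, e). Prm CT (\<iota> b) ` (e \<inter> Img CT (\<iota> b))) ` (\<B>' \<times> \<E>)"
    have ct: "countable \<C>" unfolding \<C>_def using \<B>(1) \<E>(1) by (intro countable_image countable_SIGMA) (auto simp: \<B>'_def)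
    have op: "openin (atlas_topology CT) V" if V: "V \<in> \<C>" for V
    proof -
      obtain b e where be: "b \<in> \<B>'" "e \<in> \<E>" "V = Prm CT (\<iota> b) ` (e \<inter> Img CT (\<iota> b))"
        using V unfolding \<C>_def by auto
      have iT: "\<iota> b \<in> Idx CT" using \<iota>(1)[OF be(1)] by simp
      have "open (e \<inter> Img CT (\<iota> b))"
        using topological_basis_open[OF \<E>(2) be(2)] CT.open_Img[OF iT] by (rule open_Int)
      from CT.openin_Prm_image[OF iT this Int_lower2] show ?thesis unfolding be(3) .
    qed
    have nb: "\<exists>V\<in>\<C>. q \<in> V \<and> V \<subseteq> U" if U: "openin (atlas_topology CT) U" "q \<in> U" for U q
    proof -
      obtain x \<omega> where q: "q = (x, \<omega>)" by (cases q)
      have qc: "q \<in> carrier CT" using U CT.openin_atlas_topology by blast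
      then have x: "x \<in> carrier N" "\<omega> \<in> cotangent_space N x" by (auto simp: q CT_carrier)
      obtain j where j: "j \<in> Idx N" "x \<in> Dom N j" using x by (auto simp: carrier_def)
      obtain b where b: "b \<in> \<B>" "x \<in> b" "b \<subseteq> Dom N j" using \<B>(3)[OF openin_Dom[OF j(1)] j(2)] by blast
      have b': "b \<in> \<B>'" unfolding \<B>'_def using b j by blast
      define i where "i = \<iota> b"
      have i: "i \<in> Idx N" "x \<in> Dom N i" using \<iota>[OF b'] b by (auto simp: i_def)
      have iT: "i \<in> Idx CT" and qD: "q \<in> Dom CT i" using i x by (auto simp: q)
      have "open (Crd CT i ` (U \<inter> Dom CT i))" using U(1) iT unfolding CT.openin_atlas_topology by blast
      then obtain e where e: "e \<in> \<E>" "Crd CT i q \<in> e" "e \<subseteq> Crd CT i ` (U \<inter> Dom CT i)"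
        using topological_basisE[OF \<E>(2)] U(2) qD by (metis IntI imageI)
      have "q \<in> Prm CT i ` (e \<inter> Img CT i)"
        using CT.Prm_Crd[OF iT qD] CT.Crd_Img[OF qD] e(2) by force
      moreover have "Prm CT i ` (e \<inter> Img CT i) \<subseteq> U"
        using e(3) CT.Prm_Crd[OF iT] by force
      moreover have "Prm CT i ` (e \<inter> Img CT i) \<in> \<C>"
        unfolding \<C>_def i_def using b' e(1) by blast
      ultimately show ?thesis by (intro bexI[of _ "Prm CT i ` (e \<inter> Img CT i)"] conjI)
    qed
    show ?thesis unfolding second_countable_def by (intro exI[of _ \<C>]) (simp add: ct op nb)
  qed
  ultimately show "smooth_manifold CT" using ne CT.atlas by (simp add: smooth_manifold_def)
qed

subsection \<open>Levi-Civita connections and closed forms in charts\<close>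

text \<open>For fields with constant components near the point, metric compatibility expresses the
  derivative of \<open>g\<close> through two coefficients of the connection. Three such identities
  and the symmetry of \<open>\<Gamma>\<close> combine to Koszul's formula.\<close>

lemma levi_civita_koszul:
  assumes g: "bform_field N g" and D: "levi_civita_connection N g D"
    and sym: "\<And>u v. bform_crd N i g y u v = bform_crd N i g y v u"
    and \<Gamma>: "connection_coeffs D i \<Gamma>" and i: "i \<in> Idx N" and y: "y \<in> Img N i"
  shows "2 * bform_crd N i g y (\<Gamma> y u v) w = koszul (bform_crd N i g) y u v w"
proof -
  let ?G = "bform_crd N i g"
  define p where "p = Prm N i y"
  have p: "p \<in> Dom N i" "Crd N i p = y" using Prm_Dom[OF y] Crd_Prm[OF y] by (simp_all add: p_def)
  have ip: "i \<in> charts_at N p" using i p by (simp add: charts_at_iff)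
  note pc = Dom_carrier[OF i p(1)]
  have lin: "linear_connection N D" and tf: "torsion_free N D"
    using D by (auto simp: levi_civita_connection_def)
  have compat: "fd (\<lambda>z. ?G z b c) y a = ?G y (\<Gamma> y a b) c + ?G y b (\<Gamma> y a c)" for a b c
  proof -
    have vt: "chart_vec N i p a \<in> tangent_space N p" by (rule chart_vec_tangent[OF ip])
    obtain Y V where Y: "Y \<in> vector_fields N" "open V" "y \<in> V" "V \<subseteq> Img N i" "\<And>y. y \<in> V \<Longrightarrow> vfield_crd N i Y y = b"
      using locally_constant_vfield[OF i p(1)] unfolding p(2) by metis
    obtain Z W where Z: "Z \<in> vector_fields N" "open W" "y \<in> W" "W \<subseteq> Img N i" "\<And>y. y \<in> W \<Longrightarrow> vfield_crd N i Z y = c"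
      using locally_constant_vfield[OF i p(1)] unfolding p(2) by metis
    have comp: "Y p i = b" "Z p i = c" using Y(3,5) Z(3,5) by (simp_all add: vfield_crd_def p_def)
    have d0: "fd (vfield_crd N i Y) y a = 0" "fd (vfield_crd N i Z) y a = 0"
      using fd_cong_open[OF Y(2,3), of "vfield_crd N i Y" "\<lambda>_. b"] fd_cong_open[OF Z(2,3), of "vfield_crd N i Z" "\<lambda>_. c"]
        Y(5) Z(5) by (simp_all add: frechet_derivative_const)
    have DY: "D p (chart_vec N i p a) Y i = \<Gamma> y a b" "D p (chart_vec N i p a) Z i = \<Gamma> y a c"
      using \<Gamma> p vt Y(1) Z(1) d0 comp by (auto simp: connection_coeffs_def chart_vec_self[OF ip])
    let ?f = "\<lambda>q. g q (Y q) (Z q)"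
    have eq: "(?f \<circ> Prm N i) z = ?G z b c" if z: "z \<in> V \<inter> W" for z
    proof -
      have zi: "z \<in> Img N i" using z Y(4) by blast
      have iz: "i \<in> charts_at N (Prm N i z)" using i zi by (simp add: charts_at_iff Prm_Dom)
      show ?thesis
        using bform_chart[OF iz vfield_tangent[OF Y(1) Prm_carrier[OF i zi]] vfield_tangent[OF Z(1) Prm_carrier[OF i zi]], of g]
          z Y(5)[of z] Z(5)[of z] Crd_Prm[OF zi] by (simp add: vfield_crd_def)
    qed
    have VW: "open (V \<inter> W)" "y \<in> V \<inter> W" using Y Z by auto
    have "(?f \<circ> Prm N i) differentiable at y"
      using differentiable_cong_open[of "V \<inter> W" y "?f \<circ> Prm N i" "\<lambda>z. ?G z b c", OF VW eq] smooth_on_differentiable[OF bform_crd_smooth[OF g i, of b c] y] by simp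
    then have "dir_deriv N p (chart_vec N i p a) ?f = fd (\<lambda>z. ?G z b c) y a"
      using dir_deriv_eq[OF ip vt, of ?f] fd_cong_open[of "V \<inter> W" y "?f \<circ> Prm N i" "\<lambda>z. ?G z b c", OF VW eq] by (simp add: p chart_vec_self[OF ip])
    moreover have "dir_deriv N p (chart_vec N i p a) ?f
        = g p (D p (chart_vec N i p a) Y) (Z p) + g p (Y p) (D p (chart_vec N i p a) Z)"
      using D pc vt Y(1) Z(1) by (simp add: levi_civita_connection_def)
    ultimately show ?thesis
      using bform_chart[OF ip connection_tangent[OF lin Y(1) pc vt] vfield_tangent[OF Z(1) pc], of g]
        bform_chart[OF ip vfield_tangent[OF Y(1) pc] connection_tangent[OF lin Z(1) pc vt], of g]
      by (simp add: DY comp p)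
  qed
  show ?thesis
    unfolding koszul_def compat
    using connection_coeffs_symmetric[OF tf \<Gamma> i y] sym by (simp add: sym[of "\<Gamma> y _ _"])
qed

text \<open>The coefficients of the form contribute no derivatives, and those of the components of
  \<open>X\<close>, \<open>Y\<close>, \<open>Z\<close> cancel against the bracket terms by
  skew-symmetry.\<close>

lemma ext_deriv2_constant_coeffs:
  assumes A: "bilinear A" "\<And>u v. A u v = - A v u"
    and O: "\<And>q u v. q \<in> Dom N i \<Longrightarrow> u \<in> tangent_space N q \<Longrightarrow> v \<in> tangent_space N q \<Longrightarrow> \<Omega> q u v = A (u i) (v i)"
    and i: "i \<in> charts_at N p"
    and X: "X \<in> vector_fields N" and Y: "Y \<in> vector_fields N" and Z: "Z \<in> vector_fields N"
  shows "ext_deriv2 N \<Omega> X Y Z p = 0"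
proof -
  have ip: "i \<in> Idx N" "p \<in> Dom N i" using i by (auto simp: charts_at_iff)
  note pc = Dom_carrier[OF ip]
  let ?y = "Crd N i p" and ?d = "\<lambda>V. fd (vfield_crd N i V) (Crd N i p)"
  note y = Crd_Img[OF ip(2)]
  have b: "bounded_bilinear A" using A(1) bilinear_conv_bounded_bilinear by blast
  have dd: "dir_deriv N p v (\<lambda>q. \<Omega> q (V q) (W q)) = A (V p i) (?d W (v i)) + A (?d V (v i)) (W p i)"
    if V: "V \<in> vector_fields N" and W: "W \<in> vector_fields N" and v: "v \<in> tangent_space N p" for V W v
  proof -
    let ?f = "(\<lambda>q. \<Omega> q (V q) (W q)) \<circ> Prm N i" and ?h = "\<lambda>z. A (vfield_crd N i V z) (vfield_crd N i W z)"
    have eq: "?f z = A (vfield_crd N i V z) (vfield_crd N i W z)" if "z \<in> Img N i" for z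
      using O[OF Prm_Dom[OF that] vfield_tangent[OF V Prm_carrier[OF ip(1) that]] vfield_tangent[OF W Prm_carrier[OF ip(1) that]]]
      by (simp add: vfield_crd_def)
    have D: "((\<lambda>z. A (vfield_crd N i V z) (vfield_crd N i W z)) has_derivative
        (\<lambda>h. A (vfield_crd N i V ?y) (?d W h) + A (?d V h) (vfield_crd N i W ?y))) (at ?y)"
      by (rule bounded_bilinear.FDERIV[OF b]) (intro smooth_on_has_derivative[OF vfield_smooth] V W ip(1) y)+
    have "?h differentiable at ?y" using D unfolding differentiable_def by blast
    then have "?f differentiable at ?y"
      using differentiable_cong_open[of "Img N i" ?y ?f ?h, OF open_Img[OF ip(1)] y eq] by simp
    then show ?thesis
      using dir_deriv_eq[OF i v, of "\<lambda>q. \<Omega> q (V q) (W q)"]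
        fd_cong_open[of "Img N i" ?y ?f ?h, OF open_Img[OF ip(1)] y eq] fd_eqI[OF D]
      by (simp add: vfield_crd_def Prm_Crd ip)
  qed
  have br: "\<Omega> p (bracket N V W p) (U p) = A (?d W (V p i) - ?d V (W p i)) (U p i)"
    if "V \<in> vector_fields N" "W \<in> vector_fields N" "U \<in> vector_fields N" for U V W
    using O[OF ip(2) bracket_tangent[OF that(1,2) pc] vfield_tangent[OF that(3) pc]] i by (simp add: bracket_def)
  note t = vfield_tangent[OF X pc] vfield_tangent[OF Y pc] vfield_tangent[OF Z pc]
  show ?thesis
    unfolding ext_deriv2_def dd[OF Y Z t(1)] dd[OF X Z t(2)] dd[OF X Y t(3)] br[OF X Y Z] br[OF X Z Y] br[OF Y Z X]
      bilinear_lsub[OF A(1)]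
    using A(2)[of "X p i"] A(2)[of "Y p i"] by simp
qed

end

subsection \<open>The local model of a natural Riemann extension\<close>

text \<open>Only the block shape of the metric enters here: \<open>S\<close> is an arbitrary smooth
  family of symmetric forms on the base directions, which may vary with the fibre coordinate. Its
  expression through the connection is used outside the model.\<close>

locale riemann_model =
  fixes a :: real and S :: "'e::euclidean_space \<times> 'e \<Rightarrow> 'e \<Rightarrow> 'e \<Rightarrow> real" and Q :: "('e \<times> 'e) set"
  assumes a: "a > 0" and Q: "open Q"
    and bil: "q \<in> Q \<Longrightarrow> bilinear (S q)" and sym: "q \<in> Q \<Longrightarrow> S q u v = S q v u"
    and smooth: "smooth_on (\<lambda>q. S q u v) Q"
begin

definition G :: "'e \<times> 'e \<Rightarrow> 'e \<times> 'e \<Rightarrow> 'e \<times> 'e \<Rightarrow> real" where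
  "G q \<xi> \<eta> = a * (snd \<xi> \<bullet> fst \<eta> + snd \<eta> \<bullet> fst \<xi>) + S q (fst \<xi>) (fst \<eta>)"

definition sv :: "'e \<times> 'e \<Rightarrow> 'e \<Rightarrow> 'e" where
  "sv q u = (\<Sum>c\<in>Basis. S q u c *\<^sub>R c)"

definition Pm :: "'e \<times> 'e \<Rightarrow> 'e \<times> 'e \<Rightarrow> 'e \<times> 'e" where
  "Pm q \<xi> = (fst \<xi>, - (1 / a) *\<^sub>R sv q (fst \<xi>) - snd \<xi>)"

lemma sv_inner: "q \<in> Q \<Longrightarrow> sv q u \<bullet> v = S q u v"
proof -
  assume q: "q \<in> Q"
  have "S q u v = (\<Sum>c\<in>Basis. (v \<bullet> c) *\<^sub>R S q u c)"
    by (rule linear_sum_Basis[OF bilinear_linear_right[OF bil[OF q]]])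
  then show ?thesis unfolding sv_def inner_sum_left by (simp add: inner_commute[of v] mult.commute)
qed

lemma linear_sv: "q \<in> Q \<Longrightarrow> linear (sv q)"
  by (rule linearI)
     (simp_all add: sv_def bilinear_ladd[OF bil] bilinear_lmul[OF bil] scaleR_add_left sum.distrib scaleR_sum_right)

lemma G_bilinear: "q \<in> Q \<Longrightarrow> bilinear (G q)"
  unfolding bilinear_def
  by (auto intro!: linearI simp: G_def inner_add_left inner_add_right algebra_simps
      bilinear_ladd[OF bil] bilinear_lmul[OF bil] bilinear_radd[OF bil] bilinear_rmul[OF bil])

lemma G_symmetric: "q \<in> Q \<Longrightarrow> G q \<xi> \<eta> = G q \<eta> \<xi>"
  using sym[of q "fst \<xi>" "fst \<eta>"] by (simp add: G_def)

lemma G_nondegenerate: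
  assumes q: "q \<in> Q" shows "nondegenerate (G q)"
  unfolding nondegenerate_def
proof (intro allI impI)
  fix z assume z: "\<forall>v. G q z v = 0"
  have "v \<bullet> fst z = 0" for v
    using z[rule_format, of "(0, v)"] a by (simp add: G_def bilinear_rzero[OF bil[OF q]])
  then have f: "fst z = 0" by (metis inner_eq_zero_iff)
  have "snd z \<bullet> v = 0" for v
    using z[rule_format, of "(v, 0)"] a by (simp add: G_def f bilinear_lzero[OF bil[OF q]])
  then have "snd z = 0" by (metis inner_eq_zero_iff)
  with f show "z = 0" by (simp add: prod_eq_iff)
qed

lemma Pm_Pm: "q \<in> Q \<Longrightarrow> Pm q (Pm q \<xi>) = \<xi>"
  by (simp add: Pm_def)

text \<open>The term \<open>- S / a\<close> inside \<open>Pm\<close> pairs with the base part to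
  cancel the \<open>S\<close> in the metric. What is left has constant coefficients.\<close>

lemma G_Pm: "q \<in> Q \<Longrightarrow> G q \<xi> (Pm q \<eta>) = a * (snd \<xi> \<bullet> fst \<eta> - snd \<eta> \<bullet> fst \<xi>)"
  using a sym[of q "fst \<xi>" "fst \<eta>"] by (simp add: G_def Pm_def inner_diff_left sv_inner algebra_simps)

lemma G_Pm_Pm: "q \<in> Q \<Longrightarrow> G q (Pm q \<xi>) (Pm q \<eta>) = - G q \<xi> \<eta>"
  unfolding G_Pm using a sym[of q "fst \<xi>" "fst \<eta>"]
  by (simp add: G_def Pm_def inner_diff_left sv_inner field_simps)

abbreviation dS :: "'e \<times> 'e \<Rightarrow> 'e \<times> 'e \<Rightarrow> 'e \<Rightarrow> 'e \<Rightarrow> real" where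
  "dS q d u v \<equiv> fd (\<lambda>z. S z u v) q d"

lemma S_diff: "q \<in> Q \<Longrightarrow> (\<lambda>z. S z u v) differentiable at q"
  by (rule smooth_on_differentiable[OF smooth])

lemma S_has_derivative: "q \<in> Q \<Longrightarrow> ((\<lambda>z. S z u v) has_derivative (\<lambda>d. dS q d u v)) (at q)"
  using smooth_on_has_derivative[OF smooth] by blast

lemma dS_linear:
  assumes q: "q \<in> Q"
  shows "linear (\<lambda>d. dS q d u v)" "linear (\<lambda>u. dS q d u v)" "linear (\<lambda>v. dS q d u v)"
  using linear_fd[OF S_diff[OF q, of u v]]
    linear_fd_family[OF Q q bilinear_linear_left[OF bil] S_diff[OF q], of v d]
    linear_fd_family[OF Q q bilinear_linear_right[OF bil] S_diff[OF q], of u d] by simp_all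

lemma fd_G: "q \<in> Q \<Longrightarrow> fd (\<lambda>z. G z \<xi> \<eta>) q d = dS q d (fst \<xi>) (fst \<eta>)"
proof -
  assume q: "q \<in> Q"
  have "((\<lambda>z. G z \<xi> \<eta>) has_derivative (\<lambda>d. 0 + dS q d (fst \<xi>) (fst \<eta>))) (at q)"
    unfolding G_def by (intro has_derivative_add has_derivative_const S_has_derivative q)
  from fd_eqI[OF this] show ?thesis by simp
qed

lemma G_smooth: "smooth_on (\<lambda>z. G z \<xi> \<eta>) Q"
  unfolding G_def by (intro smooth_on_add Q smooth_on_const smooth)

lemma fd_Pm: "q \<in> Q \<Longrightarrow> fd (\<lambda>z. Pm z \<xi>) q d = (0, - (1 / a) *\<^sub>R (\<Sum>c\<in>Basis. dS q d (fst \<xi>) c *\<^sub>R c))"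
proof -
  assume q: "q \<in> Q"
  have "((\<lambda>z. Pm z \<xi>) has_derivative (\<lambda>d. (0, - (1 / a) *\<^sub>R (\<Sum>c\<in>Basis. dS q d (fst \<xi>) c *\<^sub>R c) - 0))) (at q)"
    unfolding Pm_def sv_def
    by (intro has_derivative_Pair has_derivative_const has_derivative_diff has_derivative_scaleR_right
        has_derivative_sum has_derivative_scaleR_left S_has_derivative q)
  from fd_eqI[OF this] show ?thesis by simp
qed

text \<open>\<open>Z1\<close> and \<open>Z2\<close> are the Christoffel vectors \<open>\<Gamma>(\<xi>, \<eta>)\<close> and \<open>\<Gamma>(\<xi>, P \<eta>)\<close>, so the left-hand side is
  \<open>(\<nabla>\<^sub>\<xi> P) \<eta>\<close>; it is vertical and depends only on the base components of \<open>\<xi>\<close> and \<open>\<eta>\<close>.\<close>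

lemma nabla_Pm:
  assumes q: "q \<in> Q"
    and Z1: "\<And>r. 2 * G q Z1 r = koszul G q \<xi> \<eta> r"
    and Z2: "\<And>r. 2 * G q Z2 r = koszul G q \<xi> (Pm q \<eta>) r"
  shows "fd (\<lambda>z. Pm z \<eta>) q \<xi> + Z2 - Pm q Z1 = (0, (1 / a) *\<^sub>R
    (\<Sum>c\<in>Basis. (dS q (fst \<eta>, - (1 / (2 * a)) *\<^sub>R sv q (fst \<eta>)) (fst \<xi>) c
               - dS q (c, - (1 / (2 * a)) *\<^sub>R sv q c) (fst \<xi>) (fst \<eta>)) *\<^sub>R c))"
proof -
  obtain u \<theta> where \<xi>: "\<xi> = (u, \<theta>)" by (cases \<xi>)
  obtain v \<tau> where \<eta>: "\<eta> = (v, \<tau>)" by (cases \<eta>)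
  obtain m \<mu> where m: "Z1 = (m, \<mu>)" by (cases Z1)
  obtain m' \<mu>' where m': "Z2 = (m', \<mu>')" by (cases Z2)
  note z = linear_0[OF dS_linear(2)[OF q]] linear_0[OF dS_linear(3)[OF q]] bilinear_rzero[OF bil[OF q]]
  have K: "koszul G q (u, \<theta>) (v, \<tau>') (w, \<zeta>) = dS q (u, \<theta>) v w + dS q (v, \<tau>') u w - dS q (w, \<zeta>) u v" for \<tau>' w \<zeta>
    by (simp add: koszul_def fd_G[OF q])
  \<comment> \<open>A vertical test vector isolates the horizontal part of a Christoffel vector. The
    result involves only the base parts \<open>u\<close> and \<open>v\<close>, so \<open>vm'\<close>
    has the same right-hand side.\<close>
  have vm: "2 * a * (\<zeta> \<bullet> m) = - dS q (0, \<zeta>) u v" for \<zeta>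
    using Z1[of "(0, \<zeta>)"] by (simp add: \<xi> \<eta> m K z G_def)
  have vm': "2 * a * (\<zeta> \<bullet> m') = - dS q (0, \<zeta>) u v" for \<zeta>
    using Z2[of "(0, \<zeta>)"] by (simp add: \<xi> \<eta> m' K z G_def Pm_def)
  have "m = m'"
  proof (rule euclidean_eqI)
    fix c :: 'e
    have "2 * a * (c \<bullet> m) = 2 * a * (c \<bullet> m')" using vm vm' by simp
    then show "m \<bullet> c = m' \<bullet> c" using a by (simp add: inner_commute)
  qed
  have h1: "2 * a * (\<mu> \<bullet> w) + 2 * S q m w = dS q (u, \<theta>) v w + dS q (v, \<tau>) u w - dS q (w, 0) u v" for w
    using Z1[of "(w, 0)"] by (simp add: \<xi> \<eta> m K G_def)
  have h2: "2 * a * (\<mu>' \<bullet> w) + 2 * S q m w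
      = dS q (u, \<theta>) v w + dS q (v, - (1 / a) *\<^sub>R sv q v - \<tau>) u w - dS q (w, 0) u v" for w
    using Z2[of "(w, 0)"] by (simp add: \<xi> \<eta> m' K G_def Pm_def \<open>m = m'\<close>)
  \<comment> \<open>Half the sum of \<open>h1\<close> and \<open>h2\<close>, in which
    \<open>\<tau>\<close> cancels and the mean of \<open>(v, \<tau>)\<close> and
    \<open>Pm q (v, \<tau>)\<close> appears as direction. One copy of \<open>S q m w\<close> is then
    traded, by \<open>vm\<close> at \<open>sv q w\<close>, for a vertical derivative of
    \<open>S\<close>.\<close>
  have key: "- dS q (u, \<theta>) v w + a * (\<mu>' \<bullet> w) + S q m w + a * (\<mu> \<bullet> w)
      = dS q (v, - (1 / (2 * a)) *\<^sub>R sv q v) u w - dS q (w, - (1 / (2 * a)) *\<^sub>R sv q w) u v" for w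
  proof -
    note l = dS_linear(1)[OF q, of u w] and l' = dS_linear(1)[OF q, of u v]
    have d1: "dS q (v, \<tau>) u w + dS q (v, - (1 / a) *\<^sub>R sv q v - \<tau>) u w = 2 * dS q (v, - (1 / (2 * a)) *\<^sub>R sv q v) u w"
      using linear_add[OF l, of "(v, \<tau>)" "(v, - (1 / a) *\<^sub>R sv q v - \<tau>)"]
        linear_scale[OF l, of 2 "(v, - (1 / (2 * a)) *\<^sub>R sv q v)"]
      by (simp add: scaleR_2)
    have d2: "dS q (w, - (1 / (2 * a)) *\<^sub>R sv q w) u v = dS q (w, 0) u v - 1 / (2 * a) * dS q (0, sv q w) u v"
      using linear_add[OF l', of "(w, 0)" "(0, - (1 / (2 * a)) *\<^sub>R sv q w)"]
        linear_scale[OF l', of "- (1 / (2 * a))" "(0, sv q w)"] by simp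
    have "dS q (0, sv q w) u v = - (2 * a * S q m w)"
      using vm[of "sv q w"] sv_inner[OF q, of w m] sym[OF q, of w m] by simp
    then have "1 / (2 * a) * dS q (0, sv q w) u v = - S q m w" using a by simp
    then show ?thesis using h1[of w] h2[of w] d1 d2 by linarith
  qed
  have fst: "fst (fd (\<lambda>z. Pm z \<eta>) q \<xi> + Z2 - Pm q Z1) = 0"
    unfolding fd_Pm[OF q] by (simp add: Pm_def m m' \<open>m = m'\<close>)
  have "snd (fd (\<lambda>z. Pm z \<eta>) q \<xi> + Z2 - Pm q Z1) = (1 / a) *\<^sub>R
    (\<Sum>c\<in>Basis. (dS q (v, - (1 / (2 * a)) *\<^sub>R sv q v) u c - dS q (c, - (1 / (2 * a)) *\<^sub>R sv q c) u v) *\<^sub>R c)"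
    (is "?L = _")
  proof (rule euclidean_eqI)
    fix w :: 'e assume w: "w \<in> Basis"
    have aux: "x = (1 / a) * k" if "a * x = k" for x k using that a by auto
    have "a * (?L \<bullet> w) = - dS q (u, \<theta>) v w + a * (\<mu>' \<bullet> w) + S q m w + a * (\<mu> \<bullet> w)"
      using a w unfolding fd_Pm[OF q] by (simp add: Pm_def m m' \<open>m = m'\<close> \<xi> \<eta> inner_add_left inner_diff_left sv_inner[OF q] algebra_simps)
    also note key
    finally have "?L \<bullet> w = (1 / a) * (dS q (v, - (1 / (2 * a)) *\<^sub>R sv q v) u w - dS q (w, - (1 / (2 * a)) *\<^sub>R sv q w) u v)"
      by (rule aux)
    then show "?L \<bullet> w = ((1 / a) *\<^sub>R
      (\<Sum>c\<in>Basis. (dS q (v, - (1 / (2 * a)) *\<^sub>R sv q v) u c - dS q (c, - (1 / (2 * a)) *\<^sub>R sv q c) u v) *\<^sub>R c)) \<bullet> w"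
      using w by (simp add: inner_sum_left_Basis)
  qed
  with fst show ?thesis by (simp add: prod_eq_iff \<xi> \<eta>)
qed

text \<open>Both terms of the formula in \<open>nabla_Pm\<close> are linear in the base part of
  \<open>\<xi>\<close> and in that of \<open>\<eta>\<close>.\<close>

lemma nabla_Pm_vertical:
  assumes q: "q \<in> Q"
    and Z1: "\<And>r. 2 * G q Z1 r = koszul G q \<xi> \<eta> r"
    and Z2: "\<And>r. 2 * G q Z2 r = koszul G q \<xi> (Pm q \<eta>) r"
    and v: "fst \<xi> = 0 \<or> fst \<eta> = 0"
  shows "fd (\<lambda>z. Pm z \<eta>) q \<xi> + Z2 - Pm q Z1 = 0"
proof -
  have "dS q (0, - (1 / (2 * a)) *\<^sub>R sv q 0) u w = 0" for u w
    using linear_0[OF dS_linear(1)[OF q], of u w] linear_0[OF linear_sv[OF q]] by (simp add: zero_prod_def)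
  then show ?thesis
    unfolding nabla_Pm[OF assms(1-3)]
    using v linear_0[OF dS_linear(2)[OF q]] linear_0[OF dS_linear(3)[OF q]] by (auto simp: zero_prod_def)
qed

lemma sharp_vertical:
  assumes q: "q \<in> Q" and c: "c \<in> Basis"
  shows "fst c = 0 \<or> fst (sharp (G q) c) = 0"
proof -
  consider e where "e \<in> Basis" "c = (e, 0)" | e where "c = (0, e)" using c by (auto simp: Basis_prod_def)
  then show ?thesis
  proof cases
    case 1
    have "sharp (G q) c = (0, (1 / a) *\<^sub>R e)"
      using a by (intro sharp_eqI[OF G_bilinear[OF q] G_nondegenerate[OF q]])
        (simp add: 1 G_def bilinear_lzero[OF bil[OF q]] inner_prod_def)
    then show ?thesis by simp
  qed simp
qed

end

subsection \<open>The natural Riemann extension in charts\<close>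

locale natural_riemann = smanifold N
  for N :: "('i, 'p, 'e::euclidean_space) atlas" +
  fixes D :: "('i, 'p, 'e) conn" and a b :: real
    and g :: "('i, 'p \<times> ('i, 'e) covec, 'e \<times> 'e) bform"
    and P :: "('i, 'p \<times> ('i, 'e) covec, 'e \<times> 'e) endo"
  assumes conn: "linear_connection N D" and tf: "torsion_free N D"
    and a: "a > 0"
    and ext: "natural_riemann_extension N D a b g"
    and P: "endo_field (cotangent_bundle N) P"
    and P_complete: "\<And>X q. X \<in> vector_fields N \<Longrightarrow> q \<in> carrier (cotangent_bundle N) \<Longrightarrow>
           P q (complete_lift N X q) =
             (\<lambda>i. complete_lift N X q i + 2 *\<^sub>R contracted N (nabla_endo D X) q i
                  - ((b / a) * vlift X q) *\<^sub>R liouville N q i)"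
    and P_vertical: "\<And>\<alpha> q. \<alpha> \<in> one_forms N \<Longrightarrow> q \<in> carrier (cotangent_bundle N) \<Longrightarrow>
           P q (vlift_form N \<alpha> q) = (\<lambda>i. - vlift_form N \<alpha> q i)"
begin

sublocale CT: smanifold CT by (rule CT_smanifold)

definition \<Gamma> :: "'i \<Rightarrow> 'e \<Rightarrow> 'e \<Rightarrow> 'e \<Rightarrow> 'e" where
  "\<Gamma> i = (SOME G. connection_coeffs D i G)"

lemma \<Gamma>: "i \<in> Idx N \<Longrightarrow> connection_coeffs D i (\<Gamma> i)"
  unfolding \<Gamma>_def using connection_coeffs_exist[OF conn] by (metis someI_ex)

lemma \<Gamma>_sym: "i \<in> Idx N \<Longrightarrow> y \<in> Img N i \<Longrightarrow> \<Gamma> i y u v = \<Gamma> i y v u"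
  by (rule connection_coeffs_symmetric[OF tf \<Gamma>])

lemma \<Gamma>_bilinear: "i \<in> Idx N \<Longrightarrow> y \<in> Img N i \<Longrightarrow> bilinear (\<Gamma> i y)"
  using \<Gamma> unfolding connection_coeffs_def by blast

definition S :: "'i \<Rightarrow> 'e \<times> 'e \<Rightarrow> 'e \<Rightarrow> 'e \<Rightarrow> real" where
  "S i q u v = - 2 * a * (snd q \<bullet> \<Gamma> i (fst q) u v) + b * (snd q \<bullet> u) * (snd q \<bullet> v)"

lemma g_bform: "bform_field CT g"
  and g_sym: "\<And>p u v. p \<in> carrier CT \<Longrightarrow> u \<in> tangent_space CT p \<Longrightarrow> v \<in> tangent_space CT p \<Longrightarrow> g p u v = g p v u"
  and g_metric: "semi_riemannian_metric CT g"
  using ext by (auto simp: natural_riemann_extension_def metric_of_signature_def semi_riemannian_metric_def)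

lemma g_complete_complete:
  assumes "(x, \<omega>) \<in> carrier CT" "X \<in> vector_fields N" "Y \<in> vector_fields N"
  shows "g (x, \<omega>) (complete_lift N X (x, \<omega>)) (complete_lift N Y (x, \<omega>)) =
             - a * \<omega> (lincomb 1 (D x (X x) Y) 1 (D x (Y x) X)) + b * \<omega> (X x) * \<omega> (Y x)"
  using ext assms unfolding natural_riemann_extension_def by blast

lemma g_complete_vertical:
  assumes "(x, \<omega>) \<in> carrier CT" "X \<in> vector_fields N" "\<alpha> \<in> one_forms N"
  shows "g (x, \<omega>) (complete_lift N X (x, \<omega>)) (vlift_form N \<alpha> (x, \<omega>)) = a * \<alpha> x (X x)"
  using ext assms unfolding natural_riemann_extension_def by blast

lemma g_vertical_vertical:
  assumes "(x, \<omega>) \<in> carrier CT" "\<alpha> \<in> one_forms N" "\<beta> \<in> one_forms N"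
  shows "g (x, \<omega>) (vlift_form N \<alpha> (x, \<omega>)) (vlift_form N \<beta> (x, \<omega>)) = 0"
  using ext assms unfolding natural_riemann_extension_def by blast

section \<open>Components of the metric and of P at a point of an induced chart\<close>

context
  fixes i y w p \<omega>
  assumes i: "i \<in> Idx N" and y: "y \<in> Img N i"
  defines "p \<equiv> Prm N i y" and "\<omega> \<equiv> covec_of i p w"
begin

lemma point:
  "i \<in> charts_at N p" "p \<in> carrier N" "Crd N i p = y" "\<omega> \<in> cotangent_space N p"
  "i \<in> charts_at CT (p, \<omega>)" "(p, \<omega>) \<in> carrier CT" "Prm CT i (y, w) = (p, \<omega>)" "covec_crd N i p \<omega> = w"
proof -
  show ip: "i \<in> charts_at N p" unfolding p_def using i y by (simp add: charts_at_iff Prm_Dom)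
  show pc: "p \<in> carrier N" unfolding p_def by (rule Prm_carrier[OF i y])
  show "Crd N i p = y" unfolding p_def by (rule Crd_Prm[OF y])
  show w: "\<omega> \<in> cotangent_space N p" unfolding \<omega>_def by (rule covec_of_cotangent)
  show "i \<in> charts_at CT (p, \<omega>)" using ip w by (simp add: CT_charts_at)
  show "(p, \<omega>) \<in> carrier CT" using pc w by (simp add: CT_carrier)
  show "Prm CT i (y, w) = (p, \<omega>)" unfolding p_def \<omega>_def by (rule CT_Prm[OF i y])
  show "covec_crd N i p \<omega> = w" unfolding \<omega>_def by (rule covec_crd_of[OF ip])
qed

text \<open>Complete lifts of fields with vanishing first derivatives realise the coordinate vectors
  \<open>(u, 0)\<close>. The prescriptions for complete lifts thus determine the components of
  \<open>g\<close> and \<open>P\<close>.\<close>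

lemma horizontal_field:
  obtains X where "X \<in> vector_fields N" "X p = chart_vec N i p u"
    "complete_lift N X (p, \<omega>) = chart_vec CT i (p, \<omega>) (u, 0)"
    "\<And>v. D p (chart_vec N i p v) X i = \<Gamma> i y v u"
proof -
  obtain X where X: "X \<in> vector_fields N" "X p = chart_vec N i p u" "fd (vfield_crd N i X) (Crd N i p) = (\<lambda>_. 0)"
    using vfield_through[OF chart_vec_tangent[OF point(1)] point(1)] by blast
  have "D p (chart_vec N i p v) X i = \<Gamma> i y v u" for v
    using \<Gamma>[OF i] X chart_vec_tangent[OF point(1)] point(1,3)
    by (auto simp: connection_coeffs_def chart_vec_self[OF point(1)] charts_at_iff)
  then show ?thesis
    using that[OF X(1,2)] complete_lift_chart_vec[OF X(1) point(1,4) X(3)] X(2) by (simp add: chart_vec_self[OF point(1)])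
qed

lemma vertical_form:
  obtains \<alpha> where "\<alpha> \<in> one_forms N" "\<And>v. v \<in> tangent_space N p \<Longrightarrow> \<alpha> p v = \<theta> \<bullet> v i"
    "vlift_form N \<alpha> (p, \<omega>) = chart_vec CT i (p, \<omega>) (0, \<theta>)"
proof -
  have pD: "p \<in> Dom N i" using point(1) by (simp add: charts_at_iff)
  obtain \<alpha> where \<alpha>: "\<alpha> \<in> one_forms N" "\<And>v. v \<in> tangent_space N p \<Longrightarrow> \<alpha> p v = \<theta> \<bullet> v i"
    using one_form_through[OF i pD] by blast
  have c: "\<alpha> p \<in> cotangent_space N p" using \<alpha>(1) point(2) by (simp add: one_forms_def)
  have "covec_crd N i p (\<alpha> p) = \<theta>"
    by (simp add: covec_crd_def \<alpha>(2)[OF chart_vec_tangent[OF point(1)]] chart_vec_self[OF point(1)] euclidean_representation)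
  then show ?thesis
    using that[OF \<alpha>] vertical_chart_vec[OF c point(1,4)] by (simp add: vlift_form_def)
qed

lemma omega_eval: "v \<in> tangent_space N p \<Longrightarrow> \<omega> v = w \<bullet> v i"
  using covec_eval[OF point(4) _ point(1)] point(8) by simp

lemma CT_y: "(y, w) \<in> Img CT i" "i \<in> Idx CT"
  using i y by (simp_all add: CT_Img)

lemma g_crd: "bform_crd CT i g (y, w) (u, \<theta>) (v, \<tau>) = a * (\<theta> \<bullet> v + \<tau> \<bullet> u) + S i (y, w) u v"
proof -
  let ?B = "bform_crd CT i g (y, w)"
  have B: "?B s t = g (p, \<omega>) (chart_vec CT i (p, \<omega>) s) (chart_vec CT i (p, \<omega>) t)" for s t
    unfolding bform_crd_def point(7) ..
  note bilB = CT.bform_crd_bilinear[OF g_bform CT_y(2,1)]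
  obtain X where X: "X \<in> vector_fields N" "X p = chart_vec N i p u"
    "complete_lift N X (p, \<omega>) = chart_vec CT i (p, \<omega>) (u, 0)" "\<And>v. D p (chart_vec N i p v) X i = \<Gamma> i y v u"
    using horizontal_field[of u] by blast
  obtain Y where Y: "Y \<in> vector_fields N" "Y p = chart_vec N i p v"
    "complete_lift N Y (p, \<omega>) = chart_vec CT i (p, \<omega>) (v, 0)" "\<And>u. D p (chart_vec N i p u) Y i = \<Gamma> i y u v"
    using horizontal_field[of v] by blast
  obtain \<alpha> where \<alpha>: "\<alpha> \<in> one_forms N" "\<And>v. v \<in> tangent_space N p \<Longrightarrow> \<alpha> p v = \<theta> \<bullet> v i"
    "vlift_form N \<alpha> (p, \<omega>) = chart_vec CT i (p, \<omega>) (0, \<theta>)" using vertical_form[of \<theta>] by blast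
  obtain \<beta> where \<beta>: "\<beta> \<in> one_forms N" "\<And>v. v \<in> tangent_space N p \<Longrightarrow> \<beta> p v = \<tau> \<bullet> v i"
    "vlift_form N \<beta> (p, \<omega>) = chart_vec CT i (p, \<omega>) (0, \<tau>)" using vertical_form[of \<tau>] by blast
  note ct = chart_vec_tangent[OF point(1)] and cs = chart_vec_self[OF point(1)]
  \<comment> \<open>Symmetry of \<open>\<Gamma>\<close> merges the two covariant derivatives; this
    is the factor 2 in \<open>S\<close>.\<close>
  have DD: "\<omega> (lincomb 1 (D p (X p) Y) 1 (D p (Y p) X)) = 2 * (w \<bullet> \<Gamma> i y u v)"
    using X(2,4) Y(2,4) \<Gamma>_sym[OF i y, of v u]
      omega_eval[OF lincomb_tangent[OF connection_tangent[OF conn Y(1) point(2) ct] connection_tangent[OF conn X(1) point(2) ct]], of 1 u 1 v]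
    by (simp add: lincomb_apply inner_add_right)
  have "?B (u, 0) (v, 0) = S i (y, w) u v"
    unfolding B X(3)[symmetric] Y(3)[symmetric] g_complete_complete[OF point(6) X(1) Y(1)] DD
    by (simp add: S_def X(2) Y(2) omega_eval[OF ct] cs)
  moreover have "?B (u, 0) (0, \<tau>) = a * (\<tau> \<bullet> u)"
    unfolding B X(3)[symmetric] \<beta>(3)[symmetric] g_complete_vertical[OF point(6) X(1) \<beta>(1)]
    by (simp add: X(2) \<beta>(2)[OF ct] cs)
  \<comment> \<open>The definition of the extension prescribes this pairing in the other order only,
    so symmetry of \<open>g\<close> is invoked.\<close>
  moreover have "?B (0, \<theta>) (v, 0) = a * (\<theta> \<bullet> v)"
  proof -
    have "?B (0, \<theta>) (v, 0) = ?B (v, 0) (0, \<theta>)"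
      unfolding B by (rule g_sym[OF point(6) CT.chart_vec_tangent[OF point(5)] CT.chart_vec_tangent[OF point(5)]])
    also have "\<dots> = a * \<alpha> p (Y p)"
      unfolding B Y(3)[symmetric] \<alpha>(3)[symmetric] by (rule g_complete_vertical[OF point(6) Y(1) \<alpha>(1)])
    finally show ?thesis by (simp add: Y(2) \<alpha>(2)[OF ct] cs)
  qed
  moreover have "?B (0, \<theta>) (0, \<tau>) = 0"
    unfolding B \<alpha>(3)[symmetric] \<beta>(3)[symmetric] by (rule g_vertical_vertical[OF point(6) \<alpha>(1) \<beta>(1)])
  moreover have "?B (u, \<theta>) (v, \<tau>) = ?B (u, 0) (v, 0) + ?B (u, 0) (0, \<tau>) + (?B (0, \<theta>) (v, 0) + ?B (0, \<theta>) (0, \<tau>))"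
    unfolding bilinear_radd[OF bilB, symmetric] bilinear_ladd[OF bilB, symmetric] by simp
  ultimately show ?thesis by (simp add: algebra_simps)
qed

text \<open>On \<open>(u, 0)\<close> the contracted field and the multiple of the Liouville field
  add up to \<open>- S(u, c) / a\<close> in every basis direction \<open>c\<close>. Since
  \<open>C(\<nabla>X)\<close> contains \<open>\<Gamma>(c, u)\<close>, the symmetry of
  \<open>\<Gamma>\<close> enters.\<close>

lemma P_crd:
  "CT.endo_crd i P (y, w) (u, \<theta>) = (u, - (1 / a) *\<^sub>R (\<Sum>c\<in>Basis. S i (y, w) u c *\<^sub>R c) - \<theta>)"
proof -
  note lin = CT.endo_crd_linear[OF P CT_y(2,1)]
  obtain X where X: "X \<in> vector_fields N" "X p = chart_vec N i p u"
    "complete_lift N X (p, \<omega>) = chart_vec CT i (p, \<omega>) (u, 0)" "\<And>v. D p (chart_vec N i p v) X i = \<Gamma> i y v u"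
    using horizontal_field[of u] by blast
  obtain \<alpha> where \<alpha>: "\<alpha> \<in> one_forms N" "\<And>v. v \<in> tangent_space N p \<Longrightarrow> \<alpha> p v = \<theta> \<bullet> v i"
    "vlift_form N \<alpha> (p, \<omega>) = chart_vec CT i (p, \<omega>) (0, \<theta>)" using vertical_form[of \<theta>] by blast
  note ct = chart_vec_tangent[OF point(1)] and cs = chart_vec_self[OF point(1)]
  have con: "covec_crd N i p (\<lambda>v. \<omega> (nabla_endo D X p v)) = (\<Sum>c\<in>Basis. (w \<bullet> \<Gamma> i y u c) *\<^sub>R c)"
    unfolding covec_crd_def nabla_endo_def
    by (intro sum.cong refl) (simp add: omega_eval[OF connection_tangent[OF conn X(1) point(2) ct]] X(4) \<Gamma>_sym[OF i y])
  have "CT.endo_crd i P (y, w) (u, 0) = P (p, \<omega>) (complete_lift N X (p, \<omega>)) i"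
    unfolding CT.endo_crd_def point(7) X(3) ..
  also have "\<dots> = (u, 0) + 2 *\<^sub>R (0, \<Sum>c\<in>Basis. (w \<bullet> \<Gamma> i y u c) *\<^sub>R c) - ((b / a) * (w \<bullet> u)) *\<^sub>R (0, w)"
    using point(5) con point(8) CT.chart_vec_self[OF point(5)]
    unfolding fun_cong[OF P_complete[OF X(1) point(6)], of i]
    by (simp add: X(3) contracted_def liouville_def vertical_def vlift_def X(2) omega_eval[OF ct] cs)
  finally have 1: "CT.endo_crd i P (y, w) (u, 0)
    = (u, 2 *\<^sub>R (\<Sum>c\<in>Basis. (w \<bullet> \<Gamma> i y u c) *\<^sub>R c) - ((b / a) * (w \<bullet> u)) *\<^sub>R w)" by simp
  have "CT.endo_crd i P (y, w) (0, \<theta>) = P (p, \<omega>) (vlift_form N \<alpha> (p, \<omega>)) i"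
    unfolding CT.endo_crd_def point(7) \<alpha>(3) ..
  also have "\<dots> = - (0, \<theta>)"
    unfolding fun_cong[OF P_vertical[OF \<alpha>(1) point(6)], of i] using CT.chart_vec_self[OF point(5)] by (simp add: \<alpha>(3))
  finally have 2: "CT.endo_crd i P (y, w) (0, \<theta>) = (0, - \<theta>)" by simp
  have "- (1 / a) *\<^sub>R (\<Sum>c\<in>Basis. S i (y, w) u c *\<^sub>R c)
      = (\<Sum>c\<in>Basis. 2 *\<^sub>R ((w \<bullet> \<Gamma> i y u c) *\<^sub>R c) - ((b / a) * (w \<bullet> u)) *\<^sub>R ((w \<bullet> c) *\<^sub>R c))"
  proof -
    have "- (1 / a) * S i (y, w) u c = 2 * (w \<bullet> \<Gamma> i y u c) - (b / a) * (w \<bullet> u) * (w \<bullet> c)" for c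
      using a by (simp add: S_def field_simps)
    then show ?thesis by (simp only: scaleR_sum_right scaleR_scaleR scaleR_diff_left)
  qed
  also have "\<dots> = 2 *\<^sub>R (\<Sum>c\<in>Basis. (w \<bullet> \<Gamma> i y u c) *\<^sub>R c) - ((b / a) * (w \<bullet> u)) *\<^sub>R w"
    unfolding sum_subtractf scaleR_sum_right[symmetric] euclidean_representation ..
  finally show ?thesis
    using linear_add[OF lin, of "(u, 0)" "(0, \<theta>)"] 1 2 by simp
qed

end

lemma model:
  assumes i: "i \<in> Idx N" shows "riemann_model a (S i) (Img CT i)"
proof
  have img: "Img CT i = Img N i \<times> UNIV" by (rule CT_Img[OF i])
  show "a > 0" by (rule a)
  show o: "open (Img CT i)" using CT.open_Img[of i] i by simp
  show "bilinear (S i q)" if "q \<in> Img CT i" for q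
  proof -
    have y: "fst q \<in> Img N i" using that by (auto simp: img)
    note b = \<Gamma>_bilinear[OF i y]
    show ?thesis
      unfolding bilinear_def
      by (auto intro!: linearI simp: S_def bilinear_ladd[OF b] bilinear_lmul[OF b] bilinear_radd[OF b] bilinear_rmul[OF b]
          inner_add_right algebra_simps)
  qed
  show "S i q u v = S i q v u" if "q \<in> Img CT i" for q u v
    using that \<Gamma>_sym[OF i, of "fst q" u v] by (auto simp: S_def img)
  \<comment> \<open>The form \<open>S\<close> is the coefficient of \<open>g\<close> on horizontal
    coordinate vectors, so its smoothness comes from \<open>g\<close> and not from
    \<open>\<Gamma>\<close>.\<close>
  show "smooth_on (\<lambda>q. S i q u v) (Img CT i)" for u v
    by (rule smooth_on_eqI[OF o CT.bform_crd_smooth[OF g_bform, of i "(u, 0)" "(v, 0)"]])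
       (use i g_crd[OF i] in \<open>auto simp: img\<close>)
qed

lemma g_model: "i \<in> Idx N \<Longrightarrow> q \<in> Img CT i \<Longrightarrow> bform_crd CT i g q \<xi> \<eta> = riemann_model.G a (S i) q \<xi> \<eta>"
  using g_crd[of i "fst q" "snd q" "fst \<xi>" "snd \<xi>" "fst \<eta>" "snd \<eta>"]
  by (auto simp: riemann_model.G_def[OF model] CT_Img)

lemma P_model: "i \<in> Idx N \<Longrightarrow> q \<in> Img CT i \<Longrightarrow> CT.endo_crd i P q \<xi> = riemann_model.Pm a (S i) q \<xi>"
  using P_crd[of i "fst q" "snd q" "fst \<xi>" "snd \<xi>"]
  by (auto simp: riemann_model.Pm_def[OF model] riemann_model.sv_def[OF model] CT_Img)

text \<open>The difference of the two sides is \<open>-2a \<omega>(R(v, w) u)\<close>, since all terms with \<open>b\<close> cancel.\<close>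

lemma flat_nabla_Pm:
  assumes F: "flat N D" and i: "i \<in> Idx N" and q: "q \<in> Img CT i"
  shows "fd (\<lambda>z. S i z u w) q (v, - (1 / (2 * a)) *\<^sub>R riemann_model.sv (S i) q v)
    = fd (\<lambda>z. S i z u v) q (w, - (1 / (2 * a)) *\<^sub>R riemann_model.sv (S i) q w)"
proof -
  interpret m: riemann_model a "S i" "Img CT i" by (rule model[OF i])
  obtain y \<omega> where y: "q = (y, \<omega>)" "y \<in> Img N i" using q by (auto simp: CT_Img[OF i])
  have bil: "bilinear (\<Gamma> i y)" by (rule \<Gamma>_bilinear[OF i y(2)])
  \<comment> \<open>At the fibre point \<open>c\<close> of the basis, \<open>S\<close> determines
    the component \<open>\<Gamma> i z u v \<bullet> c\<close>. Solving for it transfers smoothness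
    from the metric to the connection coefficients.\<close>
  have sm: "smooth_on (\<lambda>z. \<Gamma> i z u v) (Img N i)" for u v
  proof -
    note o = open_Img[OF i]
    have "smooth_on (\<lambda>z. \<Sum>c\<in>Basis. (((b * (c \<bullet> u) * (c \<bullet> v)) - S i (z, c) u v) * (1 / (2 * a))) *\<^sub>R c) (Img N i)"
    proof (intro smooth_intros o finite_Basis)
      fix c :: 'e
      have zc: "smooth_on (\<lambda>z. (z, c)) (Img N i)" by (intro smooth_intros o)
      show "smooth_on (\<lambda>z. S i (z, c) u v) (Img N i)"
        by (rule smooth_on_compose[OF o m.Q _ zc m.smooth]) (auto simp: CT_Img[OF i])
    qed
    then show ?thesis
    proof (rule smooth_on_eqI[OF o])
      fix z
      have "(b * (c \<bullet> u) * (c \<bullet> v) - S i (z, c) u v) * (1 / (2 * a)) = \<Gamma> i z u v \<bullet> c" for c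
        using a by (simp add: S_def field_simps inner_commute)
      then show "\<Gamma> i z u v = (\<Sum>c\<in>Basis. ((b * (c \<bullet> u) * (c \<bullet> v) - S i (z, c) u v) * (1 / (2 * a))) *\<^sub>R c)"
        by (simp only: euclidean_representation)
    qed
  qed
  have dS: "fd (\<lambda>z. S i z u v) q (d, h) = - 2 * a * (h \<bullet> \<Gamma> i y u v + \<omega> \<bullet> fd (\<lambda>z. \<Gamma> i z u v) y d)
      + b * ((h \<bullet> u) * (\<omega> \<bullet> v) + (\<omega> \<bullet> u) * (h \<bullet> v))" for u v d h
  proof -
    have fst: "(fst has_derivative fst) (at q)" and snd: "(snd has_derivative snd) (at q)"
      by (auto intro!: derivative_eq_intros)
    have 1: "((\<lambda>z. \<Gamma> i (fst z) u v) has_derivative (\<lambda>k. fd (\<lambda>z. \<Gamma> i z u v) y (fst k))) (at q)"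
      using has_derivative_compose[OF fst, of "\<lambda>z. \<Gamma> i z u v"] smooth_on_has_derivative[OF sm y(2), of u v]
      by (simp add: y(1))
    have "((\<lambda>z. S i z u v) has_derivative (\<lambda>k. - 2 * a * (snd q \<bullet> fd (\<lambda>z. \<Gamma> i z u v) y (fst k) + snd k \<bullet> \<Gamma> i (fst q) u v)
        + ((b * (snd q \<bullet> u)) * (snd k \<bullet> v) + (b * (snd k \<bullet> u)) * (snd q \<bullet> v)))) (at q)"
      unfolding S_def
      by (intro has_derivative_add has_derivative_mult_right has_derivative_mult has_derivative_inner_left has_derivative_inner[OF snd 1] snd)
    from fd_eqI[OF this] show ?thesis by (simp add: y(1) algebra_simps)
  qed
  \<comment> \<open>Writing \<open>b\<close> as \<open>2 * a * k\<close> gives all terms the common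
    factor \<open>2 * a\<close>.\<close>
  define k where "k = b / (2 * a)"
  have b: "b * t = 2 * a * (k * t)" for t using a by (simp add: k_def)
  let ?h = "\<lambda>v. - (1 / (2 * a)) *\<^sub>R m.sv q v"
  have h: "?h v \<bullet> x = \<omega> \<bullet> \<Gamma> i y v x - k * (\<omega> \<bullet> v) * (\<omega> \<bullet> x)" for v x
  proof -
    have "?h v \<bullet> x = - (1 / (2 * a)) * S i q v x" by (simp add: m.sv_inner[OF q])
    also have "\<dots> = \<omega> \<bullet> \<Gamma> i y v x - k * (\<omega> \<bullet> v) * (\<omega> \<bullet> x)"
      using a by (simp add: S_def y(1) k_def field_simps)
    finally show ?thesis .
  qed
  note s = \<Gamma>_sym[OF i y(2)]
  have "\<omega> \<bullet> (fd (\<lambda>z. \<Gamma> i z w u) y v + \<Gamma> i y v (\<Gamma> i y w u)) = \<omega> \<bullet> (fd (\<lambda>z. \<Gamma> i z v u) y w + \<Gamma> i y w (\<Gamma> i y v u))"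
    using flat_coeffs[OF conn tf F \<Gamma>[OF i] i y(2), of w u v] by simp
  moreover have "fd (\<lambda>z. \<Gamma> i z x u) y = fd (\<lambda>z. \<Gamma> i z u x) y" for x
    by (rule fd_cong_open[OF open_Img[OF i] y(2)]) (rule \<Gamma>_sym[OF i])
  ultimately have R: "\<omega> \<bullet> fd (\<lambda>z. \<Gamma> i z u w) y v + \<omega> \<bullet> \<Gamma> i y v (\<Gamma> i y u w)
      = \<omega> \<bullet> fd (\<lambda>z. \<Gamma> i z u v) y w + \<omega> \<bullet> \<Gamma> i y w (\<Gamma> i y u v)"
    by (simp add: inner_add_right s[of w u] s[of v u])
  \<comment> \<open>Flatness equates the terms free of \<open>k\<close>. All remaining terms carry
    \<open>k\<close> and form an expression symmetric in \<open>u\<close>, \<open>v\<close> and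
    \<open>w\<close>, so they agree on both sides.\<close>
  have "2 * a * (\<omega> \<bullet> fd (\<lambda>z. \<Gamma> i z u w) y v + \<omega> \<bullet> \<Gamma> i y v (\<Gamma> i y u w))
      = 2 * a * (\<omega> \<bullet> fd (\<lambda>z. \<Gamma> i z u v) y w + \<omega> \<bullet> \<Gamma> i y w (\<Gamma> i y u v))" using R by simp
  then show ?thesis
    unfolding dS h s[of v u] s[of w u] s[of w v] b by (simp add: algebra_simps)
qed

section \<open>Global properties of the structure\<close>

lemma carrier_nonempty: "carrier CT \<noteq> {}"
  using CT.manifold by (simp add: smooth_manifold_def)

lemma P_chart:
  assumes "i \<in> charts_at CT q" "v \<in> tangent_space CT q"
  shows "P q v i = riemann_model.Pm a (S i) (Crd CT i q) (v i)"
  using CT.endo_chart[OF assms, of P] P_model[of i "Crd CT i q"] assms(1) CT.Crd_Img[of q i]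
  by (simp add: CT.charts_at_iff)

lemma g_chart:
  assumes "i \<in> charts_at CT q" "u \<in> tangent_space CT q" "v \<in> tangent_space CT q"
  shows "g q u v = riemann_model.G a (S i) (Crd CT i q) (u i) (v i)"
  using CT.bform_chart[OF assms, of g] g_model[of i "Crd CT i q"] assms(1) CT.Crd_Img[of q i]
  by (simp add: CT.charts_at_iff)

lemma P_tangent: "q \<in> carrier CT \<Longrightarrow> v \<in> tangent_space CT q \<Longrightarrow> P q v \<in> tangent_space CT q"
  by (rule CT.endo_tangent[OF P])

text \<open>Both ranges are injective linear images of the model space of the base, which is how the
  eigenspaces are seen to have equal rank.\<close>

lemma P_eigenspaces:
  assumes i: "i \<in> charts_at CT q"
  defines "y \<equiv> Crd CT i q"
  shows "(\<lambda>v. v i) ` {v \<in> tangent_space CT q. P q v = v} = range (\<lambda>u. (u, - (1 / (2 * a)) *\<^sub>R riemann_model.sv (S i) y u))"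
    and "(\<lambda>v. v i) ` {v \<in> tangent_space CT q. P q v = (\<lambda>j. - v j)} = range (\<lambda>\<theta>. (0, \<theta>))"
proof -
  have iN: "i \<in> Idx N" "q \<in> Dom CT i" using i by (simp_all add: CT.charts_at_iff)
  interpret m: riemann_model a "S i" "Img CT i" by (rule model[OF iN(1)])
  have qc: "q \<in> carrier CT" using CT.Dom_carrier iN by (metis CT_simps(1))
  have yI: "y \<in> Img CT i" unfolding y_def by (rule CT.Crd_Img[OF iN(2)])
  \<comment> \<open>A general eigenvalue \<open>r\<close> lets one transfer to the chart serve both
    1 and -1.\<close>
  have img: "(\<lambda>v. v i) ` {v \<in> tangent_space CT q. P q v = (\<lambda>j. r *\<^sub>R v j)} = {\<xi>. m.Pm y \<xi> = r *\<^sub>R \<xi>}" for r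
  proof (intro equalityI subsetI)
    fix \<xi> assume "\<xi> \<in> (\<lambda>v. v i) ` {v \<in> tangent_space CT q. P q v = (\<lambda>j. r *\<^sub>R v j)}"
    then obtain v where v: "v \<in> tangent_space CT q" "P q v = (\<lambda>j. r *\<^sub>R v j)" "\<xi> = v i" by blast
    then show "\<xi> \<in> {\<xi>. m.Pm y \<xi> = r *\<^sub>R \<xi>}" using P_chart[OF i v(1)] by (simp add: y_def)
  next
    fix \<xi> assume \<xi>: "\<xi> \<in> {\<xi>. m.Pm y \<xi> = r *\<^sub>R \<xi>}"
    let ?v = "chart_vec CT i q \<xi>"
    note vt = CT.chart_vec_tangent[OF i, of \<xi>] and vi = CT.chart_vec_self[OF i, of \<xi>]
    have "P q ?v = (\<lambda>j. r *\<^sub>R ?v j)"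
      using \<xi> P_chart[OF i vt] by (intro CT.tangent_eqI[OF P_tangent[OF qc vt] CT.scale_tangent[OF vt] i]) (simp add: vi y_def)
    then have "?v \<in> {v \<in> tangent_space CT q. P q v = (\<lambda>j. r *\<^sub>R v j)}" using vt by blast
    from imageI[OF this, of "\<lambda>v. v i"]
    show "\<xi> \<in> (\<lambda>v. v i) ` {v \<in> tangent_space CT q. P q v = (\<lambda>j. r *\<^sub>R v j)}" unfolding vi .
  qed
  have "{\<xi>. m.Pm y \<xi> = 1 *\<^sub>R \<xi>} = range (\<lambda>u. (u, - (1 / (2 * a)) *\<^sub>R m.sv y u))"
  proof -
    have "m.Pm y (u, \<theta>) = (u, \<theta>) \<longleftrightarrow> \<theta> = - (1 / (2 * a)) *\<^sub>R m.sv y u" for u \<theta>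
    proof -
      have "- (1 / a) *\<^sub>R m.sv y u - \<theta> = \<theta> \<longleftrightarrow> - (1 / a) *\<^sub>R m.sv y u = 2 *\<^sub>R \<theta>"
        by (auto simp: scaleR_2 diff_eq_eq)
      also have "\<dots> \<longleftrightarrow> \<theta> = (1 / 2) *\<^sub>R (- (1 / a) *\<^sub>R m.sv y u)"
      proof -
        have "X = 2 *\<^sub>R \<theta> \<longleftrightarrow> \<theta> = (1 / 2) *\<^sub>R X" for X by auto
        then show ?thesis by blast
      qed
      finally show ?thesis by (simp add: m.Pm_def)
    qed
    then show ?thesis by auto
  qed
  then show "(\<lambda>v. v i) ` {v \<in> tangent_space CT q. P q v = v} = range (\<lambda>u. (u, - (1 / (2 * a)) *\<^sub>R m.sv y u))"
    using img[of 1] by simp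
  have "{\<xi>. m.Pm y \<xi> = (- 1) *\<^sub>R \<xi>} = range (\<lambda>\<theta>. (0, \<theta>))"
  proof -
    have eig: "m.Pm y (u, \<theta>) = (- u, - \<theta>) \<longleftrightarrow> u = 0" for u \<theta>
    proof -
      have "u = - u \<longleftrightarrow> u = 0"
        by (metis eq_neg_iff_add_eq_0 scaleR_2 scale_eq_0_iff zero_neq_numeral)
      then show ?thesis using linear_0[OF m.linear_sv[OF yI]] by (auto simp: m.Pm_def)
    qed
    have "m.Pm y \<xi> = (- 1) *\<^sub>R \<xi> \<longleftrightarrow> fst \<xi> = 0" for \<xi>
      using eig[of "fst \<xi>" "snd \<xi>"] by (simp add: uminus_prod_def)
    then have "{\<xi>. m.Pm y \<xi> = (- 1) *\<^sub>R \<xi>} = {\<xi>. fst \<xi> = 0}" by blast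
    also have "\<dots> = range (\<lambda>\<theta>. (0, \<theta>))" by force
    finally show ?thesis .
  qed
  then show "(\<lambda>v. v i) ` {v \<in> tangent_space CT q. P q v = (\<lambda>j. - v j)} = range (\<lambda>\<theta>. (0, \<theta>))"
    using img[of "-1"] by simp
qed

lemma almost_para_complex: "almost_para_complex CT P"
  unfolding almost_para_complex_def
proof (intro conjI ballI P)
  obtain q where q: "q \<in> carrier CT" using carrier_nonempty by blast
  obtain i where i: "i \<in> charts_at CT q" using CT.chart_at_mem[OF q] by blast
  have iN: "i \<in> Idx N" "Crd CT i q \<in> Img CT i" using i CT.Crd_Img by (auto simp: CT.charts_at_iff)
  interpret m: riemann_model a "S i" "Img CT i" by (rule model[OF iN(1)])
  obtain c :: 'e where c: "c \<noteq> 0" using nonzero_Basis SOME_Basis by blast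
  note t = CT.chart_vec_tangent[OF i] and s = CT.chart_vec_self[OF i]
  have c': "c \<noteq> - c" "- c \<noteq> c" using c by (metis neg_equal_0_iff_equal scaleR_2 scale_eq_0_iff add.left_inverse zero_neq_numeral)+
  \<comment> \<open>A nonzero vertical vector is reversed, which excludes the identity; a vector
    with nonzero base part keeps that part, which excludes its negative.\<close>
  have "P q (chart_vec CT i q (0, c)) i \<noteq> chart_vec CT i q (0, c) i"
    unfolding P_chart[OF i t] s m.Pm_def using c' linear_0[OF m.linear_sv[OF iN(2)]] by simp
  then show "\<exists>p\<in>carrier CT. \<exists>v\<in>tangent_space CT p. P p v \<noteq> v" using q t by metis
  have "P q (chart_vec CT i q (c, 0)) i \<noteq> - chart_vec CT i q (c, 0) i"
    unfolding P_chart[OF i t] s m.Pm_def using c' by simp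
  then show "\<exists>p\<in>carrier CT. \<exists>v\<in>tangent_space CT p. P p v \<noteq> (\<lambda>i. - v i)" using q t by metis
next
  fix q v assume q: "q \<in> carrier CT" and v: "v \<in> tangent_space CT q"
  obtain i where i: "i \<in> charts_at CT q" using CT.chart_at_mem[OF q] by blast
  have iN: "i \<in> Idx N" "Crd CT i q \<in> Img CT i" using i CT.Crd_Img by (auto simp: CT.charts_at_iff)
  note Pt = P_tangent[OF q v]
  show "P q (P q v) = v"
    by (rule CT.tangent_eqI[OF P_tangent[OF q Pt] v i])
       (simp add: P_chart[OF i Pt] P_chart[OF i v] riemann_model.Pm_Pm[OF model iN(2)] iN)
next
  fix q i assume i: "i \<in> charts_at CT q"
  have iN: "i \<in> Idx N" "Crd CT i q \<in> Img CT i" using i CT.Crd_Img by (auto simp: CT.charts_at_iff)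
  have l: "linear (\<lambda>u. (u, - (1 / (2 * a)) *\<^sub>R riemann_model.sv (S i) (Crd CT i q) u))"
    using riemann_model.linear_sv[OF model[OF iN(1)] iN(2)]
    by (auto intro!: linearI simp: linear_add linear_scale scaleR_diff_right algebra_simps)
  have l': "linear (\<lambda>\<theta>. (0 :: 'e, \<theta> :: 'e))" by (auto intro!: linearI)
  show "dim ((\<lambda>v. v i) ` {v \<in> tangent_space CT q. P q v = v})
      = dim ((\<lambda>v. v i) ` {v \<in> tangent_space CT q. P q v = (\<lambda>j. - v j)})"
  proof -
    have "dim (range (\<lambda>u. (u, - (1 / (2 * a)) *\<^sub>R riemann_model.sv (S i) (Crd CT i q) u))) = dim (UNIV :: 'e set)"
      by (rule dim_image_eq[OF l]) (auto simp: inj_on_def)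
    moreover have "dim (range (\<lambda>\<theta>. (0 :: 'e, \<theta> :: 'e))) = dim (UNIV :: 'e set)"
      by (rule dim_image_eq[OF l']) (auto simp: inj_on_def)
    ultimately show ?thesis unfolding P_eigenspaces[OF i] by simp
  qed
qed

lemma almost_para_hermitian: "almost_para_hermitian CT P g"
  unfolding almost_para_hermitian_def
proof (intro conjI ballI CT.manifold almost_para_complex g_metric)
  fix q u v assume q: "q \<in> carrier CT" and t: "u \<in> tangent_space CT q" "v \<in> tangent_space CT q"
  obtain i where i: "i \<in> charts_at CT q" using CT.chart_at_mem[OF q] by blast
  have iN: "i \<in> Idx N" "Crd CT i q \<in> Img CT i" using i CT.Crd_Img by (auto simp: CT.charts_at_iff)
  show "g q (P q u) (P q v) = - g q u v"
    using t q by (simp add: g_chart[OF i] P_tangent P_chart[OF i] riemann_model.G_Pm_Pm[OF model iN(2)] iN)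
qed

text \<open>The fundamental form is \<open>a\<close> times the canonical symplectic form of the cotangent bundle.\<close>

lemma almost_para_kaehler: "almost_para_kaehler CT P g"
  unfolding almost_para_kaehler_def
proof (intro conjI ballI almost_para_hermitian)
  fix X Y Z q assume XYZ: "X \<in> vector_fields CT" "Y \<in> vector_fields CT" "Z \<in> vector_fields CT" and q: "q \<in> carrier CT"
  obtain i where i: "i \<in> charts_at CT q" using CT.chart_at_mem[OF q] by blast
  have iN: "i \<in> Idx N" using i by (auto simp: CT.charts_at_iff)
  let ?A = "\<lambda>\<xi> \<eta> :: 'e \<times> 'e. a * (snd \<xi> \<bullet> fst \<eta> - snd \<eta> \<bullet> fst \<xi>)"
  show "ext_deriv2 CT (fundamental_form P g) X Y Z q = 0"
  proof (rule CT.ext_deriv2_constant_coeffs[OF _ _ _ i XYZ, of ?A])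
    show "bilinear ?A"
      unfolding bilinear_def by (auto intro!: linearI simp: inner_add_left inner_add_right algebra_simps)
    show "?A u v = - ?A v u" for u v by (simp add: algebra_simps)
    fix r u v assume r: "r \<in> Dom CT i" and t: "u \<in> tangent_space CT r" "v \<in> tangent_space CT r"
    have ir: "i \<in> charts_at CT r" using r iN by (simp add: CT.charts_at_iff)
    have rc: "r \<in> carrier CT" using CT.Dom_carrier r iN by (metis CT_simps(1))
    show "fundamental_form P g r u v = ?A (u i) (v i)"
      using t rc by (simp add: fundamental_form_def g_chart[OF ir] P_tangent P_chart[OF ir]
          riemann_model.G_Pm[OF model[OF iN] CT.Crd_Img[OF r]])
  qed
qed

text \<open>By Koszul's formula the coefficients of any Levi-Civita connection satisfy the
  hypotheses of \<open>nabla_Pm\<close>, and for a flat base the difference on its right-hand side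
  vanishes.\<close>

lemma para_kaehler: assumes F: "flat N D" shows "para_kaehler CT P g"
  unfolding para_kaehler_def parallel_endo_def
proof (intro conjI allI impI ballI almost_para_hermitian)
  fix D' q v Y
  assume D': "levi_civita_connection CT g D'" and q: "q \<in> carrier CT" and v: "v \<in> tangent_space CT q"
    and Y: "Y \<in> vector_fields CT"
  have lin: "linear_connection CT D'" using D' by (simp add: levi_civita_connection_def)
  obtain i where i: "i \<in> charts_at CT q" using CT.chart_at_mem[OF q] by blast
  have iN: "i \<in> Idx N" "q \<in> Dom CT i" "i \<in> Idx CT" using i by (simp_all add: CT.charts_at_iff)
  define y where "y = Crd CT i q"
  have y: "y \<in> Img CT i" unfolding y_def by (rule CT.Crd_Img[OF iN(2)])
  interpret m: riemann_model a "S i" "Img CT i" by (rule model[OF iN(1)])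
  obtain G' where G': "CT.connection_coeffs D' i G'" using CT.connection_coeffs_exist[OF lin iN(3)] by blast
  have G'_eq: "D' q v X i = fd (vfield_crd CT i X) y (v i) + G' y (v i) (X q i)" if "X \<in> vector_fields CT" for X
    using G' that v iN(2) unfolding CT.connection_coeffs_def y_def by blast
  have Gm: "bform_crd CT i g z \<xi> \<eta> = m.G z \<xi> \<eta>" if "z \<in> Img CT i" for z \<xi> \<eta> by (rule g_model[OF iN(1) that])
  have kz: "koszul (bform_crd CT i g) y \<xi> \<eta> r = koszul m.G y \<xi> \<eta> r" for \<xi> \<eta> r
    unfolding koszul_def using fd_cong_open[OF m.Q y Gm] by simp
  have K: "2 * m.G y (G' y \<xi> \<eta>) r = koszul m.G y \<xi> \<eta> r" for \<xi> \<eta> r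
    using CT.levi_civita_koszul[OF g_bform D' _ G' iN(3) y, of \<xi> \<eta> r] m.G_symmetric[OF y]
    by (simp add: Gm[OF y] kz)
  let ?PY = "endo_apply CT P Y"
  have PY: "?PY \<in> vector_fields CT" by (rule CT.endo_apply_vfield[OF P Y])
  note Yt = CT.vfield_tangent[OF Y q]
  have PYq: "?PY q i = m.Pm y (Y q i)"
    using q by (simp add: endo_apply_def P_chart[OF i Yt] y_def)
  have eq: "vfield_crd CT i ?PY z = m.Pm z (vfield_crd CT i Y z)" if z: "z \<in> Img CT i" for z
  proof -
    have iz: "i \<in> charts_at CT (Prm CT i z)" using iN z by (simp add: CT.charts_at_iff CT.Prm_Dom)
    have zc: "Prm CT i z \<in> carrier CT" by (rule CT.Prm_carrier[OF iN(3) z])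
    show ?thesis
      using zc P_chart[OF iz CT.vfield_tangent[OF Y zc]] by (simp add: vfield_crd_def endo_apply_def CT.Crd_Prm[OF z])
  qed
  have Yq: "vfield_crd CT i Y y = Y q i" by (simp add: vfield_crd_def y_def CT.Prm_Crd[OF iN(3,2)])
  have linP: "linear (m.Pm z)" if "z \<in> Img CT i" for z
  proof -
    have "CT.endo_crd i P z = m.Pm z" 
    proof
      show "CT.endo_crd i P z x = m.Pm z x" for x using P_model[OF iN(1) that, of x] by simp
    qed
    then show ?thesis using CT.endo_crd_linear[OF P iN(3) that] by simp
  qed
  have Pd: "(\<lambda>z. m.Pm z c) differentiable at y" for c
  proof -
    have "smooth_on (\<lambda>z. m.Pm z c) (Img CT i)"
      by (rule smooth_on_eqI[OF m.Q CT.endo_crd_smooth[OF P iN(3), of c]]) (simp add: P_model[OF iN(1)])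
    then show ?thesis using y by (rule smooth_on_differentiable)
  qed
  have H: "((\<lambda>z. m.Pm z (vfield_crd CT i Y z)) has_derivative
      (\<lambda>d. fd (\<lambda>z. m.Pm z (vfield_crd CT i Y y)) y d + m.Pm y (fd (vfield_crd CT i Y) y d))) (at y)"
    by (rule has_derivative_linear_family[where f = "\<lambda>z. z" and L = m.Pm, OF m.Q y has_derivative_ident
          smooth_on_has_derivative[OF CT.vfield_smooth[OF Y iN(3)] y] Pd linP])
  have d: "fd (vfield_crd CT i ?PY) y (v i) = fd (\<lambda>z. m.Pm z (Y q i)) y (v i) + m.Pm y (fd (vfield_crd CT i Y) y (v i))"
    using fd_cong_open[of "Img CT i" y "vfield_crd CT i ?PY" "\<lambda>z. m.Pm z (vfield_crd CT i Y z)", OF m.Q y eq]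
      fd_eqI[OF H] by (simp add: Yq)
  \<comment> \<open>The derivatives of the components of \<open>Y\<close> cancel between
    \<open>\<nabla>(P Y)\<close> and \<open>P \<nabla>Y\<close>, so only this algebraic expression
    in the value of \<open>Y\<close> at \<open>q\<close> has to vanish.\<close>
  have "fd (\<lambda>z. m.Pm z (Y q i)) y (v i) + G' y (v i) (m.Pm y (Y q i)) - m.Pm y (G' y (v i) (Y q i)) = 0"
    unfolding m.nabla_Pm[OF y K K] flat_nabla_Pm[OF F iN(1) y] by (simp add: zero_prod_def)
  then have "D' q v ?PY i = m.Pm y (D' q v Y i)"
    unfolding G'_eq[OF PY] G'_eq[OF Y] PYq d linear_add[OF linP[OF y]] by (simp add: algebra_simps)
  note Dt = CT.connection_tangent[OF lin Y q v]
  show "D' q v ?PY = P q (D' q v Y)"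
    by (rule CT.tangent_eqI[OF CT.connection_tangent[OF lin PY q v] P_tangent[OF q Dt] i])
       (simp add: P_chart[OF i Dt] y_def[symmetric] \<open>D' q v ?PY i = _\<close>)
qed

text \<open>The general criterion asks for \<open>\<nabla>P\<close> only on pairs of a basis vector
  and its dual vector, and one member of each pair is vertical. The Christoffel vectors of
  \<open>g\<close> satisfy Koszul's identity, so \<open>nabla_Pm_vertical\<close> applies without
  any curvature condition.\<close>

lemma harmonic: "harmonic_endo CT g P"
proof (rule CT.harmonic_endoI[OF g_bform _ _ P])
  fix i y assume i': "i \<in> Idx CT" and y: "y \<in> Img CT i"
  then have i: "i \<in> Idx N" by simp
  interpret m: riemann_model a "S i" "Img CT i" by (rule model[OF i])
  have Gm: "bform_crd CT i g z \<xi> \<eta> = m.G z \<xi> \<eta>" if "z \<in> Img CT i" for z \<xi> \<eta> by (rule g_model[OF i that])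
  have Gy: "bform_crd CT i g y = m.G y" using Gm[OF y] by blast
  show "bform_crd CT i g y u v = bform_crd CT i g y v u" for u v
    unfolding Gy by (rule m.G_symmetric[OF y])
  show "nondegenerate (bform_crd CT i g y)" unfolding Gy by (rule m.G_nondegenerate[OF y])
  have kz: "koszul (bform_crd CT i g) y \<xi> \<eta> r = koszul m.G y \<xi> \<eta> r" for \<xi> \<eta> r
    unfolding koszul_def using fd_cong_open[OF m.Q y Gm] by simp
  have chr: "christoffel (bform_crd CT i g) y \<xi> \<eta> = christoffel m.G y \<xi> \<eta>" for \<xi> \<eta>
    unfolding christoffel_koszul Gy kz ..
  have K: "2 * m.G y (christoffel m.G y \<xi> \<eta>) r = koszul m.G y \<xi> \<eta> r" for \<xi> \<eta> r
    by (rule christoffel_property_all[of m.G y, OF m.G_bilinear[OF y] m.G_nondegenerate[OF y]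
          linear_koszul[of "Img CT i" y m.G, OF m.Q y m.G_bilinear smooth_on_differentiable[OF m.G_smooth y]]])
  have nab: "CT.nabla_endo_crd g P i y \<xi> \<eta> = 0" if "fst \<xi> = 0 \<or> fst \<eta> = 0" for \<xi> \<eta>
  proof -
    have "fd (\<lambda>z. CT.endo_crd i P z \<eta>) y = fd (\<lambda>z. m.Pm z \<eta>) y"
      by (rule fd_cong_open[OF m.Q y P_model[OF i]])
    then show ?thesis
      using m.nabla_Pm_vertical[OF y K K that] by (simp add: CT.nabla_endo_crd_def chr P_model[OF i y])
  qed
  show "CT.nabla_endo_crd g P i y c (sharp (bform_crd CT i g y) c) = 0 \<and>
      CT.nabla_endo_crd g P i y (sharp (bform_crd CT i g y) c) c = 0" if c: "c \<in> Basis" for c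
    using m.sharp_vertical[OF y c] unfolding Gy by (auto intro!: nab)
qed

end

theorem theorem3p1:
  fixes M :: "('i, 'm, real ^ 'n) atlas"
    and D :: "('i, 'm, real ^ 'n) conn"
    and a b :: real
    and g :: "('i, 'm \<times> ('i, real ^ 'n) covec, (real ^ 'n) \<times> (real ^ 'n)) bform"
    and P :: "('i, 'm \<times> ('i, real ^ 'n) covec, (real ^ 'n) \<times> (real ^ 'n)) endo"
  assumes "CARD('n) \<ge> 2"
    and "smooth_manifold M" and "connected_space (atlas_topology M)"
    and "linear_connection M D" and "torsion_free M D"
    and "a > 0" and "b \<noteq> 0"
    and "natural_riemann_extension M D a b g"
    and "endo_field (cotangent_bundle M) P"
    and "\<And>X q. X \<in> vector_fields M \<Longrightarrow> q \<in> carrier (cotangent_bundle M) \<Longrightarrow>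
           P q (complete_lift M X q) =
             (\<lambda>i. complete_lift M X q i + 2 *\<^sub>R contracted M (nabla_endo D X) q i
                  - ((b / a) * vlift X q) *\<^sub>R liouville M q i)"
    and "\<And>\<alpha> q. \<alpha> \<in> one_forms M \<Longrightarrow> q \<in> carrier (cotangent_bundle M) \<Longrightarrow>
           P q (vlift_form M \<alpha> q) = (\<lambda>i. - vlift_form M \<alpha> q i)"
  shows "almost_para_hermitian (cotangent_bundle M) P g \<and>
         (\<not> flat M D \<longrightarrow> almost_para_kaehler (cotangent_bundle M) P g) \<and>
         (flat M D \<longrightarrow> para_kaehler (cotangent_bundle M) P g) \<and>
         harmonic_endo (cotangent_bundle M) g P"
proof -
  interpret natural_riemann M D a b g P
    by unfold_locales (use assms in blast)+
  show ?thesis using almost_para_hermitian almost_para_kaehler para_kaehler harmonic by blast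
qed

end
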